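(* Let $d\in\mathbb{N}$ and let $\Theta=[\nu_{\min},\nu_{\max}]$ with $0<\nu_{\min}\le\nu_{\max}<\infty$ and $\nu_{\max}>d/2$. Let $K_\nu$, $\nu\in\Theta$, be the Matérn kernels on $\mathbb{R}^d$ with fixed $\sigma,\lambda>0$ and positive scaling factor $c(\nu)$, and suppose that $\inf_{\nu\in[\nu_{\min},\nu_{\max}]}c(\nu)>0$. Suppose that $\Omega\subset\mathbb{R}^d$ is a bounded connected open set which satisfies an interior cone condition and has a Lipschitz boundary, and that $\{x_i\}_{i=1}^\infty\subset\Omega$ is a sequence of pairwise distinct points that is quasi-uniform on $\Omega$. If $f_0$ is a version of a zero-mean Gaussian process with the Matérn covariance kernel $K_{\nu_0}$ for some $\nu_0\in(d/2,\nu_{\max}]$ such that almost all of its samples are continuous, then $$\liminf_{n\to\infty}\hat\nu_{\mathrm{ML}}^{f_0}(X_n)\ge\nu_0\quad\text{and}\quad\liminf_{n\to\infty}\hat\nu_{\mathrm{CV}}^{f_0}(X_n)\ge\nu_0-\frac d2\quad\text{almost surely}.$$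
   Context: Matérn kernels: $\sigma,\lambda>0$ are fixed, $c(\nu)>0$ is a scaling factor, and for $\nu>0$, $x,y\in\mathbb{R}^d$, $$K_\nu(x,y)=\sigma^2c(\nu)\Big(\tfrac{\sqrt{2\nu}\,\|x-y\|}{\lambda}\Big)^{\nu}\mathcal K_\nu\Big(\tfrac{\sqrt{2\nu}\,\|x-y\|}{\lambda}\Big),$$ where $\mathcal K_\nu$ is the modified Bessel function of the second kind of order $\nu$, $\|\cdot\|$ is the Euclidean norm, and the value at $x=y$ is defined by continuity. $K_\nu$ is symmetric and strictly positive-definite. Notation: $X_n=\{x_i\}_{i=1}^n$, $X_n^i=X_n\setminus\{x_i\}$, $f_0(X)$ is the column vector of values of $f_0$ at the points of $X$, $K_\nu(X)$ is the matrix with entries $K_\nu(x_i,x_j)$, $x_i,x_j\in X$, and $K_\nu(x,X)$ is the column vector with entries $K_\nu(x,x_i)$. The conditional mean and variance are $$\mu_{\nu,f_0}(x\mid X)=K_\nu(x,X)^{\mathsf T}K_\nu(X)^{-1}f_0(X),\qquad \mathbb V_\nu(x\mid X)=K_\nu(x,x)-K_\nu(x,X)^{\mathsf T}K_\nu(X)^{-1}K_\nu(x,X),$$ with $\mu_{\nu,f_0}(x\mid\emptyset)=0$ and $\mathbb V_\nu(x\mid\emptyset)=K_\nu(x,x)$. Estimators: $\hat\nu_{\mathrm{ML}}^{f_0}(X_n)$ is any minimiser over $\nu\in\Theta$ of $$\ell_{\mathrm{ML}}^{f_0}(\nu\mid X_n)=f_0(X_n)^{\mathsf T}K_\nu(X_n)^{-1}f_0(X_n)+\log\det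 K_\nu(X_n),$$ and $\hat\nu_{\mathrm{CV}}^{f_0}(X_n)$ is any minimiser over $\nu\in\Theta$ of $$\ell_{\mathrm{CV}}^{f_0}(\nu\mid X_n)=\sum_{i=1}^n\Big[\frac{(f_0(x_i)-\mu_{\nu,f_0}(x_i\mid X_n^i))^2}{\mathbb V_\nu(x_i\mid X_n^i)}+\log\mathbb V_\nu(x_i\mid X_n^i)\Big].$$ Here the estimators are computed sample-wise. Minimisers are assumed to exist; results hold for an arbitrary choice of minimisers. Quasi-uniformity: with fill-distance $h_{n,\Omega}=\sup_{x\in\Omega}\min_{1\le i\le n}\|x-x_i\|$ and separation radius $q_n=\frac12\min_{1\le i\ne j\le n}\|x_i-x_j\|$, the sequence is quasi-uniform on $\Omega$ if there is a constant $c_{\mathrm{qu}}>0$ with $q_n\le h_{n,\Omega}\le c_{\mathrm{qu}}q_n$ for every $n\ge2$. Interior cone condition: there are an angle in $(0,\pi/2)$ and a radius $r>0$ such that every $x\in\Omega$ is the vertex of a cone of that angle and radius contained in $\Omega$. *)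

theory Defs
  imports
    "HOL-Probability.Probability"
    "Jordan_Normal_Form.Gauss_Jordan_Elimination"
    "Jordan_Normal_Form.Determinant"
begin

section \<open>Matern kernels\<close>

text \<open>
  The modified Bessel function of the second kind of order \<open>\<nu>\<close>, defined for \<open>z > 0\<close> by its
  classical integral representation.
\<close>

definition bessel_K :: "real \<Rightarrow> real \<Rightarrow> real" where
  "bessel_K \<nu> z = (LBINT t:{0..}. exp (- z * cosh t) * cosh (\<nu> * t))"

text \<open>
  The function \<open>z\<^sup>\<nu> K\<^sub>\<nu>(z)\<close>, extended by continuity to \<open>z = 0\<close>
  (there, its value is \<open>2 powr (\<nu> - 1) * Gamma \<nu>\<close> when \<open>\<nu> > 0\<close>).
\<close>

definition matern_profile :: "real \<Rightarrow> real \<Rightarrow> real" where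
  "matern_profile \<nu> z =
     (if z = 0 then Lim (at_right 0) (\<lambda>u. u powr \<nu> * bessel_K \<nu> u)
      else z powr \<nu> * bessel_K \<nu> z)"

definition matern ::
    "real \<Rightarrow> real \<Rightarrow> (real \<Rightarrow> real) \<Rightarrow> real \<Rightarrow> 'p::real_normed_vector \<Rightarrow> 'p \<Rightarrow> real" where
  "matern \<sigma> l c \<nu> x y = \<sigma>\<^sup>2 * c \<nu> * matern_profile \<nu> (sqrt (2 * \<nu>) * norm (x - y) / l)"


section \<open>Conditional moments and the two estimation criteria\<close>

text \<open>
  A finite set of points is given by a list of its distinct elements, so that matrices and vectors
  over it can be indexed by natural numbers.
\<close>

definition data_vec :: "('p \<Rightarrow> real) \<Rightarrow> 'p list \<Rightarrow> real Matrix.vec" where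
  "data_vec f xs = vec_of_list (map f xs)"

definition kernel_mat :: "('p \<Rightarrow> 'p \<Rightarrow> real) \<Rightarrow> 'p list \<Rightarrow> real Matrix.mat" where
  "kernel_mat k xs = Matrix.mat (length xs) (length xs) (\<lambda>(i, j). k (xs ! i) (xs ! j))"

definition kernel_vec :: "('p \<Rightarrow> 'p \<Rightarrow> real) \<Rightarrow> 'p \<Rightarrow> 'p list \<Rightarrow> real Matrix.vec" where
  "kernel_vec k x xs = vec_of_list (map (k x) xs)"

text \<open>Only meaningful for invertible \<open>A\<close>; kernel matrices are, by strict positive-definiteness.\<close>

definition inverse_mat :: "real Matrix.mat \<Rightarrow> real Matrix.mat" where
  "inverse_mat A = the (mat_inverse A)"

definition cond_mean :: "('p \<Rightarrow> 'p \<Rightarrow> real) \<Rightarrow> ('p \<Rightarrow> real) \<Rightarrow> 'p list \<Rightarrow> 'p \<Rightarrow> real" where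
  "cond_mean k f xs x =
     scalar_prod (kernel_vec k x xs) (inverse_mat (kernel_mat k xs) *\<^sub>v data_vec f xs)"

definition cond_var :: "('p \<Rightarrow> 'p \<Rightarrow> real) \<Rightarrow> 'p list \<Rightarrow> 'p \<Rightarrow> real" where
  "cond_var k xs x =
     k x x - scalar_prod (kernel_vec k x xs) (inverse_mat (kernel_mat k xs) *\<^sub>v kernel_vec k x xs)"

text \<open>The conventions for conditioning on the empty set hold automatically.\<close>

lemma inverse_kernel_mat_Nil: "inverse_mat (kernel_mat k []) \<in> carrier_mat 0 0"
proof -
  have A: "kernel_mat k [] = 1\<^sub>m 0" "kernel_mat k [] \<in> carrier_mat 0 0"
    by (auto simp: kernel_mat_def)
  have "1\<^sub>m 0 \<in> Units (ring_mat TYPE(real) 0 ())"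
    unfolding Units_def ring_mat_def by auto
  then obtain B where B: "mat_inverse (kernel_mat k []) = Some B"
    using mat_inverse(1)[OF A(2), of "()"] A(1) by (cases "mat_inverse (kernel_mat k [])") auto
  then show ?thesis
    using mat_inverse(2)[OF A(2) B] by (simp add: inverse_mat_def)
qed

lemma cond_mean_Nil: "cond_mean k f [] x = 0"
  using inverse_kernel_mat_Nil[of k] by (simp add: cond_mean_def scalar_prod_def)

lemma cond_var_Nil: "cond_var k [] x = k x x"
  using inverse_kernel_mat_Nil[of k] by (simp add: cond_var_def scalar_prod_def)

definition ell_ML :: "(real \<Rightarrow> 'p \<Rightarrow> 'p \<Rightarrow> real) \<Rightarrow> ('p \<Rightarrow> real) \<Rightarrow> 'p list \<Rightarrow> real \<Rightarrow> real" where
  "ell_ML K f xs \<nu> =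
     scalar_prod (data_vec f xs) (inverse_mat (kernel_mat (K \<nu>) xs) *\<^sub>v data_vec f xs)
       + ln (Determinant.det (kernel_mat (K \<nu>) xs))"

definition ell_CV :: "(real \<Rightarrow> 'p \<Rightarrow> 'p \<Rightarrow> real) \<Rightarrow> ('p \<Rightarrow> real) \<Rightarrow> 'p list \<Rightarrow> real \<Rightarrow> real" where
  "ell_CV K f xs \<nu> =
     (\<Sum>p\<leftarrow>xs. (f p - cond_mean (K \<nu>) f (removeAll p xs) p)\<^sup>2 / cond_var (K \<nu>) (removeAll p xs) p
             + ln (cond_var (K \<nu>) (removeAll p xs) p))"

text \<open>
  Sequences of points are indexed from 1; the value at index 0 is never used.
\<close>

definition first_points :: "(nat \<Rightarrow> 'p) \<Rightarrow> nat \<Rightarrow> 'p list" where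
  "first_points x n = map x [1..<Suc n]"


section \<open>Geometry of the domain and of the design points\<close>

definition fill_distance :: "'p::metric_space set \<Rightarrow> (nat \<Rightarrow> 'p) \<Rightarrow> nat \<Rightarrow> real" where
  "fill_distance \<Omega> x n = (SUP y\<in>\<Omega>. Min ((\<lambda>i. dist y (x i)) ` {1..n}))"

definition separation_radius :: "(nat \<Rightarrow> 'p::metric_space) \<Rightarrow> nat \<Rightarrow> real" where
  "separation_radius x n =
     1 / 2 * Min {dist (x i) (x j) | i j. i \<in> {1..n} \<and> j \<in> {1..n} \<and> i \<noteq> j}"

definition quasi_uniform :: "'p::metric_space set \<Rightarrow> (nat \<Rightarrow> 'p) \<Rightarrow> bool" where
  "quasi_uniform \<Omega> x \<longleftrightarrow>
     (\<exists>c>0. \<forall>n\<ge>2. separation_radius x n \<le> fill_distance \<Omega> x n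
                  \<and> fill_distance \<Omega> x n \<le> c * separation_radius x n)"

definition cone :: "'p::real_inner \<Rightarrow> 'p \<Rightarrow> real \<Rightarrow> real \<Rightarrow> 'p set" where
  "cone v \<xi> \<theta> r = {v + t *\<^sub>R y | t y. 0 \<le> t \<and> t \<le> r \<and> norm y = 1 \<and> inner y \<xi> \<ge> cos \<theta>}"

definition interior_cone_condition :: "'p::real_inner set \<Rightarrow> bool" where
  "interior_cone_condition \<Omega> \<longleftrightarrow>
     (\<exists>\<theta> r. 0 < \<theta> \<and> \<theta> < pi / 2 \<and> r > 0 \<and> (\<forall>v\<in>\<Omega>. \<exists>\<xi>. norm \<xi> = 1 \<and> cone v \<xi> \<theta> r \<subseteq> \<Omega>))"

text \<open>
  Near each boundary point, the set is the strict epigraph of a Lipschitz function over a hyperplane,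
  in the direction of a unit normal \<open>e\<close> of that hyperplane.
\<close>

definition lipschitz_boundary :: "'p::real_inner set \<Rightarrow> bool" where
  "lipschitz_boundary \<Omega> \<longleftrightarrow>
     (\<forall>p\<in>frontier \<Omega>. \<exists>r>0. \<exists>e (\<phi>::'p \<Rightarrow> real) L. norm e = 1 \<and> lipschitz_on L {y. inner y e = 0} \<phi> \<and>
        \<Omega> \<inter> ball p r = {y \<in> ball p r. inner y e > \<phi> (y - inner y e *\<^sub>R e)})"


section \<open>Gaussian processes\<close>

text \<open>Degenerate (almost surely constant) variables count as Gaussian.\<close>

definition gaussian_variable :: "'w measure \<Rightarrow> ('w \<Rightarrow> real) \<Rightarrow> bool" where
  "gaussian_variable M Y \<longleftrightarrow> Y \<in> borel_measurable M \<and>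
     (\<exists>m s. (s > 0 \<and> distributed M lborel Y (normal_density m s)) \<or> (s = 0 \<and> (AE w in M. Y w = m)))"

text \<open>
  The finite-dimensional distributions are Gaussian: a random vector is Gaussian if and only if all
  linear combinations of its components are.
\<close>

definition gaussian_process :: "'w measure \<Rightarrow> 't set \<Rightarrow> ('t \<Rightarrow> 'w \<Rightarrow> real) \<Rightarrow> bool" where
  "gaussian_process M T f \<longleftrightarrow> prob_space M \<and>
     (\<forall>S a. finite S \<and> S \<subseteq> T \<longrightarrow> gaussian_variable M (\<lambda>w. \<Sum>t\<in>S. a t * f t w))"

definition mean_fun :: "'w measure \<Rightarrow> ('t \<Rightarrow> 'w \<Rightarrow> real) \<Rightarrow> 't \<Rightarrow> real" where
  "mean_fun M f t = (\<integral>w. f t w \<partial>M)"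

definition covariance_kernel :: "'w measure \<Rightarrow> ('t \<Rightarrow> 'w \<Rightarrow> real) \<Rightarrow> 't \<Rightarrow> 't \<Rightarrow> real" where
  "covariance_kernel M f s t = (\<integral>w. (f s w - mean_fun M f s) * (f t w - mean_fun M f t) \<partial>M)"

definition zero_mean_gaussian_process ::
    "'w measure \<Rightarrow> 't set \<Rightarrow> ('t \<Rightarrow> 't \<Rightarrow> real) \<Rightarrow> ('t \<Rightarrow> 'w \<Rightarrow> real) \<Rightarrow> bool" where
  "zero_mean_gaussian_process M T k f \<longleftrightarrow> gaussian_process M T f
     \<and> (\<forall>t\<in>T. mean_fun M f t = 0)
     \<and> (\<forall>s\<in>T. \<forall>t\<in>T. covariance_kernel M f s t = k s t)"

end

theory Submission
  imports Defs
begin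

text \<open>
  Both criteria at \<open>\<nu> \<le> \<nu>\<^sub>0 - \<epsilon>\<close> are compared with their values at \<open>\<nu>\<^sub>0\<close>; the comparison gives
  the bound \<open>\<nu>\<^sub>0\<close> for cross validation as well.

  Matern kernels are mixtures of Gaussian kernels. If the points are \<open>q\<close>-separated, the components
  of width about \<open>q\<close> give diagonally dominant matrices, so the smallest eigenvalue of the kernel
  matrix is at least of order \<open>q\<^bsup>2\<nu>\<^esup>\<close>, that is \<open>n\<^bsup>-2\<nu>/d\<^esup>\<close>, uniformly in \<open>\<nu>\<close>. This bounds all
  conditional variances, hence both criteria, from below by \<open>- (2\<nu>/d) n log n - O(n)\<close>.

  In the other direction, cut space into cells of side \<open>A n\<^bsup>-1/d\<^esup>\<close>. In each cell a bounded number of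
  points determines the values of all polynomials of a fixed degree at the remaining points, with
  bounded coefficients; by Taylor expansion of the Gaussian components, these remaining points have
  conditional variance \<open>O(n\<^bsup>-2\<nu>\<^sub>0/d\<^esup>)\<close> at \<open>\<nu>\<^sub>0\<close>. For large \<open>A\<close> the exceptional points are an arbitrarily small
  fraction of all points, and so the logarithmic terms at \<open>\<nu>\<^sub>0\<close> are at most
  \<open>- (1 - \<delta>) (2\<nu>\<^sub>0/d) n log n + O(n)\<close>. Almost surely the quadratic form
  \<open>f\<^sub>0(X\<^sub>n)\<^sup>T K(X\<^sub>n)\<^bsup>-1\<^esup> f\<^sub>0(X\<^sub>n)\<close>, which is chi-squared with \<open>n\<close> degrees of freedom at \<open>\<nu>\<^sub>0\<close>, is \<open>O(n)\<close>. The normalised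
  squared leave-one-out residuals at \<open>\<nu>\<^sub>0\<close> sum to at most a constant multiple of it over the other points, and are at most
  \<open>12 log n + O(1)\<close> at the exceptional ones.
\<close>

section \<open>Kernel interpolation\<close>

text \<open>At distance \<epsilon> below \<open>\<nu>\<^sub>0\<close> the two sides differ by a
  multiple of n log n, so every error of order n is harmless and constants may be crude; only
  coefficients of n log n need care. The lower bound drops the nonnegative data terms, so the sample
  matters only at \<open>\<nu>\<^sub>0\<close>. The obstacle is cross validation at the exceptional
  points. A normalised residual is controlled by the quadratic form times the ratio of its
  conditional variance to the smallest eigenvalue. Elsewhere this ratio stays bounded, but at an
  exceptional point only the prior variance is at hand and the ratio may grow like a power of n.
  Hence these residuals are bounded one by one, at logarithmic cost; since their number is at most
  \<delta> n, the loss is 12 \<delta> n log n up to order n, and \<delta> is fixed after \<epsilon>.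
  The law of the quadratic form is reached without diagonalisation: its exponential moment is
  computed by adding one point at a time, using Laplace transforms of linear combinations
  only.\<close>

definition quad_form :: "('p \<Rightarrow> 'p \<Rightarrow> real) \<Rightarrow> 'p set \<Rightarrow> ('p \<Rightarrow> real) \<Rightarrow> real" where
  "quad_form k X a = (\<Sum>x\<in>X. \<Sum>y\<in>X. a x * a y * k x y)"

text \<open>A lower bound \<open>c\<close> for the smallest eigenvalue of the kernel matrix, stated
  for functions on points so that no ordering of \<open>X\<close> enters. Strict
  positive-definiteness is used in this quantitative form.\<close>

definition coercive :: "('p \<Rightarrow> 'p \<Rightarrow> real) \<Rightarrow> 'p set \<Rightarrow> real \<Rightarrow> bool" where
  "coercive k X c \<longleftrightarrow> (\<forall>a. c * (\<Sum>x\<in>X. (a x)\<^sup>2) \<le> quad_form k X a)"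

definition data_fit :: "('p \<Rightarrow> 'p \<Rightarrow> real) \<Rightarrow> ('p \<Rightarrow> real) \<Rightarrow> 'p list \<Rightarrow> real" where
  "data_fit k f xs =
     scalar_prod (data_vec f xs) (inverse_mat (kernel_mat k xs) *\<^sub>v data_vec f xs)"

lemma quad_form_alt: "quad_form k X a = (\<Sum>x\<in>X. a x * (\<Sum>y\<in>X. k x y * a y))"
  unfolding quad_form_def sum_distrib_left
  by (rule sum.cong[OF refl], rule sum.cong[OF refl]) (simp only: mult_ac)

lemma quad_form_extend:
  assumes "finite X" "Y \<subseteq> X" "\<And>x. x \<in> X - Y \<Longrightarrow> a x = 0"
  shows "quad_form k X a = quad_form k Y a"
proof -
  have "quad_form k X a = (\<Sum>x\<in>Y. \<Sum>y\<in>X. a x * a y * k x y)"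
    unfolding quad_form_def using assms by (intro sum.mono_neutral_right) auto
  also have "\<dots> = quad_form k Y a"
    unfolding quad_form_def using assms by (intro sum.cong sum.mono_neutral_right) auto
  finally show ?thesis .
qed

text \<open>Coefficients on \<open>Y\<close> extended by zero leave both sides unchanged, as in
  eigenvalue interlacing for principal submatrices.\<close>

lemma coercive_subset:
  assumes "coercive k X c" "Y \<subseteq> X" "finite X"
  shows "coercive k Y c"
  unfolding coercive_def
proof
  fix a
  let ?b = "\<lambda>x. if x \<in> Y then a x else (0::real)"
  have "quad_form k X ?b = quad_form k Y ?b"
    using assms by (intro quad_form_extend) auto
  moreover have "quad_form k Y ?b = quad_form k Y a"
    by (auto simp: quad_form_def intro!: sum.cong)
  moreover have "(\<Sum>x\<in>X. (?b x)\<^sup>2) = (\<Sum>x\<in>Y. (?b x)\<^sup>2)"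
    using assms by (intro sum.mono_neutral_right) auto
  moreover have "(\<Sum>x\<in>Y. (?b x)\<^sup>2) = (\<Sum>x\<in>Y. (a x)\<^sup>2)"
    by (auto intro!: sum.cong)
  moreover have "c * (\<Sum>x\<in>X. (?b x)\<^sup>2) \<le> quad_form k X ?b"
    using assms(1) unfolding coercive_def by (rule spec)
  ultimately show "c * (\<Sum>x\<in>Y. (a x)\<^sup>2) \<le> quad_form k Y a" by simp
qed

section \<open>Vectors and matrices over a list as sums over its points\<close>

lemma sum_nth_distinct:
  assumes "distinct xs"
  shows "(\<Sum>i\<in>{0..<length xs}. g (xs ! i)) = (\<Sum>x\<in>set xs. g x)"
  by (rule sum.reindex_bij_betw) (use bij_betw_nth[OF assms] in \<open>auto simp: atLeast0LessThan\<close>)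

lemma kernel_mat_carrier: "kernel_mat k xs \<in> carrier_mat (length xs) (length xs)"
  by (simp add: kernel_mat_def)

lemma data_vec_dim [simp]: "data_vec f xs \<in> carrier_vec (length xs)" "dim_vec (data_vec f xs) = length xs"
  by (rule carrier_vecI, simp add: data_vec_def) (simp add: data_vec_def)

lemma data_vec_index: "i < length xs \<Longrightarrow> vec_index (data_vec f xs) i = f (xs ! i)"
  by (simp add: data_vec_def vec_of_list_index)

lemma kernel_vec_eq: "kernel_vec k p xs = data_vec (k p) xs"
  by (simp add: kernel_vec_def data_vec_def)

text \<open>Distinctness makes the index of an entry unique, so the definite description recovers
  it, and vectors can be traded for functions on the points.\<close>

lemma vec_eq_data_vec:
  assumes "distinct xs" "v \<in> carrier_vec (length xs)"
  obtains a where "v = data_vec a xs"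
proof
  define a where "a y = vec_index v (THE i. i < length xs \<and> xs ! i = y)" for y
  have "(THE j. j < length xs \<and> xs ! j = xs ! i) = i" if "i < length xs" for i
    using that assms(1) by (auto intro!: the_equality simp: nth_eq_iff_index_eq)
  then show "v = data_vec a xs"
    using assms(2) by (intro eq_vecI) (auto simp: data_vec_index a_def)
qed

lemma scalar_prod_data_vec:
  assumes "distinct xs"
  shows "scalar_prod (data_vec g xs) (data_vec a xs) = (\<Sum>y\<in>set xs. g y * a y)"
proof -
  have "scalar_prod (data_vec g xs) (data_vec a xs) = (\<Sum>i\<in>{0..<length xs}. g (xs!i) * a (xs!i))"
    by (simp add: scalar_prod_def data_vec_index)
  also have "\<dots> = (\<Sum>y\<in>set xs. g y * a y)"
    by (rule sum_nth_distinct[OF assms, of "\<lambda>y. g y * a y"])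
  finally show ?thesis .
qed

lemma kernel_mat_mult_data_vec:
  assumes "distinct xs"
  shows "kernel_mat k xs *\<^sub>v data_vec a xs = data_vec (\<lambda>z. \<Sum>y\<in>set xs. k z y * a y) xs"
proof (intro eq_vecI)
  fix i assume i: "i < dim_vec (data_vec (\<lambda>z. \<Sum>y\<in>set xs. k z y * a y) xs)"
  then have i': "i < length xs" by simp
  have r: "Matrix.row (kernel_mat k xs) i = data_vec (k (xs!i)) xs"
    using i' by (intro eq_vecI) (auto simp: kernel_mat_def data_vec_index)
  have "vec_index (kernel_mat k xs *\<^sub>v data_vec a xs) i
    = scalar_prod (Matrix.row (kernel_mat k xs) i) (data_vec a xs)"
    using i' by (simp add: kernel_mat_def)
  also have "\<dots> = (\<Sum>y\<in>set xs. k (xs!i) y * a y)"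
    unfolding r by (rule scalar_prod_data_vec[OF assms])
  finally show "vec_index (kernel_mat k xs *\<^sub>v data_vec a xs) i
      = vec_index (data_vec (\<lambda>z. \<Sum>y\<in>set xs. k z y * a y) xs) i"
    using i' by (simp add: data_vec_index)
qed (simp add: kernel_mat_def)

abbreviation kernel_det :: "('p \<Rightarrow> 'p \<Rightarrow> real) \<Rightarrow> 'p list \<Rightarrow> real" where
  "kernel_det k xs \<equiv> Determinant.det (kernel_mat k xs)"

lemma det_kernel_mat_nonzero:
  assumes "distinct xs" "c > 0" "coercive k (set xs) c"
  shows "kernel_det k xs \<noteq> 0"
proof
  assume "kernel_det k xs = 0"
  then obtain v where v: "v \<in> carrier_vec (length xs)" "v \<noteq> 0\<^sub>v (length xs)"
    "kernel_mat k xs *\<^sub>v v = 0\<^sub>v (length xs)"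
    using det_0_iff_vec_prod_zero[OF kernel_mat_carrier[of k xs]] by auto
  obtain a where a: "v = data_vec a xs" using vec_eq_data_vec[OF assms(1) v(1)] by blast
  have z: "(\<Sum>y\<in>set xs. k z y * a y) = 0" if zin: "z \<in> set xs" for z
  proof -
    obtain i where i: "i < length xs" "z = xs ! i" using zin by (metis in_set_conv_nth)
    have "vec_index (data_vec (\<lambda>z. \<Sum>y\<in>set xs. k z y * a y) xs) i = vec_index (0\<^sub>v (length xs)) i"
      using v(3) unfolding a kernel_mat_mult_data_vec[OF assms(1)] by simp
    then show ?thesis using i by (simp add: data_vec_index)
  qed
  have "quad_form k (set xs) a = 0" unfolding quad_form_alt using z by simp
  then have "c * (\<Sum>x\<in>set xs. (a x)\<^sup>2) \<le> 0" using assms(3) unfolding coercive_def by metis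
  then have "(\<Sum>x\<in>set xs. (a x)\<^sup>2) \<le> 0" using assms(2) by (simp add: mult_le_0_iff)
  then have "(\<Sum>x\<in>set xs. (a x)\<^sup>2) = 0" by (simp add: antisym sum_nonneg)
  then have "\<forall>x\<in>set xs. a x = 0" by (simp add: sum_nonneg_eq_0_iff)
  then have "v = 0\<^sub>v (length xs)" unfolding a by (intro eq_vecI) (auto simp: data_vec_index)
  with v(2) show False by simp
qed

lemma inverse_kernel_mat:
  assumes "distinct xs" "c > 0" "coercive k (set xs) c"
  shows "inverse_mat (kernel_mat k xs) \<in> carrier_mat (length xs) (length xs)"
    "kernel_mat k xs * inverse_mat (kernel_mat k xs) = 1\<^sub>m (length xs)"
proof -
  have "kernel_mat k xs \<in> Units (ring_mat TYPE(real) (length xs) ())"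
    by (rule det_non_zero_imp_unit[OF kernel_mat_carrier det_kernel_mat_nonzero[OF assms]])
  then have "mat_inverse (kernel_mat k xs) \<noteq> None"
    using mat_inverse(1)[OF kernel_mat_carrier, of k xs "()"] by (rule contrapos_pn)
  then obtain B where B: "mat_inverse (kernel_mat k xs) = Some B" by (auto simp only: not_None_eq)
  have "inverse_mat (kernel_mat k xs) = B" unfolding inverse_mat_def B by (rule option.sel)
  then show "inverse_mat (kernel_mat k xs) \<in> carrier_mat (length xs) (length xs)"
    "kernel_mat k xs * inverse_mat (kernel_mat k xs) = 1\<^sub>m (length xs)"
    using mat_inverse(2)[OF kernel_mat_carrier B] by blast+
qed

text \<open>The coefficient function \<open>a\<close> stands for the inverse matrix applied to the
  data. Pairing it with an arbitrary \<open>g\<close> covers conditional means, conditional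
  variances and data fits at once.\<close>

lemma kernel_system_solution:
  assumes "distinct xs" "c > 0" "coercive k (set xs) c"
  obtains a where "\<forall>z\<in>set xs. (\<Sum>y\<in>set xs. k z y * a y) = f z"
    "\<forall>g. scalar_prod (data_vec g xs) (inverse_mat (kernel_mat k xs) *\<^sub>v data_vec f xs)
       = (\<Sum>y\<in>set xs. g y * a y)"
proof -
  let ?v = "inverse_mat (kernel_mat k xs) *\<^sub>v data_vec f xs"
  note I = inverse_kernel_mat[OF assms]
  have vc: "?v \<in> carrier_vec (length xs)" using I by auto
  obtain a where a: "?v = data_vec a xs" using vec_eq_data_vec[OF assms(1) vc] by blast
  have "kernel_mat k xs *\<^sub>v ?v = data_vec f xs"
    using I kernel_mat_carrier[of k xs]
    by (simp flip: assoc_mult_mat_vec[OF kernel_mat_carrier I(1) data_vec_dim(1)])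
  then have e: "data_vec (\<lambda>z. \<Sum>y\<in>set xs. k z y * a y) xs = data_vec f xs"
    unfolding a kernel_mat_mult_data_vec[OF assms(1)] .
  have 1: "(\<Sum>y\<in>set xs. k z y * a y) = f z" if zin: "z \<in> set xs" for z
  proof -
    obtain i where i: "i < length xs" "z = xs ! i" using zin by (metis in_set_conv_nth)
    show ?thesis using arg_cong[OF e, of "\<lambda>v. vec_index v i"] i by (simp add: data_vec_index)
  qed
  show ?thesis
    by (rule that[of a]) (use 1 in \<open>simp_all only: a scalar_prod_data_vec[OF assms(1)] ball_simps, simp_all\<close>)
qed

text \<open>Symmetry of the inverse matrix without the inverse: with \<open>K a = f\<close> and
  \<open>K b = g\<close>, both sides are the bilinear form of \<open>a\<close> and
  \<open>b\<close>.\<close>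

lemma sum_solution_swap:
  assumes sy: "\<And>x y. k x y = (k y x :: real)"
    and a: "\<And>z. z \<in> X \<Longrightarrow> (\<Sum>y\<in>X. k z y * a y) = f z" and b: "\<And>z. z \<in> X \<Longrightarrow> (\<Sum>y\<in>X. k z y * b y) = g z"
  shows "(\<Sum>y\<in>X. f y * b y) = (\<Sum>y\<in>X. g y * a y)"
proof -
  have "(\<Sum>y\<in>X. f y * b y) = (\<Sum>y\<in>X. \<Sum>z\<in>X. k y z * a z * b y)"
    by (rule sum.cong[OF refl]) (simp only: a[symmetric] sum_distrib_right)
  also have "\<dots> = (\<Sum>z\<in>X. \<Sum>y\<in>X. k y z * a z * b y)" by (rule sum.swap)
  also have "\<dots> = (\<Sum>z\<in>X. (\<Sum>y\<in>X. k z y * b y) * a z)"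
    unfolding sum_distrib_right
    by (rule sum.cong[OF refl], rule sum.cong[OF refl]) (simp add: sy mult_ac)
  also have "\<dots> = (\<Sum>z\<in>X. g z * a z)" using b by simp
  finally show ?thesis .
qed

text \<open>\<open>sum_solution_swap\<close> with equal right-hand sides shows that every solution
  gives the same value, so any convenient one may be supplied.\<close>

lemma data_fit_eq:
  assumes "distinct xs" "c > 0" "coercive k (set xs) c" "\<And>x y. k x y = k y x"
    "\<And>z. z \<in> set xs \<Longrightarrow> (\<Sum>y\<in>set xs. k z y * a y) = f z"
  shows "data_fit k f xs = (\<Sum>y\<in>set xs. f y * a y)"
proof -
  obtain b where b: "\<forall>z\<in>set xs. (\<Sum>y\<in>set xs. k z y * b y) = f z"
      "\<forall>g. scalar_prod (data_vec g xs) (inverse_mat (kernel_mat k xs) *\<^sub>v data_vec f xs)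
       = (\<Sum>y\<in>set xs. g y * b y)"
    by (rule kernel_system_solution[OF assms(1-3)])
  show ?thesis unfolding data_fit_def b(2)[rule_format]
    by (rule sum_solution_swap[OF assms(4) assms(5) b(1)[rule_format]])
qed

text \<open>Weights of the functional that subtracts from the value at \<open>p\<close> its best
  linear prediction. If the conditional variance is nonzero, dividing them by it gives column
  \<open>p\<close> of the inverse of the enlarged kernel matrix.\<close>

definition residual_weights :: "('p \<Rightarrow> 'p \<Rightarrow> real) \<Rightarrow> 'p list \<Rightarrow> 'p \<Rightarrow> ('p \<Rightarrow> real) \<Rightarrow> bool" where
  "residual_weights k xs p a \<longleftrightarrow> a p = 1 \<and>
     (\<forall>z\<in>set xs. (\<Sum>y\<in>insert p (set xs). k z y * a y) = 0) \<and>
     (\<Sum>y\<in>insert p (set xs). k p y * a y) = cond_var k xs p \<and>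
     (\<forall>f. (\<Sum>y\<in>insert p (set xs). f y * a y) = f p - cond_mean k f xs p) \<and>
     quad_form k (insert p (set xs)) a = cond_var k xs p"

lemma residual_weightsD:
  assumes "residual_weights k xs p a"
  shows "a p = 1" "\<forall>z\<in>set xs. (\<Sum>y\<in>insert p (set xs). k z y * a y) = 0"
    "(\<Sum>y\<in>insert p (set xs). k p y * a y) = cond_var k xs p"
    "\<forall>f. (\<Sum>y\<in>insert p (set xs). f y * a y) = f p - cond_mean k f xs p"
    "quad_form k (insert p (set xs)) a = cond_var k xs p"
  using assms unfolding residual_weights_def by blast+

lemma ex_residual_weights:
  assumes "distinct xs" "p \<notin> set xs" "c > 0" "coercive k (set xs) c" "\<And>x y. k x y = k y x"
  obtains a where "residual_weights k xs p a"
proof -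
  obtain w where w: "\<forall>z\<in>set xs. (\<Sum>y\<in>set xs. k z y * w y) = k p z"
      "\<forall>g. scalar_prod (data_vec g xs) (inverse_mat (kernel_mat k xs) *\<^sub>v data_vec (k p) xs)
       = (\<Sum>y\<in>set xs. g y * w y)"
    by (rule kernel_system_solution[OF assms(1,3,4), where f = "k p"])
  define a where "a y = (if y = p then 1 else - w y)" for y
  have s: "(\<Sum>y\<in>insert p (set xs). g y * a y) = g p - (\<Sum>y\<in>set xs. g y * w y)" for g
  proof -
    have "(\<Sum>y\<in>set xs. g y * a y) = (\<Sum>y\<in>set xs. - (g y * w y))"
      using assms(2) by (intro sum.cong) (auto simp: a_def)
    then show ?thesis using assms(2) by (simp add: sum_negf) (simp add: a_def)
  qed
  \<comment> \<open>Symmetry moves the inverse matrix from the data to the cross-covariances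
    \<open>k p\<close>.\<close>
  have mean: "(\<Sum>y\<in>set xs. f y * w y) = cond_mean k f xs p" for f
  proof -
    obtain b where b: "\<forall>z\<in>set xs. (\<Sum>y\<in>set xs. k z y * b y) = f z"
      "\<forall>g. scalar_prod (data_vec g xs) (inverse_mat (kernel_mat k xs) *\<^sub>v data_vec f xs)
         = (\<Sum>y\<in>set xs. g y * b y)"
      by (rule kernel_system_solution[OF assms(1,3,4)])
    show ?thesis unfolding cond_mean_def kernel_vec_eq b(2)[rule_format]
      by (rule sum_solution_swap[OF assms(5) b(1)[rule_format] w(1)[rule_format]])
  qed
  have orth: "(\<Sum>y\<in>insert p (set xs). k z y * a y) = 0" if "z \<in> set xs" for z
    unfolding s using w(1)[rule_format, OF that] assms(5)[of z p] by simp
  have var: "(\<Sum>y\<in>insert p (set xs). k p y * a y) = cond_var k xs p"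
    unfolding s cond_var_def kernel_vec_eq w(2)[rule_format] ..
  have ap: "a p = 1" by (simp add: a_def)
  have res: "(\<Sum>y\<in>insert p (set xs). f y * a y) = f p - cond_mean k f xs p" for f
    unfolding s mean ..
  have "(\<Sum>x\<in>set xs. a x * (\<Sum>y\<in>insert p (set xs). k x y * a y)) = 0"
    by (rule sum.neutral, rule ballI) (simp only: orth mult_zero_right)
  then have "quad_form k (insert p (set xs)) a = cond_var k xs p"
    unfolding quad_form_alt using assms(2)
    by (subst sum.insert) (simp_all only: var ap finite_set, simp)
  then show ?thesis using that[of a] ap orth var res unfolding residual_weights_def by blast
qed

text \<open>The conditional variance is the quadratic form of the residual weights, whose entry at
  \<open>p\<close> is 1, so their squares sum to at least 1.\<close>

lemma cond_var_ge:
  assumes "distinct xs" "p \<notin> set xs" "c > 0" "coercive k (insert p (set xs)) c" "\<And>x y. k x y = k y x"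
  shows "c \<le> cond_var k xs p"
proof -
  have co: "coercive k (set xs) c" using coercive_subset[OF assms(4), of "set xs"] by auto
  obtain a where "residual_weights k xs p a"
    by (rule ex_residual_weights[OF assms(1-3) co assms(5)])
  note a = residual_weightsD[OF this]
  have "c * 1 \<le> c * (\<Sum>x\<in>insert p (set xs). (a x)\<^sup>2)"
    using assms(2,3) a(1) by (intro mult_left_mono) (auto simp: sum_nonneg)
  also have "\<dots> \<le> cond_var k xs p" using assms(4) unfolding coercive_def a(5)[symmetric] by (rule spec)
  finally show ?thesis by simp
qed

text \<open>Minimality of the prediction error by Pythagoras: \<open>b\<close> differs from the
  residual weights by a \<open>u\<close> that vanishes at \<open>p\<close>, and the residual is
  uncorrelated with the points of \<open>xs\<close>, which kills the cross terms.\<close>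

lemma cond_var_le:
  assumes "distinct xs" "p \<notin> set xs" "c > 0" "coercive k (set xs) c" "\<And>x y. k x y = k y x" "b p = 1"
  shows "cond_var k xs p \<le> quad_form k (insert p (set xs)) b"
proof -
  let ?Y = "insert p (set xs)"
  obtain a where "residual_weights k xs p a"
    by (rule ex_residual_weights[OF assms(1-5)])
  note a = residual_weightsD[OF this]
  define u where "u y = b y - a y" for y
  have up: "u p = 0" using a assms(6) by (simp add: u_def)
  have ua: "(\<Sum>x\<in>?Y. u x * (\<Sum>y\<in>?Y. k x y * a y)) = 0"
    by (rule sum.neutral) (use a(2) up in auto)
  have au: "(\<Sum>x\<in>?Y. a x * (\<Sum>y\<in>?Y. k x y * u y)) = (\<Sum>x\<in>?Y. u x * (\<Sum>y\<in>?Y. k x y * a y))"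
  proof -
    have "(\<Sum>x\<in>?Y. a x * (\<Sum>y\<in>?Y. k x y * u y)) = (\<Sum>x\<in>?Y. \<Sum>y\<in>?Y. a x * (k x y * u y))"
      by (simp only: sum_distrib_left)
    also have "\<dots> = (\<Sum>y\<in>?Y. \<Sum>x\<in>?Y. a x * (k x y * u y))" by (rule sum.swap)
    also have "\<dots> = (\<Sum>x\<in>?Y. u x * (\<Sum>y\<in>?Y. k x y * a y))"
      unfolding sum_distrib_left using assms(5) by (intro sum.cong refl) (simp add: mult_ac)
    finally show ?thesis .
  qed
  have b: "b = (\<lambda>y. a y + u y)" by (auto simp: u_def)
  have "quad_form k ?Y b = quad_form k ?Y a + (\<Sum>x\<in>?Y. u x * (\<Sum>y\<in>?Y. k x y * a y))
     + (\<Sum>x\<in>?Y. a x * (\<Sum>y\<in>?Y. k x y * u y)) + quad_form k ?Y u"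
    unfolding b quad_form_alt by (simp only: distrib_left distrib_right sum.distrib)
  then have e: "quad_form k ?Y b = cond_var k xs p + quad_form k ?Y u"
    using ua au a(5) by simp
  have "quad_form k ?Y u = quad_form k (set xs) u"
    using up by (intro quad_form_extend) auto
  moreover have "0 \<le> quad_form k (set xs) u"
  proof -
    have "0 \<le> c * (\<Sum>x\<in>set xs. (u x)\<^sup>2)" using assms(3) by (simp add: sum_nonneg)
    also have "\<dots> \<le> quad_form k (set xs) u" using assms(4) unfolding coercive_def by (rule spec)
    finally show ?thesis .
  qed
  ultimately show ?thesis using e by simp
qed

text \<open>The new solution is the old one plus a multiple of the residual weights, which do not
  disturb the equations at the old points. This is the quadratic part of the chain rule for Gaussian
  log-likelihoods.\<close>

lemma data_fit_snoc:
  assumes "distinct (xs @ [p])" "c > 0" "coercive k (set (xs @ [p])) c" "\<And>x y. k x y = k y x"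
  shows "data_fit k f (xs @ [p]) = data_fit k f xs + (f p - cond_mean k f xs p)\<^sup>2 / cond_var k xs p"
proof -
  have d: "distinct xs" "p \<notin> set xs" using assms(1) by auto
  have S: "set (xs @ [p]) = insert p (set xs)" by simp
  have co: "coercive k (set xs) c" using coercive_subset[OF assms(3), of "set xs"] by auto
  have V: "cond_var k xs p > 0"
    using cond_var_ge[OF d assms(2) assms(3)[unfolded S] assms(4)] assms(2) by simp
  obtain a where "residual_weights k xs p a"
    by (rule ex_residual_weights[OF d assms(2) co assms(4)])
  note a = residual_weightsD[OF this]
  obtain b where b: "\<forall>z\<in>set xs. (\<Sum>y\<in>set xs. k z y * b y) = f z"
      "\<forall>g. scalar_prod (data_vec g xs) (inverse_mat (kernel_mat k xs) *\<^sub>v data_vec f xs)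
       = (\<Sum>y\<in>set xs. g y * b y)"
    by (rule kernel_system_solution[OF d(1) assms(2) co])
  \<comment> \<open>Forced by the equation at \<open>p\<close>: there the old solution yields the
    conditional mean and the residual weights yield the conditional variance.\<close>
  define t where "t = (f p - cond_mean k f xs p) / cond_var k xs p"
  define b' where "b' y = (if y = p then 0 else b y)" for y
  have b': "(\<Sum>y\<in>insert p (set xs). g y * b' y) = (\<Sum>y\<in>set xs. g y * b y)" for g
    using d(2) by (simp add: b'_def) (auto intro!: sum.cong)
  have tot: "(\<Sum>y\<in>insert p (set xs). g y * (b' y + t * a y))
     = (\<Sum>y\<in>set xs. g y * b y) + t * (\<Sum>y\<in>insert p (set xs). g y * a y)" for g
    unfolding b'[symmetric] distrib_left sum.distrib sum_distrib_left by (simp only: mult_ac)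
  have sol: "(\<Sum>y\<in>set (xs @ [p]). k z y * (b' y + t * a y)) = f z" if "z \<in> set (xs @ [p])" for z
  proof (cases "z = p")
    case True
    then show ?thesis unfolding S tot True a(3) b(2)[rule_format, symmetric]
      using V by (simp add: t_def cond_mean_def kernel_vec_eq)
  next
    case False
    then have z: "z \<in> set xs" using that by auto
    then show ?thesis unfolding S tot by (simp only: a(2)[rule_format, OF z] b(1)[rule_format, OF z])
  qed
  have "data_fit k f (xs @ [p]) = (\<Sum>y\<in>set (xs @ [p]). f y * (b' y + t * a y))"
    by (rule data_fit_eq[OF assms(1-4) sol])
  also have "\<dots> = data_fit k f xs + t * (f p - cond_mean k f xs p)"
    unfolding S tot a(4)[rule_format] data_fit_def b(2)[rule_format] ..
  finally show ?thesis by (simp add: t_def power2_eq_square)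
qed

text \<open>Multiplication from the right by a unit upper triangular matrix whose last column holds
  the residual weights clears the last column of the kernel matrix except for the corner, which
  becomes the conditional variance.\<close>

lemma det_kernel_mat_snoc:
  assumes "distinct xs" "p \<notin> set xs" "c > 0" "coercive k (set xs) c" "\<And>x y. k x y = k y x"
  shows "kernel_det k (xs @ [p]) = kernel_det k xs * cond_var k xs p"
proof -
  let ?n = "length xs"
  let ?Y = "insert p (set xs)"
  obtain a where "residual_weights k xs p a"
    by (rule ex_residual_weights[OF assms])
  note a = residual_weightsD[OF this]
  let ?K = "kernel_mat k (xs @ [p])"
  define U where "U = Matrix.mat (Suc ?n) (Suc ?n)
    (\<lambda>(i, j). if j = ?n then a ((xs @ [p]) ! i) else if i = j then 1 else 0)"
  have Uc: "U \<in> carrier_mat (Suc ?n) (Suc ?n)" by (simp add: U_def)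
  have Kc: "?K \<in> carrier_mat (Suc ?n) (Suc ?n)" using kernel_mat_carrier[of k "xs @ [p]"] by simp
  have "upper_triangular U" by (auto simp: upper_triangular_def U_def)
  then have "Determinant.det U = prod_list (diag_mat U)" by (rule det_upper_triangular[OF _ Uc])
  also have "\<dots> = (\<Prod>i=0..<Suc ?n. U $$ (i,i))" using Uc by (simp add: prod_list_diag_prod)
  also have "\<dots> = 1" using a(1) by (intro prod.neutral) (auto simp: U_def nth_append)
  finally have dU: "Determinant.det U = 1" .
  have KU: "?K * U = four_block_mat (kernel_mat k xs) (0\<^sub>m ?n 1)
       (Matrix.mat 1 ?n (\<lambda>(i, j). k p (xs ! j))) (Matrix.mat 1 1 (\<lambda>_. cond_var k xs p))" (is "_ = ?B")
  proof (rule eq_matI)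
    show "dim_row (?K * U) = dim_row ?B" "dim_col (?K * U) = dim_col ?B"
      using Kc Uc by (auto simp: kernel_mat_def)
    fix i j assume "i < dim_row ?B" "j < dim_col ?B"
    then have i: "i < Suc ?n" and j: "j < Suc ?n" by (auto simp: kernel_mat_def)
    have "(?K * U) $$ (i, j) = (\<Sum>m\<in>{0..<Suc ?n}. k ((xs@[p])!i) ((xs@[p])!m) * U $$ (m, j))"
      using i j Kc Uc by (simp add: scalar_prod_def kernel_mat_def)
    also have "\<dots> = ?B $$ (i, j)"
    proof (cases "j = ?n")
      case True
      have "(\<Sum>m\<in>{0..<Suc ?n}. k ((xs@[p])!i) ((xs@[p])!m) * U $$ (m, j))
         = (\<Sum>m\<in>{0..<length (xs @ [p])}. k ((xs@[p])!i) ((xs@[p])!m) * a ((xs@[p])!m))"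
        using True by (intro sum.cong) (auto simp: U_def)
      also have "\<dots> = (\<Sum>y\<in>set (xs@[p]). k ((xs@[p])!i) y * a y)"
        by (rule sum_nth_distinct[where g = "\<lambda>y. k ((xs@[p])!i) y * a y"]) (use assms in auto)
      also have "\<dots> = (\<Sum>y\<in>?Y. k ((xs@[p])!i) y * a y)" by simp
      also have "\<dots> = ?B $$ (i, j)"
      proof (cases "i = ?n")
        case True
        then show ?thesis using a(3) \<open>j = ?n\<close> by (simp add: kernel_mat_def)
      next
        case False
        then have "i < ?n" using i by simp
        then show ?thesis using a(2)[rule_format, of "xs ! i"] \<open>j = ?n\<close> by (simp add: kernel_mat_def nth_append)
      qed
      finally show ?thesis .
    next
      case False
      then have j': "j < ?n" using j by simp
      have "(\<Sum>m\<in>{0..<Suc ?n}. k ((xs@[p])!i) ((xs@[p])!m) * U $$ (m, j))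
         = (\<Sum>m\<in>{0..<Suc ?n}. if m = j then k ((xs@[p])!i) (xs!j) else 0)"
        using j' by (intro sum.cong) (auto simp: U_def nth_append)
      also have "\<dots> = k ((xs@[p])!i) (xs!j)" using j' by simp
      finally show ?thesis using i j' by (auto simp: kernel_mat_def nth_append)
    qed
    finally show "(?K * U) $$ (i, j) = ?B $$ (i, j)" .
  qed
  have "Determinant.det ?K = Determinant.det (?K * U)"
    by (simp add: det_mult[OF Kc Uc] dU)
  also have "\<dots> = kernel_det k xs * Determinant.det (Matrix.mat 1 1 (\<lambda>_. cond_var k xs p))"
    unfolding KU by (rule det_four_block_mat_upper_right_zero[OF kernel_mat_carrier]) auto
  also have "Determinant.det (Matrix.mat 1 1 (\<lambda>_. cond_var k xs p)) = cond_var k xs p"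
    by (simp add: det_single)
  finally show ?thesis .
qed

text \<open>Rows and columns are permuted alike, so the two signs cancel. This allows the
  exceptional points to be placed first in \<open>det_kernel_mat_le\<close>.\<close>

lemma det_kernel_mat_permute:
  assumes "mset xs = mset ys"
  shows "kernel_det k xs = kernel_det k ys"
proof -
  let ?n = "length ys"
  obtain f where f: "f permutes {..<?n}" "permute_list f ys = xs"
    using mset_eq_permutation[OF assms] by blast
  then have f': "f permutes {0..<?n}" by (simp add: atLeast0LessThan)
  have l: "length xs = ?n" using assms mset_eq_length by blast
  let ?A = "kernel_mat k ys"
  define A1 where "A1 = Matrix.mat ?n ?n (\<lambda>(i, j). ?A $$ (f i, j))"
  have A1c: "A1 \<in> carrier_mat ?n ?n" by (simp add: A1_def)
  have fl: "f i < ?n" if "i < ?n" for i using permutes_in_image[OF f(1)] that by auto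
  have "kernel_mat k xs = transpose_mat (Matrix.mat ?n ?n (\<lambda>(i, j). transpose_mat A1 $$ (f i, j)))"
    using f(1) fl by (intro eq_matI)
      (auto simp: kernel_mat_def l A1_def f(2)[symmetric] permute_list_nth)
  then have "kernel_det k xs
     = Determinant.det (Matrix.mat ?n ?n (\<lambda>(i, j). transpose_mat A1 $$ (f i, j)))"
    by (simp add: det_transpose[of _ ?n])
  also have "\<dots> = signof f * Determinant.det (transpose_mat A1)"
    using A1c by (intro det_permute_rows[OF _ f']) simp
  also have "\<dots> = signof f * (signof f * Determinant.det ?A)"
    unfolding det_transpose[OF A1c] unfolding A1_def
    by (subst det_permute_rows[OF kernel_mat_carrier f']) (rule refl)
  also have "\<dots> = Determinant.det ?A" by (simp add: sign_def)
  finally show ?thesis .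
qed

section \<open>Gaussian kernels\<close>

definition gauss_kernel :: "real \<Rightarrow> 'a::euclidean_space \<Rightarrow> 'a \<Rightarrow> real" where
  "gauss_kernel t x y = exp (- (t * (norm (x - y))\<^sup>2))"

text \<open>An instance of Schur's product theorem: one factor of the inner product is split over
  the coordinates and absorbed into the coefficients.\<close>

lemma quad_form_inner_power_nonneg:
  fixes X :: "'a::euclidean_space set"
  shows "0 \<le> quad_form (\<lambda>x y. (inner x y) ^ n) X a"
proof (induction n arbitrary: a)
  case 0
  have "quad_form (\<lambda>x y. (inner x y) ^ 0) X a = (\<Sum>x\<in>X. a x) * (\<Sum>y\<in>X. a y)"
    by (simp add: quad_form_def sum_product)
  then show ?case by simp
next
  case (Suc n)
  have "quad_form (\<lambda>x y. (inner x y) ^ Suc n) X a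
     = (\<Sum>x\<in>X. \<Sum>y\<in>X. \<Sum>b\<in>Basis. (a x * inner x b) * (a y * inner y b) * inner x y ^ n)"
    unfolding quad_form_def
  proof (rule sum.cong[OF refl], rule sum.cong[OF refl])
    fix x y :: 'a
    have "a x * a y * inner x y ^ Suc n = a x * a y * inner x y ^ n * (\<Sum>b\<in>Basis. inner x b * inner y b)"
      unfolding euclidean_inner[of x y, symmetric] by (simp add: mult_ac)
    then show "a x * a y * inner x y ^ Suc n
       = (\<Sum>b\<in>Basis. (a x * inner x b) * (a y * inner y b) * inner x y ^ n)"
      by (simp add: sum_distrib_left mult_ac)
  qed
  also have "\<dots> = (\<Sum>x\<in>X. \<Sum>b\<in>Basis. \<Sum>y\<in>X. (a x * inner x b) * (a y * inner y b) * inner x y ^ n)"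
    by (rule sum.cong[OF refl], rule sum.swap)
  also have "\<dots> = (\<Sum>b\<in>Basis. quad_form (\<lambda>x y. (inner x y) ^ n) X (\<lambda>x. a x * inner x b))"
    unfolding quad_form_def by (rule sum.swap)
  also have "\<dots> \<ge> 0" by (intro sum_nonneg Suc.IH)
  finally show ?case .
qed

lemma gauss_kernel_factor:
  "gauss_kernel t x y = exp (- (t * (norm x)\<^sup>2)) * exp (- (t * (norm y)\<^sup>2)) * exp (2 * t * inner x y)"
proof -
  have e: "(norm (x - y))\<^sup>2 = (norm x)\<^sup>2 + (norm y)\<^sup>2 - 2 * inner x y"
    by (simp add: power2_norm_eq_inner inner_diff_left inner_diff_right inner_commute)
  have "- (t * (norm (x - y))\<^sup>2) = - (t * (norm x)\<^sup>2) + - (t * (norm y)\<^sup>2) + 2 * t * inner x y"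
    unfolding e by (simp add: algebra_simps)
  then show ?thesis by (simp only: gauss_kernel_def exp_add)
qed

text \<open>By \<open>gauss_kernel_factor\<close> the parts that depend on a single point go into
  the coefficients; what remains is a power series in the inner product with nonnegative
  coefficients.\<close>

lemma quad_form_gauss_kernel_nonneg:
  fixes X :: "'a::euclidean_space set"
  assumes "t \<ge> 0"
  shows "0 \<le> quad_form (gauss_kernel t) X a"
proof -
  define b where "b x = a x * exp (- (t * (norm x)\<^sup>2))" for x
  have e: "(\<lambda>n. (2 * t) ^ n /\<^sub>R fact n * (b x * b y * inner x y ^ n)) sums (a x * a y * gauss_kernel t x y)"
    for x y :: 'a
  proof -
    have "(\<lambda>n. (2 * t * inner x y) ^ n /\<^sub>R fact n) sums exp (2 * t * inner x y)" by (rule exp_converges)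
    from sums_mult[OF this, of "b x * b y"] show ?thesis
      by (simp add: gauss_kernel_factor b_def power_mult_distrib mult_ac)
  qed
  have "(\<lambda>n. \<Sum>x\<in>X. \<Sum>y\<in>X. (2 * t) ^ n /\<^sub>R fact n * (b x * b y * inner x y ^ n))
     sums quad_form (gauss_kernel t) X a"
    unfolding quad_form_def by (intro sums_sum e)
  moreover have "(\<Sum>x\<in>X. \<Sum>y\<in>X. (2 * t) ^ n /\<^sub>R fact n * (b x * b y * inner x y ^ n)) \<ge> 0" for n
  proof -
    have "(\<Sum>x\<in>X. \<Sum>y\<in>X. (2 * t) ^ n /\<^sub>R fact n * (b x * b y * inner x y ^ n))
      = (2 * t) ^ n /\<^sub>R fact n * quad_form (\<lambda>x y. (inner x y) ^ n) X b"
      by (simp add: quad_form_def sum_distrib_left)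
    also have "\<dots> \<ge> 0"
      using assms by (intro mult_nonneg_nonneg quad_form_inner_power_nonneg) auto
    finally show ?thesis .
  qed
  ultimately show ?thesis by (rule sums_le[OF _ sums_zero, rotated])
qed

lemma quad_form_gauss_kernel_le:
  assumes "t \<ge> 0"
  shows "quad_form (gauss_kernel t) X a \<le> (\<Sum>x\<in>X. \<bar>a x\<bar>)\<^sup>2"
proof -
  have "quad_form (gauss_kernel t) X a \<le> (\<Sum>x\<in>X. \<Sum>y\<in>X. \<bar>a x\<bar> * \<bar>a y\<bar>)"
    unfolding quad_form_def
  proof (intro sum_mono)
    fix x y :: 'a
    have "gauss_kernel t x y \<le> 1" "gauss_kernel t x y \<ge> 0"
      using assms by (simp_all add: gauss_kernel_def)
    then have "\<bar>a x * a y * gauss_kernel t x y\<bar> \<le> \<bar>a x\<bar> * \<bar>a y\<bar> * 1"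
      unfolding abs_mult by (intro mult_mono) auto
    then show "a x * a y * gauss_kernel t x y \<le> \<bar>a x\<bar> * \<bar>a y\<bar>" by simp
  qed
  also have "\<dots> = (\<Sum>x\<in>X. \<bar>a x\<bar>)\<^sup>2" by (simp add: power2_eq_square sum_product)
  finally show ?thesis .
qed

text \<open>The restricted lambda makes the index of a grid cell an element of a \<open>PiE\<close>
  over \<open>Basis\<close>, so that cells can be counted and sums over cells factorise over the
  coordinates.\<close>

definition cell_index :: "real \<Rightarrow> 'a::euclidean_space \<Rightarrow> 'a \<Rightarrow> int" where
  "cell_index s x = (\<lambda>b\<in>Basis. \<lfloor>inner x b / s\<rfloor>)"

lemma cell_index_eq_imp:
  fixes x y :: "'a::euclidean_space" and s :: real
  assumes "s > 0" "cell_index s x = cell_index s y"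
  shows "norm (x - y) < DIM('a) * s"
proof -
  have "\<bar>inner (x - y) b\<bar> < s" if "b \<in> Basis" for b
  proof -
    have "\<lfloor>inner x b / s\<rfloor> = \<lfloor>inner y b / s\<rfloor>"
      using fun_cong[OF assms(2), of b] that by (simp add: cell_index_def)
    then have "\<bar>inner x b / s - inner y b / s\<bar> < 1" by linarith
    then have "\<bar>(inner x b - inner y b) / s\<bar> < 1" by (simp add: diff_divide_distrib)
    then show ?thesis using assms(1) by (simp add: abs_divide inner_diff_left)
  qed
  then have "(\<Sum>b\<in>Basis. \<bar>inner (x - y) b\<bar>) < (\<Sum>b\<in>(Basis::'a set). s)"
    by (intro sum_strict_mono) auto
  then show ?thesis using norm_le_l1[of "x - y"] by simp
qed

text \<open>Indices that differ by D force coordinates to differ by at least (D - 1) s. The square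
  is weakened to the linear bound D - 1 so that Gaussian sums are dominated by products of geometric
  series.\<close>

lemma norm_diff_cell_index:
  fixes x y :: "'a::euclidean_space"
  assumes "s > 0"
  shows "(\<Sum>b\<in>Basis. real_of_int \<bar>cell_index s x b - cell_index s y b\<bar> - 1) \<le> (norm (x - y))\<^sup>2 / s\<^sup>2"
proof -
  have "real_of_int \<bar>cell_index s x b - cell_index s y b\<bar> - 1 \<le> (inner (x - y) b / s)\<^sup>2"
    if "b \<in> Basis" for b
  proof -
    define u where "u = \<bar>inner x b / s - inner y b / s\<bar>"
    define D where "D = \<bar>\<lfloor>inner x b / s\<rfloor> - \<lfloor>inner y b / s\<rfloor>\<bar>"
    have uD: "real_of_int D - 1 \<le> u" unfolding u_def D_def by linarith
    have D0: "D \<ge> 0" by (simp add: D_def)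
    have "real_of_int D - 1 \<le> u\<^sup>2"
    proof (cases "D \<le> 1")
      case True
      then have "real_of_int D - 1 \<le> 0" by simp
      then show ?thesis by (rule order_trans) simp
    next
      case False
      then have "1 \<le> real_of_int D - 1" by linarith
      then have "u \<ge> 1" using uD by linarith
      then have "u \<le> u\<^sup>2" by (simp add: power2_eq_square)
      then show ?thesis using uD by linarith
    qed
    also have "u\<^sup>2 = (inner (x - y) b / s)\<^sup>2"
      by (simp add: u_def inner_diff_left diff_divide_distrib)
    finally show ?thesis using that by (simp add: D_def cell_index_def)
  qed
  then have "(\<Sum>b\<in>Basis. real_of_int \<bar>cell_index s x b - cell_index s y b\<bar> - 1)
     \<le> (\<Sum>b\<in>Basis. (inner (x - y) b / s)\<^sup>2)" by (rule sum_mono)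
  also have "\<dots> = (norm (x - y))\<^sup>2 / s\<^sup>2"
  proof -
    have "(norm (x - y))\<^sup>2 = (\<Sum>b\<in>Basis. (inner (x - y) b)\<^sup>2)"
      unfolding power2_norm_eq_inner by (subst euclidean_inner) (simp add: power2_eq_square)
    then show ?thesis by (simp add: power_divide sum_divide_distrib)
  qed
  finally show ?thesis .
qed

text \<open>Splitting at \<open>m0\<close> gives two geometric series of ratio exp (-1), which is at
  most 1/2, so each sums to at most 2; the shift by 1 contributes the factor exp 1.\<close>

lemma sum_exp_int_le:
  assumes "finite S"
  shows "(\<Sum>m\<in>S. exp (1 - real_of_int \<bar>m0 - m\<bar>)) \<le> 4 * exp 1"
proof -
  have geo: "(\<Sum>n\<in>T. exp (- real n)) \<le> 2" if "finite T" for T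
  proof -
    have e: "exp (- 1) \<le> (1/2::real)" using exp_ge_add_one_self[of 1] by (simp add: exp_minus field_simps)
    have s: "summable (\<lambda>n. (1/2::real) ^ n)" by (rule summable_geometric) simp
    have "(\<Sum>n\<in>T. exp (- real n)) \<le> (\<Sum>n\<in>T. (1/2::real) ^ n)"
    proof (rule sum_mono)
      fix n
      have "exp (- real n) = exp (-1) ^ n" by (simp flip: exp_of_nat_mult)
      also have "\<dots> \<le> (1/2) ^ n" by (intro power_mono e) simp
      finally show "exp (- real n) \<le> (1/2) ^ n" .
    qed
    also have "\<dots> \<le> (\<Sum>n. (1/2::real) ^ n)" using s that by (intro sum_le_suminf) auto
    also have "\<dots> = 2" by (subst suminf_geometric) auto
    finally show ?thesis .
  qed
  have half: "(\<Sum>m\<in>{m\<in>S. P m}. exp (- real_of_int \<bar>m0 - m\<bar>)) \<le> 2"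
    if "inj_on (\<lambda>m. nat \<bar>m0 - m\<bar>) {m\<in>S. P m}" for P
  proof -
    have "(\<Sum>m\<in>{m\<in>S. P m}. exp (- real_of_int \<bar>m0 - m\<bar>))
      = (\<Sum>n\<in>(\<lambda>m. nat \<bar>m0 - m\<bar>) ` {m\<in>S. P m}. exp (- real n))"
      by (subst sum.reindex[OF that]) simp
    also have "\<dots> \<le> 2" using assms by (intro geo) simp
    finally show ?thesis .
  qed
  have "(\<Sum>m\<in>S. exp (- real_of_int \<bar>m0 - m\<bar>))
     = (\<Sum>m\<in>{m\<in>S. m \<le> m0}. exp (- real_of_int \<bar>m0 - m\<bar>))
       + (\<Sum>m\<in>{m\<in>S. \<not> m \<le> m0}. exp (- real_of_int \<bar>m0 - m\<bar>))"
    using assms by (subst sum.union_disjoint[symmetric]) (auto intro!: sum.cong)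
  also have "\<dots> \<le> 2 + 2"
    by (intro add_mono half) (auto simp: inj_on_def)
  finally have "exp 1 * (\<Sum>m\<in>S. exp (- real_of_int \<bar>m0 - m\<bar>)) \<le> exp 1 * 4"
    by (intro mult_left_mono) auto
  then show ?thesis by (simp add: sum_distrib_left diff_conv_add_uminus exp_add del: add_uminus_conv_diff)
qed

text \<open>Two points in one cell of side q / d would be closer than \<open>q\<close>. So each cell
  holds at most one point, and the sum over points is dominated by a product over coordinates of
  sums over integers.\<close>

lemma separated_sum_exp_le:
  fixes X :: "'a::euclidean_space set"
  assumes "finite X" "q > 0" "\<And>x y. x \<in> X \<Longrightarrow> y \<in> X \<Longrightarrow> x \<noteq> y \<Longrightarrow> q \<le> norm (x - y)"
  shows "(\<Sum>x\<in>X. exp (- ((DIM('a) / q)\<^sup>2 * (norm (p - x))\<^sup>2))) \<le> (4 * exp 1) ^ DIM('a)"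
proof -
  define s where "s = q / DIM('a)"
  have s: "s > 0" using assms(2) by (simp add: s_def)
  have inj: "inj_on (cell_index s) X"
  proof (rule inj_onI, rule ccontr)
    fix x y assume "x \<in> X" "y \<in> X" "cell_index s x = cell_index s y" "x \<noteq> y"
    then show False using cell_index_eq_imp[OF s, of x y] assms(3)[of x y] by (simp add: s_def)
  qed
  define S where "S b = (\<lambda>x. cell_index s x b) ` X" for b
  have "(\<Sum>x\<in>X. exp (- ((DIM('a) / q)\<^sup>2 * (norm (p - x))\<^sup>2)))
      \<le> (\<Sum>x\<in>X. \<Prod>b\<in>Basis. exp (1 - real_of_int \<bar>cell_index s p b - cell_index s x b\<bar>))"
  proof (rule sum_mono)
    fix x
    have "(DIM('a) / q)\<^sup>2 * (norm (p - x))\<^sup>2 = (norm (p - x))\<^sup>2 / s\<^sup>2"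
      by (simp add: s_def power_divide)
    then have "- ((DIM('a) / q)\<^sup>2 * (norm (p - x))\<^sup>2)
       \<le> (\<Sum>b\<in>Basis. 1 - real_of_int \<bar>cell_index s p b - cell_index s x b\<bar>)"
      using norm_diff_cell_index[OF s, of p x] by (simp add: sum_subtractf)
    then show "exp (- ((DIM('a) / q)\<^sup>2 * (norm (p - x))\<^sup>2))
       \<le> (\<Prod>b\<in>Basis. exp (1 - real_of_int \<bar>cell_index s p b - cell_index s x b\<bar>))"
      by (simp flip: exp_sum)
  qed
  also have "\<dots> = (\<Sum>g\<in>cell_index s ` X. \<Prod>b\<in>Basis. exp (1 - real_of_int \<bar>cell_index s p b - g b\<bar>))"
    by (simp add: sum.reindex[OF inj])
  also have "\<dots> \<le> (\<Sum>g\<in>PiE Basis S. \<Prod>b\<in>Basis. exp (1 - real_of_int \<bar>cell_index s p b - g b\<bar>))"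
  proof (rule sum_mono2)
    show "finite (PiE Basis S)" using assms(1) by (intro finite_PiE) (auto simp: S_def)
    show "cell_index s ` X \<subseteq> PiE Basis S" by (auto simp: S_def cell_index_def)
  qed (intro prod_nonneg, auto)
  also have "\<dots> = (\<Prod>b\<in>Basis. \<Sum>m\<in>S b. exp (1 - real_of_int \<bar>cell_index s p b - m\<bar>))"
    using assms(1) by (intro prod_sum_PiE[symmetric]) (auto simp: S_def)
  also have "\<dots> \<le> (\<Prod>b\<in>(Basis::'a set). 4 * exp 1)"
    using assms(1) by (intro prod_mono conjI sum_exp_int_le sum_nonneg) (auto simp: S_def)
  finally show ?thesis by simp
qed

text \<open>Chosen for off-diagonal row sums of at most 1/2: the square of \<open>d\<close> pays for
  the rate (d / q)^2 in \<open>separated_sum_exp_le\<close>, and the excess rate gains the factor 1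
  / (2 (4 e)^d) from distance \<open>q\<close> onwards.\<close>

definition gauss_threshold :: "nat \<Rightarrow> real" where
  "gauss_threshold d = (real d)\<^sup>2 + ln (2 * (4 * exp 1) ^ d)"

lemma gauss_threshold_pos: "gauss_threshold d > 0"
proof -
  have "(1::real) \<le> 4 * exp 1" using exp_ge_add_one_self[of 1] by simp
  then have "(1::real) \<le> (4 * exp 1) ^ d" by (rule one_le_power)
  then have "ln (2 * (4 * exp 1) ^ d) > (0::real)" by (intro ln_gt_zero) linarith
  then show ?thesis by (simp add: gauss_threshold_def add_nonneg_pos)
qed

lemma separated_gauss_sum_le:
  fixes X :: "'a::euclidean_space set"
  assumes "finite X" "q > 0" "\<And>x y. x \<in> X \<Longrightarrow> y \<in> X \<Longrightarrow> x \<noteq> y \<Longrightarrow> q \<le> norm (x - y)"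
    and "gauss_threshold DIM('a) \<le> t * q\<^sup>2" "p \<in> X"
  shows "(\<Sum>x\<in>X - {p}. gauss_kernel t p x) \<le> 1 / 2"
proof -
  let ?C = "(4 * exp 1 :: real) ^ DIM('a)" and ?u = "(DIM('a) / q)\<^sup>2"
  have C: "?C > 0" by simp
  have "(1::real) \<le> 4 * exp 1" using exp_ge_add_one_self[of 1] by simp
  then have C1: "1 \<le> ?C" by (rule one_le_power)
  have uq: "?u * q\<^sup>2 = (real DIM('a))\<^sup>2" using assms(2) by (simp add: power_divide)
  have lnC: "ln (2 * ?C) \<ge> 0" using C1 by (intro ln_ge_zero) linarith
  have tq: "ln (2 * ?C) \<le> (t - ?u) * q\<^sup>2"
    using assms(4) by (simp add: gauss_threshold_def left_diff_distrib uq)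
  then have "0 \<le> (t - ?u) * q\<^sup>2" using lnC by linarith
  then have tu: "0 \<le> t - ?u" using assms(2) by (simp add: zero_le_mult_iff)
  have "(\<Sum>x\<in>X - {p}. gauss_kernel t p x)
     \<le> (\<Sum>x\<in>X - {p}. 1 / (2 * ?C) * exp (- (?u * (norm (p - x))\<^sup>2)))"
  proof (rule sum_mono)
    fix x assume x: "x \<in> X - {p}"
    have "q \<le> norm (p - x)" using assms(3)[OF assms(5), of x] x by auto
    then have "q\<^sup>2 \<le> (norm (p - x))\<^sup>2" using assms(2) by (intro power_mono) auto
    then have "(t - ?u) * q\<^sup>2 \<le> (t - ?u) * (norm (p - x))\<^sup>2" using tu by (rule mult_left_mono)
    then have "ln (2 * ?C) \<le> (t - ?u) * (norm (p - x))\<^sup>2" using tq by linarith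
    then have "- (t * (norm (p - x))\<^sup>2) \<le> - ln (2 * ?C) + - (?u * (norm (p - x))\<^sup>2)"
      by (simp add: left_diff_distrib)
    then have "gauss_kernel t p x \<le> exp (- ln (2 * ?C) + - (?u * (norm (p - x))\<^sup>2))"
      unfolding gauss_kernel_def by (subst exp_le_cancel_iff)
    also have "\<dots> = exp (- ln (2 * ?C)) * exp (- (?u * (norm (p - x))\<^sup>2))" by (rule exp_add)
    also have "exp (- ln (2 * ?C)) = 1 / (2 * ?C)"
      using C by (simp add: exp_minus inverse_eq_divide)
    finally show "gauss_kernel t p x \<le> 1 / (2 * ?C) * exp (- (?u * (norm (p - x))\<^sup>2))" .
  qed
  also have "\<dots> = 1 / (2 * ?C) * (\<Sum>x\<in>X - {p}. exp (- (?u * (norm (p - x))\<^sup>2)))"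
    by (simp only: sum_distrib_left)
  also have "\<dots> \<le> 1 / (2 * ?C) * ?C"
  proof (rule mult_left_mono)
    show "(\<Sum>x\<in>X - {p}. exp (- (?u * (norm (p - x))\<^sup>2))) \<le> ?C"
      by (rule separated_sum_exp_le) (use assms in auto)
  qed (use C in simp)
  also have "\<dots> = 1 / 2" using C by simp
  finally show ?thesis .
qed

text \<open>Diagonal dominance: the diagonal is 1 and off-diagonal rows sum to at most 1/2. Mixed
  products of coefficients are split into squares, and symmetry of the kernel merges the two
  halves.\<close>

lemma coercive_gauss_kernel:
  fixes X :: "'a::euclidean_space set"
  assumes "finite X" "q > 0" "\<And>x y. x \<in> X \<Longrightarrow> y \<in> X \<Longrightarrow> x \<noteq> y \<Longrightarrow> q \<le> norm (x - y)"
    and "gauss_threshold DIM('a) \<le> t * q\<^sup>2"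
  shows "coercive (gauss_kernel t) X (1 / 2)"
  unfolding coercive_def
proof
  fix a :: "'a \<Rightarrow> real"
  define g :: "'a \<Rightarrow> 'a \<Rightarrow> real" where "g = gauss_kernel t"
  have g0: "g x y \<ge> 0" and gsym: "g x y = g y x" and g1: "g x x = 1" for x y :: 'a
    by (simp_all add: g_def gauss_kernel_def norm_minus_commute)
  have off: "(\<Sum>x\<in>X. \<Sum>y\<in>X - {x}. (a x)\<^sup>2 * g x y) \<le> (\<Sum>x\<in>X. (a x)\<^sup>2 * (1/2))"
    unfolding sum_distrib_left[symmetric] g_def
    by (intro sum_mono mult_left_mono separated_gauss_sum_le[OF assms]) auto
  have swap: "(\<Sum>x\<in>X. \<Sum>y\<in>X - {x}. (a y)\<^sup>2 * g x y) = (\<Sum>x\<in>X. \<Sum>y\<in>X - {x}. (a x)\<^sup>2 * g x y)"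
  proof -
    have "(\<Sum>x\<in>X. \<Sum>y\<in>X - {x}. (a y)\<^sup>2 * g x y) = (\<Sum>x\<in>X. \<Sum>y\<in>X. if y \<noteq> x then (a y)\<^sup>2 * g x y else 0)"
      using assms(1) by (intro sum.cong[OF refl] sum.mono_neutral_cong_left) auto
    also have "\<dots> = (\<Sum>y\<in>X. \<Sum>x\<in>X. if y \<noteq> x then (a y)\<^sup>2 * g x y else 0)" by (rule sum.swap)
    also have "\<dots> = (\<Sum>y\<in>X. \<Sum>x\<in>X - {y}. (a y)\<^sup>2 * g y x)"
      using assms(1) by (intro sum.cong[OF refl] sum.mono_neutral_cong_right) (auto simp: gsym)
    finally show ?thesis .
  qed
  have "(\<Sum>x\<in>X. \<Sum>y\<in>X - {x}. - (a x * a y * g x y))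
     \<le> (\<Sum>x\<in>X. \<Sum>y\<in>X - {x}. (a x)\<^sup>2 * g x y / 2 + (a y)\<^sup>2 * g x y / 2)"
  proof (intro sum_mono)
    fix x y
    have "0 \<le> (a x + a y)\<^sup>2" by simp
    then have "- (a x * a y) \<le> ((a x)\<^sup>2 + (a y)\<^sup>2) / 2" by (simp add: power2_sum)
    then have "- (a x * a y) * g x y \<le> ((a x)\<^sup>2 + (a y)\<^sup>2) / 2 * g x y"
      using g0 by (rule mult_right_mono)
    then show "- (a x * a y * g x y) \<le> (a x)\<^sup>2 * g x y / 2 + (a y)\<^sup>2 * g x y / 2"
      by (simp add: field_simps)
  qed
  also have "\<dots> = (\<Sum>x\<in>X. \<Sum>y\<in>X - {x}. (a x)\<^sup>2 * g x y)"
    using swap by (simp add: sum.distrib flip: sum_divide_distrib)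
  also have "\<dots> \<le> (\<Sum>x\<in>X. (a x)\<^sup>2 * (1/2))" by (rule off)
  finally have lo: "- (\<Sum>x\<in>X. \<Sum>y\<in>X - {x}. a x * a y * g x y) \<le> 1/2 * (\<Sum>x\<in>X. (a x)\<^sup>2)"
    by (simp add: sum_negf flip: sum_distrib_right sum_divide_distrib)
  have "quad_form g X a = (\<Sum>x\<in>X. (a x)\<^sup>2 + (\<Sum>y\<in>X - {x}. a x * a y * g x y))"
    unfolding quad_form_def using assms(1)
    by (intro sum.cong refl) (simp add: sum.remove g1 power2_eq_square)
  then have "quad_form g X a = (\<Sum>x\<in>X. (a x)\<^sup>2) + (\<Sum>x\<in>X. \<Sum>y\<in>X - {x}. a x * a y * g x y)"
    by (simp add: sum.distrib)
  with lo show "1 / 2 * (\<Sum>x\<in>X. (a x)\<^sup>2) \<le> quad_form (gauss_kernel t) X a"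
    unfolding g_def by linarith
qed


text \<open>
  Products of \<open>m\<close> of the functions \<open>1\<close>, \<open>|x|\<^sup>2\<close> (letters \<open>None\<close>, \<open>Some None\<close>) and the coordinates
  span the functions \<open>|x - y|\<^bsup>2k\<^esup>\<close>, \<open>k \<le> m\<close>, which are the terms of the Taylor expansion of the
  Gaussian kernel.
\<close>

definition base_feature :: "'a::euclidean_space option option \<Rightarrow> 'a \<Rightarrow> real" where
  "base_feature e x = (case e of None \<Rightarrow> 1 | Some None \<Rightarrow> (norm x)\<^sup>2 | Some (Some b) \<Rightarrow> inner x b)"

definition feature_letters :: "'a::euclidean_space option option set" where
  "feature_letters = {None, Some None} \<union> (Some \<circ> Some) ` Basis"

definition feature_words :: "nat \<Rightarrow> 'a::euclidean_space option option list set" where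
  "feature_words m = {w. set w \<subseteq> feature_letters \<and> length w = m}"

definition word_feature :: "'a::euclidean_space option option list \<Rightarrow> 'a \<Rightarrow> real" where
  "word_feature w x = (\<Prod>e\<leftarrow>w. base_feature e x)"

lemma finite_feature_letters: "finite (feature_letters :: 'a::euclidean_space option option set)"
  by (simp add: feature_letters_def)

lemma finite_feature_words: "finite (feature_words m :: 'a::euclidean_space option option list set)"
  unfolding feature_words_def using finite_feature_letters by (rule finite_lists_length_eq)

lemma dist_square_base_feature:
  fixes y :: "'a::euclidean_space"
  obtains c where "\<forall>x. (norm (x - y))\<^sup>2 = (\<Sum>e\<in>feature_letters. c e * base_feature e x)"
proof
  let ?c = "\<lambda>e. case e of None \<Rightarrow> (norm y)\<^sup>2 | Some None \<Rightarrow> 1 | Some (Some b) \<Rightarrow> - 2 * inner y b"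
  show "\<forall>x. (norm (x - y))\<^sup>2 = (\<Sum>e\<in>feature_letters. ?c e * base_feature e x)"
  proof
    fix x
    have "(\<Sum>e\<in>feature_letters. ?c e * base_feature e x)
       = (\<Sum>e\<in>{None, Some None}. ?c e * base_feature e x)
         + (\<Sum>e\<in>(Some \<circ> Some) ` Basis. ?c e * base_feature e x)"
      unfolding feature_letters_def by (rule sum.union_disjoint) auto
    also have "(\<Sum>e\<in>(Some \<circ> Some) ` Basis. ?c e * base_feature e x)
       = (\<Sum>b\<in>Basis. - 2 * (inner x b * inner y b))"
      by (subst sum.reindex) (auto simp: base_feature_def inj_on_def mult_ac)
    also have "\<dots> = - 2 * inner x y"
      by (simp only: sum_distrib_left[symmetric] euclidean_inner[of x y, symmetric])
    finally show "(norm (x - y))\<^sup>2 = (\<Sum>e\<in>feature_letters. ?c e * base_feature e x)"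
      by (simp add: base_feature_def power2_norm_eq_inner inner_diff_left inner_diff_right inner_commute)
  qed
qed

lemma feature_words_Suc:
  "feature_words (Suc m) = (\<lambda>(e, w). e # w) ` (feature_letters \<times> feature_words m)"
  by (auto simp: feature_words_def length_Suc_conv image_iff)

lemma sum_feature_words_Suc:
  fixes F :: "'a::euclidean_space option option list \<Rightarrow> real"
  shows "(\<Sum>w\<in>feature_words (Suc m). F w) = (\<Sum>e\<in>feature_letters. \<Sum>w\<in>feature_words m. F (e # w))"
proof -
  have "inj_on (\<lambda>(e, w). e # w) (feature_letters \<times> feature_words m :: ('a option option \<times> _) set)"
    by (auto simp: inj_on_def)
  then show ?thesis
    unfolding feature_words_Suc sum.cartesian_product by (subst sum.reindex) (auto simp: case_prod_beta)
qed

text \<open>Each induction step peels off one letter: a factor |x - y|^2 if \<open>k\<close> is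
  maximal, otherwise the constant letter \<open>None\<close>, which pads lower powers to words of
  the fixed length \<open>m\<close>.\<close>

lemma dist_power_word_feature:
  fixes y :: "'a::euclidean_space"
  assumes "k \<le> m"
  shows "\<exists>C. \<forall>x. (norm (x - y)) ^ (2 * k) = (\<Sum>w\<in>feature_words m. C w * word_feature w x)"
  using assms
proof (induction m arbitrary: k)
  case 0
  have "feature_words 0 = {[] :: 'a option option list}" by (auto simp: feature_words_def)
  then show ?case using 0 by (intro exI[of _ "\<lambda>_. 1"]) (simp add: word_feature_def)
next
  case (Suc m)
  obtain j c where jc: "j \<le> m"
    "\<forall>x. (norm (x - y)) ^ (2 * k) = (\<Sum>e\<in>feature_letters. c e * base_feature e x) * (norm (x - y)) ^ (2 * j)"
  proof (cases "k = Suc m")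
    case True
    obtain c where "\<forall>x. (norm (x - y))\<^sup>2 = (\<Sum>e\<in>feature_letters. c e * base_feature e x)"
      by (rule dist_square_base_feature)
    then show ?thesis using True
      by (intro that[of m c]) (auto simp: power_add power2_eq_square)
  next
    case False
    have "(\<Sum>e\<in>feature_letters. (if e = None then 1 else (0::real)) * base_feature e x) = 1" for x :: 'a
    proof -
      have "(\<Sum>e\<in>feature_letters. (if e = None then 1 else (0::real)) * base_feature e x)
        = (\<Sum>e\<in>(feature_letters :: 'a option option set). if e = None then 1 else (0::real))"
        by (intro sum.cong) (auto simp: base_feature_def)
      also have "\<dots> = 1" by (simp add: finite_feature_letters) (simp add: feature_letters_def)
      finally show ?thesis .
    qed
    then show ?thesis using False Suc.prems
      by (intro that[of k "\<lambda>e. if e = None then 1 else 0"]) auto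
  qed
  obtain C where C: "\<forall>x. (norm (x - y)) ^ (2 * j) = (\<Sum>w\<in>feature_words m. C w * word_feature w x)"
    using Suc.IH[OF jc(1)] by blast
  have "(norm (x - y)) ^ (2 * k) = (\<Sum>w\<in>feature_words (Suc m). (c (hd w) * C (tl w)) * word_feature w x)" for x
    using jc(2)[rule_format, of x] C[rule_format, of x]
    by (simp add: sum_product sum_feature_words_Suc word_feature_def mult_ac)
  then show ?case by (intro exI[of _ "\<lambda>w. c (hd w) * C (tl w)"]) blast
qed

text \<open>Gaussian elimination, pivoting on the largest value of each feature, keeps the coefficients bounded.\<close>

lemma bounded_spanning_subset:
  fixes \<Phi> :: "'j \<Rightarrow> 'a \<Rightarrow> real"
  assumes "finite J" "finite X"
  shows "\<exists>B\<subseteq>X. card B \<le> card J \<and>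
    (\<forall>x\<in>X. \<exists>u. (\<forall>j\<in>J. \<Phi> j x = (\<Sum>b\<in>B. u b * \<Phi> j b)) \<and> (\<Sum>b\<in>B. \<bar>u b\<bar>) \<le> 2 ^ card J - 1)"
  using assms(1)
proof (induction J arbitrary: \<Phi> rule: finite_induct)
  case empty
  then show ?case by (intro exI[of _ "{}"]) auto
next
  case (insert i J)
  show ?case
  proof (cases "\<forall>x\<in>X. \<Phi> i x = 0")
    case True
    obtain B where B: "B \<subseteq> X" "card B \<le> card J"
      "\<forall>x\<in>X. \<exists>u. (\<forall>j\<in>J. \<Phi> j x = (\<Sum>b\<in>B. u b * \<Phi> j b)) \<and> (\<Sum>b\<in>B. \<bar>u b\<bar>) \<le> 2 ^ card J - 1"
      using insert.IH[of \<Phi>] by blast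
    have "(2::real) ^ card J \<le> 2 ^ Suc (card J)" by simp
    then have "\<exists>u. (\<forall>j\<in>insert i J. \<Phi> j x = (\<Sum>b\<in>B. u b * \<Phi> j b)) \<and>
         (\<Sum>b\<in>B. \<bar>u b\<bar>) \<le> 2 ^ Suc (card J) - 1" if x: "x \<in> X" for x
    proof -
      obtain u where u: "\<forall>j\<in>J. \<Phi> j x = (\<Sum>b\<in>B. u b * \<Phi> j b)" "(\<Sum>b\<in>B. \<bar>u b\<bar>) \<le> 2 ^ card J - 1"
        using B(3) x by blast
      have "\<Phi> i x = (\<Sum>b\<in>B. u b * \<Phi> i b)" using True B(1) x by (simp add: subset_iff)
      moreover have "(\<Sum>b\<in>B. \<bar>u b\<bar>) \<le> 2 ^ Suc (card J) - 1"
        using u(2) \<open>(2::real) ^ card J \<le> 2 ^ Suc (card J)\<close> by linarith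
      ultimately show ?thesis using u(1) by (intro exI[of _ u]) blast
    qed
    then show ?thesis using B(1,2) insert.hyps by (intro exI[of _ B]) auto
  next
    case False
    then have "X \<noteq> {}" by auto
    then obtain p where p: "p \<in> X" "\<forall>x\<in>X. \<bar>\<Phi> i x\<bar> \<le> \<bar>\<Phi> i p\<bar>"
      using obtains_MAX[OF assms(2), of "\<lambda>x. \<bar>\<Phi> i x\<bar>"] assms(2) Max_ge
      by (metis (no_types, lifting) finite_imageI imageI)
    have p0: "\<Phi> i p \<noteq> 0" using False p(2) by fastforce
    define r where "r x = \<Phi> i x / \<Phi> i p" for x
    have r1: "\<bar>r x\<bar> \<le> 1" if "x \<in> X" for x
      using p p0 that by (simp add: r_def abs_divide)
    \<comment> \<open>The elimination step: feature \<open>i\<close> of the modified family vanishes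
      everywhere, so only the features in \<open>J\<close> are left for the induction
      hypothesis.\<close>
    define \<Psi> where "\<Psi> j x = \<Phi> j x - r x * \<Phi> j p" for j x
    obtain B where B: "B \<subseteq> X" "card B \<le> card J"
      "\<forall>x\<in>X. \<exists>u. (\<forall>j\<in>J. \<Psi> j x = (\<Sum>b\<in>B. u b * \<Psi> j b)) \<and> (\<Sum>b\<in>B. \<bar>u b\<bar>) \<le> 2 ^ card J - 1"
      using insert.IH[of \<Psi>] by blast
    have fB: "finite B" using B(1) assms(2) finite_subset by blast
    let ?B = "insert p B"
    have ex: "\<exists>u. (\<forall>j\<in>insert i J. \<Phi> j x = (\<Sum>b\<in>?B. u b * \<Phi> j b)) \<and>
         (\<Sum>b\<in>?B. \<bar>u b\<bar>) \<le> 2 ^ Suc (card J) - 1" if x: "x \<in> X" for x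
    proof -
      obtain u where u: "\<forall>j\<in>J. \<Psi> j x = (\<Sum>b\<in>B. u b * \<Psi> j b)" "(\<Sum>b\<in>B. \<bar>u b\<bar>) \<le> 2 ^ card J - 1"
        using B(3) x by blast
      \<comment> \<open>The weight at the pivot is what restores feature \<open>i\<close>.\<close>
      define t where "t = r x - (\<Sum>b\<in>B. u b * r b)"
      \<comment> \<open>The pivot may already belong to \<open>B\<close>, so the two contributions
        are added.\<close>
      define v where "v b = (if b \<in> B then u b else 0) + (if b = p then t else 0)" for b
      have vsum: "(\<Sum>b\<in>?B. v b * g b) = (\<Sum>b\<in>B. u b * g b) + t * g p" for g
      proof -
        have "(\<Sum>b\<in>?B. v b * g b) = (\<Sum>b\<in>?B. if b \<in> B then u b * g b else 0) + (\<Sum>b\<in>?B. if b = p then t * g b else 0)"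
          unfolding sum.distrib[symmetric] by (intro sum.cong refl) (auto simp: v_def algebra_simps)
        also have "(\<Sum>b\<in>?B. if b \<in> B then u b * g b else 0) = (\<Sum>b\<in>B. u b * g b)"
          using fB by (intro sum.mono_neutral_cong_right) auto
        also have "(\<Sum>b\<in>?B. if b = p then t * g b else 0) = t * g p" using fB by simp
        finally show ?thesis .
      qed
      have "\<Phi> j x = (\<Sum>b\<in>?B. v b * \<Phi> j b)" if j: "j \<in> insert i J" for j
      proof (cases "j = i")
        case True
        have "(\<Sum>b\<in>B. u b * \<Phi> i b) = (\<Sum>b\<in>B. u b * r b) * \<Phi> i p"
          using p0 by (simp add: r_def sum_distrib_right)
        then show ?thesis using p0 unfolding vsum True t_def
          by (simp add: left_diff_distrib) (simp add: r_def)
      next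
        case False
        then have "\<Psi> j x = (\<Sum>b\<in>B. u b * \<Psi> j b)" using u j by blast
        then show ?thesis unfolding vsum t_def \<Psi>_def
          by (simp add: algebra_simps sum_subtractf sum_distrib_left sum_distrib_right)
      qed
      moreover have "(\<Sum>b\<in>?B. \<bar>v b\<bar>) \<le> 2 ^ Suc (card J) - 1"
      proof -
        have "\<bar>\<Sum>b\<in>B. u b * r b\<bar> \<le> (\<Sum>b\<in>B. \<bar>u b\<bar>)"
        proof (rule order_trans[OF sum_abs], rule sum_mono)
          fix b assume "b \<in> B"
          then have "\<bar>u b\<bar> * \<bar>r b\<bar> \<le> \<bar>u b\<bar> * 1" using r1 B(1) by (intro mult_left_mono) auto
          then show "\<bar>u b * r b\<bar> \<le> \<bar>u b\<bar>" by (simp add: abs_mult)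
        qed
        \<comment> \<open>If S is the old absolute sum, the new one is at most 2 S + 1, which is the
          recursion satisfied by 2^n - 1.\<close>
        then have t: "\<bar>t\<bar> \<le> 1 + (\<Sum>b\<in>B. \<bar>u b\<bar>)" using r1[OF x] unfolding t_def by linarith
        have "(\<Sum>b\<in>?B. \<bar>v b\<bar>) \<le> (\<Sum>b\<in>?B. (if b \<in> B then \<bar>u b\<bar> else 0) + (if b = p then \<bar>t\<bar> else 0))"
          by (intro sum_mono) (auto simp: v_def)
        also have "\<dots> = (\<Sum>b\<in>?B. if b \<in> B then \<bar>u b\<bar> else 0) + (\<Sum>b\<in>?B. if b = p then \<bar>t\<bar> else 0)"
          by (rule sum.distrib)
        also have "(\<Sum>b\<in>?B. if b \<in> B then \<bar>u b\<bar> else 0) = (\<Sum>b\<in>B. \<bar>u b\<bar>)"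
          using fB by (intro sum.mono_neutral_cong_right) auto
        also have "(\<Sum>b\<in>?B. if b = p then \<bar>t\<bar> else 0) = \<bar>t\<bar>" using fB by simp
        finally show ?thesis using t u(2) by simp
      qed
      ultimately show ?thesis by blast
    qed
    have "card ?B \<le> Suc (card J)" using B(2) fB by (simp add: card_insert_if)
    then show ?thesis using ex B(1) p(1) insert.hyps by (intro exI[of _ ?B]) auto
  qed
qed

section \<open>Gaussian quadratic forms under coefficients that annihilate the features\<close>

lemma exp_taylor_bound:
  assumes "0 \<le> r" "r \<le> (1::real)"
  shows "\<bar>exp (- r) - (\<Sum>k<m. (- r) ^ k / fact k)\<bar> \<le> 3 * r ^ m"
proof -
  obtain t where t: "\<bar>t\<bar> \<le> \<bar>- r\<bar>" "exp (- r) = (\<Sum>k<m. (- r) ^ k / fact k) + exp t / fact m * (- r) ^ m"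
    using Maclaurin_exp_le[of "- r" m] by blast
  have "exp t \<le> exp 1" using t(1) assms by simp
  then have e: "exp t \<le> 3" using exp_le by linarith
  have "\<bar>exp (- r) - (\<Sum>k<m. (- r) ^ k / fact k)\<bar> = exp t / fact m * r ^ m"
    using assms unfolding t(2) by (simp add: abs_mult power_abs)
  also have "\<dots> \<le> 3 * r ^ m"
  proof (rule mult_right_mono)
    have "exp t / fact m \<le> exp t / 1" by (intro divide_left_mono) (auto simp: fact_ge_1)
    then show "exp t / fact m \<le> 3" using e by simp
  qed (use assms in simp)
  finally show ?thesis .
qed

text \<open>For every fixed \<open>y\<close> the Taylor polynomial of the kernel is, as a function
  of \<open>x\<close>, in the span of the features, so only the remainder survives. Once t \<rho>^2
  exceeds 1 the trivial bound takes over; the minimum of both can be integrated over all components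
  of the mixture.\<close>

lemma quad_form_gauss_kernel_annihilator:
  fixes Y :: "'a::euclidean_space set"
  assumes "finite Y" "\<And>x y. x \<in> Y \<Longrightarrow> y \<in> Y \<Longrightarrow> norm (x - y) \<le> \<rho>" "\<rho> \<ge> 0" "t \<ge> 0"
    "\<And>w. w \<in> feature_words m \<Longrightarrow> (\<Sum>x\<in>Y. a x * word_feature w x) = 0"
  shows "quad_form (gauss_kernel t) Y a \<le> 3 * min 1 ((t * \<rho>\<^sup>2) ^ m) * (\<Sum>x\<in>Y. \<bar>a x\<bar>)\<^sup>2"
proof (cases "t * \<rho>\<^sup>2 \<le> 1")
  case False
  then have "1 \<le> (t * \<rho>\<^sup>2) ^ m" by (intro one_le_power) simp
  then have "1 * (\<Sum>x\<in>Y. \<bar>a x\<bar>)\<^sup>2 \<le> 3 * min 1 ((t * \<rho>\<^sup>2) ^ m) * (\<Sum>x\<in>Y. \<bar>a x\<bar>)\<^sup>2"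
    by (intro mult_right_mono) (auto simp: min_def)
  then show ?thesis using quad_form_gauss_kernel_le[OF assms(4), of Y a] by linarith
next
  case True
  define P where "P x y = (\<Sum>k<m. (- (t * (norm (x - y))\<^sup>2)) ^ k / fact k)" for x y :: 'a
  have P0: "(\<Sum>x\<in>Y. a x * P x y) = 0" for y
  proof -
    have "(\<Sum>x\<in>Y. a x * norm (x - y) ^ (2 * k)) = 0" if k: "k < m" for k
    proof -
      have "k \<le> m" using k by simp
      then obtain C where C: "\<forall>x. (norm (x - y)) ^ (2 * k) = (\<Sum>w\<in>feature_words m. C w * word_feature w x)"
        using dist_power_word_feature[of k m y] by blast
      have "(\<Sum>x\<in>Y. a x * norm (x - y) ^ (2 * k))
         = (\<Sum>x\<in>Y. \<Sum>w\<in>feature_words m. C w * (a x * word_feature w x))"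
        unfolding C[rule_format] sum_distrib_left by (intro sum.cong refl) (simp only: mult_ac)
      also have "\<dots> = (\<Sum>w\<in>feature_words m. \<Sum>x\<in>Y. C w * (a x * word_feature w x))" by (rule sum.swap)
      also have "\<dots> = 0" by (rule sum.neutral, rule ballI) (simp only: sum_distrib_left[symmetric] assms(5) mult_zero_right)
      finally show ?thesis .
    qed
    note k0 = this
    have "(\<Sum>x\<in>Y. a x * P x y)
       = (\<Sum>x\<in>Y. \<Sum>k<m. (- t) ^ k / fact k * (a x * norm (x - y) ^ (2 * k)))"
      unfolding P_def sum_distrib_left
    proof (rule sum.cong[OF refl], rule sum.cong[OF refl])
      fix x k
      have "(- (t * (norm (x - y))\<^sup>2)) ^ k = (- t) ^ k * norm (x - y) ^ (2 * k)"
        unfolding mult_minus_left[symmetric] power_mult_distrib power_mult ..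
      then show "a x * ((- (t * (norm (x - y))\<^sup>2)) ^ k / fact k) = (- t) ^ k / fact k * (a x * norm (x - y) ^ (2 * k))"
        by simp
    qed
    also have "\<dots> = (\<Sum>k<m. \<Sum>x\<in>Y. (- t) ^ k / fact k * (a x * norm (x - y) ^ (2 * k)))" by (rule sum.swap)
    also have "\<dots> = 0" by (rule sum.neutral, rule ballI) (simp only: sum_distrib_left[symmetric] k0 lessThan_iff mult_zero_right)
    finally show ?thesis .
  qed
  have "(\<Sum>x\<in>Y. \<Sum>y\<in>Y. a x * a y * P x y) = (\<Sum>y\<in>Y. \<Sum>x\<in>Y. a x * a y * P x y)" by (rule sum.swap)
  also have "\<dots> = (\<Sum>y\<in>Y. a y * (\<Sum>x\<in>Y. a x * P x y))"
    unfolding sum_distrib_left by (intro sum.cong refl) (simp only: mult_ac)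
  also have "\<dots> = 0" by (simp only: P0 mult_zero_right sum.neutral_const)
  finally have z: "(\<Sum>x\<in>Y. \<Sum>y\<in>Y. a x * a y * P x y) = 0" .
  have "quad_form (gauss_kernel t) Y a = (\<Sum>x\<in>Y. \<Sum>y\<in>Y. a x * a y * (gauss_kernel t x y - P x y))"
    unfolding right_diff_distrib sum_subtractf z by (simp add: quad_form_def)
  also have "\<dots> \<le> (\<Sum>x\<in>Y. \<Sum>y\<in>Y. \<bar>a x\<bar> * \<bar>a y\<bar> * (3 * (t * \<rho>\<^sup>2) ^ m))"
  proof (intro sum_mono)
    fix x y assume xy: "x \<in> Y" "y \<in> Y"
    have le: "t * (norm (x - y))\<^sup>2 \<le> t * \<rho>\<^sup>2"
      using assms(2)[OF xy] assms(4) by (intro mult_left_mono power_mono) auto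
    have "\<bar>gauss_kernel t x y - P x y\<bar> \<le> 3 * (t * (norm (x - y))\<^sup>2) ^ m"
      unfolding gauss_kernel_def P_def using le True assms(4) by (intro exp_taylor_bound) auto
    also have "\<dots> \<le> 3 * (t * \<rho>\<^sup>2) ^ m"
      using assms(4) by (intro mult_left_mono[OF power_mono[OF le]]) auto
    finally have b: "\<bar>gauss_kernel t x y - P x y\<bar> \<le> 3 * (t * \<rho>\<^sup>2) ^ m" .
    have "a x * a y * (gauss_kernel t x y - P x y) \<le> \<bar>a x * a y * (gauss_kernel t x y - P x y)\<bar>" by simp
    also have "\<dots> \<le> \<bar>a x\<bar> * \<bar>a y\<bar> * (3 * (t * \<rho>\<^sup>2) ^ m)"
      unfolding abs_mult by (intro mult_left_mono b) auto
    finally show "a x * a y * (gauss_kernel t x y - P x y) \<le> \<bar>a x\<bar> * \<bar>a y\<bar> * (3 * (t * \<rho>\<^sup>2) ^ m)" .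
  qed
  also have "\<dots> = 3 * (t * \<rho>\<^sup>2) ^ m * (\<Sum>x\<in>Y. \<bar>a x\<bar>)\<^sup>2"
    unfolding power2_eq_square[of "sum _ _"] sum_product by (simp add: sum_distrib_left mult_ac)
  also have "(t * \<rho>\<^sup>2) ^ m = min 1 ((t * \<rho>\<^sup>2) ^ m)"
    using True assms(3,4) by (simp add: power_le_one min_def antisym_conv)
  finally show ?thesis .
qed

section \<open>Matern kernels as mixtures of Gaussian kernels\<close>

lemma has_bochner_integral_mono:
  fixes f g :: "'a \<Rightarrow> real"
  assumes "has_bochner_integral M f a" "has_bochner_integral M g b" "\<And>x. f x \<le> g x"
  shows "a \<le> b"
  using assms integral_mono[of M f g] by (simp add: has_bochner_integral_iff)

lemma has_bochner_integral_exp_atLeast: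
  fixes r a :: real
  assumes "r > 0"
  shows "has_bochner_integral lborel (\<lambda>u. indicator {a..} u * exp (- (r * u))) (exp (- (r * a)) / r)"
proof (rule has_bochner_integral_nn_integral)
  have "(\<integral>\<^sup>+u. ennreal (exp (- (r * u))) * indicator {a..} u \<partial>lborel) = ennreal (0 - (- exp (- (r * a)) / r))"
  proof (rule nn_integral_FTC_atLeast)
    show "((\<lambda>u. - exp (- (r * u)) / r) \<longlongrightarrow> 0) at_top"
      using assms by real_asymp
    show "DERIV (\<lambda>u. - exp (- (r * u)) / r) u :> exp (- (r * u))" for u
      using assms by (auto intro!: derivative_eq_intros)
  qed auto
  then show "(\<integral>\<^sup>+u. ennreal (indicator {a..} u * exp (- (r * u))) \<partial>lborel) = ennreal (exp (- (r * a)) / r)"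
    by (simp add: ennreal_mult mult.commute ennreal_indicator)
qed (use assms in auto)

lemma has_bochner_integral_exp_atMost:
  fixes r a :: real
  assumes "r > 0"
  shows "has_bochner_integral lborel (\<lambda>u. indicator {..a} u * exp (r * u)) (exp (r * a) / r)"
proof -
  have "has_bochner_integral lborel (\<lambda>u. indicator {- a..} u * exp (- (r * u))) (exp (r * a) / r)"
    using has_bochner_integral_exp_atLeast[OF assms, of "- a"] by simp
  then have "has_bochner_integral lborel (\<lambda>u. indicator {- a..} (0 + (- 1) * u) * exp (- (r * (0 + (- 1) * u))))
      ((exp (r * a) / r) /\<^sub>R \<bar>- 1\<bar>)"
    by (subst (asm) lborel_has_bochner_integral_real_affine_iff[where c = "- 1" and t = 0]) auto
  then show ?thesis by (simp add: indicator_def)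
qed

text \<open>The unnormalised gamma density of shape \<open>\<nu>\<close> and rate 1/2, in the
  logarithmic variable \<open>u\<close>; the logarithmic widths of the Gaussian components then run
  over the whole line.\<close>

definition matern_weight :: "real \<Rightarrow> real \<Rightarrow> real" where
  "matern_weight \<nu> u = exp (\<nu> * u - exp u / 2)"

lemma matern_weight_measurable [measurable]: "matern_weight \<nu> \<in> borel_measurable borel"
  unfolding matern_weight_def by measurable

lemma matern_weight_pos: "matern_weight \<nu> u > 0"
  by (simp add: matern_weight_def)

lemma matern_weight_le: "matern_weight \<nu> u \<le> exp (\<nu> * u)"
  by (simp add: matern_weight_def)

lemma integrable_matern_weight:
  assumes "\<nu> > 0"
  shows "integrable lborel (matern_weight \<nu>)"
proof (rule Bochner_Integration.integrable_bound)
  let ?g = "\<lambda>u::real. indicator {..0} u * exp (\<nu> * u) + exp ((\<nu> + 1)\<^sup>2) * (indicator {0..} u * exp (- (1 * u)))"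
  show "integrable lborel ?g"
    using has_bochner_integral_exp_atMost[OF assms, of 0] has_bochner_integral_exp_atLeast[of 1 0]
    by (intro Bochner_Integration.integrable_add integrable_mult_right) (auto simp: has_bochner_integral_iff)
  have "matern_weight \<nu> u \<le> ?g u" for u
  proof (cases "u \<le> 0")
    case True
    then have "matern_weight \<nu> u \<le> indicator {..0} u * exp (\<nu> * u)"
      using matern_weight_le by simp
    then show ?thesis by (rule order_trans) (simp add: indicator_def)
  next
    case False
    \<comment> \<open>The quadratic term of the exponential series beats the linear terms;
      completing the square yields the constant (\<nu> + 1)^2.\<close>
    have "1 + u + u\<^sup>2 / 2 \<le> exp u" using False by (intro exp_lower_Taylor_quadratic) simp
    then have "\<nu> * u - exp u / 2 \<le> \<nu> * u - u\<^sup>2 / 4" using False by simp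
    also have "\<dots> \<le> (\<nu> + 1)\<^sup>2 - u"
      using zero_le_power2[of "u / 2 - (\<nu> + 1)"] by (simp add: power2_eq_square algebra_simps)
    finally have "matern_weight \<nu> u \<le> exp ((\<nu> + 1)\<^sup>2 + - u)"
      unfolding matern_weight_def by (subst exp_le_cancel_iff) simp
    then show ?thesis using False unfolding exp_add by simp
  qed
  then show "AE u in lborel. norm (matern_weight \<nu> u) \<le> norm (?g u)"
    using matern_weight_pos[of \<nu>] by (intro AE_I2) (smt (verit) real_norm_def)
qed simp

lemma integrable_matern_weight_mult:
  assumes "\<nu> > 0" "h \<in> borel_measurable borel" "\<And>u. 0 \<le> h u" "\<And>u. h u \<le> 1"
  shows "integrable lborel (\<lambda>u. matern_weight \<nu> u * h u)"
proof (rule Bochner_Integration.integrable_bound[OF integrable_matern_weight[OF assms(1)]])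
  show "(\<lambda>u. matern_weight \<nu> u * h u) \<in> borel_measurable lborel" using assms(2) by simp
  have "norm (matern_weight \<nu> u * h u) \<le> norm (matern_weight \<nu> u)" for u
    using assms(3,4)[of u] matern_weight_pos[of \<nu> u] by (simp add: abs_mult mult_left_le)
  then show "AE u in lborel. norm (matern_weight \<nu> u * h u) \<le> norm (matern_weight \<nu> u)" by simp
qed

definition matern_mixture :: "real \<Rightarrow> real \<Rightarrow> real" where
  "matern_mixture \<nu> z = (\<integral>u. matern_weight \<nu> u * exp (- (z\<^sup>2 * exp (- u) / 2)) \<partial>lborel) / 2"

lemma integrable_matern_mixture:
  assumes "\<nu> > 0"
  shows "integrable lborel (\<lambda>u. matern_weight \<nu> u * exp (- (z\<^sup>2 * exp (- u) / 2)))"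
  using assms by (intro integrable_matern_weight_mult) auto

text \<open>
  The translation \<open>t = u - ln z\<close> in the integral over the whole line separates the variable \<open>z\<close>:
  it turns \<open>z cosh t\<close> into \<open>(exp u + z\<^sup>2 exp (- u)) / 2\<close>.
\<close>

lemma powr_bessel_K_eq_mixture:
  assumes "\<nu> > 0" "z > 0"
  shows "z powr \<nu> * bessel_K \<nu> z = matern_mixture \<nu> z"
proof -
  define g where "g t = exp (- z * cosh t) * exp (\<nu> * t)" for t
  define e where "e t = exp (- z * cosh t) * cosh (\<nu> * t)" for t
  let ?I = "\<integral>u. matern_weight \<nu> u * exp (- (z\<^sup>2 * exp (- u) / 2)) \<partial>lborel"
  have gs: "g (- ln z + 1 * u) = z powr (- \<nu>) * (matern_weight \<nu> u * exp (- (z\<^sup>2 * exp (- u) / 2)))" for u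
  proof -
    have "exp (u - ln z) = exp u / z" "exp (- (u - ln z)) = z * exp (- u)"
      using assms(2) by (simp_all add: exp_diff exp_minus field_simps)
    then have c: "z * cosh (u - ln z) = (exp u + z\<^sup>2 * exp (- u)) / 2"
      using assms(2) by (simp add: cosh_def power2_eq_square field_simps)
    have "g (- ln z + 1 * u) = exp (- (z * cosh (u - ln z)) + \<nu> * (u - ln z))"
      by (simp add: g_def flip: exp_add)
    also have "\<dots> = exp (- \<nu> * ln z + ((\<nu> * u - exp u / 2) + - (z\<^sup>2 * exp (- u) / 2)))"
      unfolding c by (rule arg_cong[of _ _ exp]) (simp add: field_simps)
    also have "\<dots> = z powr (- \<nu>) * (matern_weight \<nu> u * exp (- (z\<^sup>2 * exp (- u) / 2)))"
      using assms(2) unfolding exp_add by (simp add: powr_def matern_weight_def)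
    finally show ?thesis .
  qed
  have "has_bochner_integral lborel (\<lambda>u. g (- ln z + 1 * u)) (z powr (- \<nu>) * ?I)"
    unfolding gs by (intro has_bochner_integral_mult_right)
      (simp add: has_bochner_integral_iff integrable_matern_mixture[OF assms(1)])
  then have g: "has_bochner_integral lborel g (z powr (- \<nu>) * ?I)"
    by (subst lborel_has_bochner_integral_real_affine_iff[where c = 1 and t = "- ln z"]) simp_all
  then have g': "has_bochner_integral lborel (\<lambda>t. g (- t)) (z powr (- \<nu>) * ?I)"
    by (subst (asm) lborel_has_bochner_integral_real_affine_iff[where c = "-1" and t = 0]) simp_all
  \<comment> \<open>The hyperbolic cosine averages the exponential over both signs of
    \<open>t\<close>; as \<open>e\<close> is even, the half-line integral defining
    \<open>bessel_K\<close> is half of the integral over the line.\<close>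
  have e: "e = (\<lambda>t. (g t + g (- t)) * (1 / 2))"
    by (simp add: e_def g_def cosh_def algebra_simps fun_eq_iff)
  have eI: "has_bochner_integral lborel e (z powr (- \<nu>) * ?I)"
    unfolding e using has_bochner_integral_mult_left[OF has_bochner_integral_add[OF g g'], of "1 / 2"]
    by simp
  have "integrable lborel (\<lambda>t. indicator {0..} t *\<^sub>R e t)"
    using eI by (intro integrable_mult_indicator) (auto simp: has_bochner_integral_iff)
  moreover have "(\<integral>t. indicator {0..} t *\<^sub>R e t \<partial>lborel) = bessel_K \<nu> z"
    unfolding bessel_K_def set_lebesgue_integral_def by (simp add: e_def)
  ultimately have "has_bochner_integral lborel (\<lambda>t. indicator {0..} t *\<^sub>R e t) (bessel_K \<nu> z)"
    by (simp add: has_bochner_integral_iff)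
  then have "has_bochner_integral lborel e (2 *\<^sub>R bessel_K \<nu> z)"
    by (rule has_bochner_integral_even_function) (simp add: e_def)
  then have "2 * bessel_K \<nu> z = z powr (- \<nu>) * ?I"
    using has_bochner_integral_eq[OF _ eI] by fastforce
  then have "2 * (z powr \<nu> * bessel_K \<nu> z) = (z powr \<nu> * z powr (- \<nu>)) * ?I" by simp
  also have "z powr \<nu> * z powr (- \<nu>) = 1" using assms(2) by (simp flip: powr_add)
  finally show ?thesis by (simp add: matern_mixture_def)
qed

text \<open>Dominated convergence identifies the value at 0 that \<open>matern_profile\<close>
  defines as a limit.\<close>

lemma matern_mixture_tendsto:
  assumes "\<nu> > 0"
  shows "(matern_mixture \<nu> \<longlongrightarrow> matern_mixture \<nu> 0) (at_right 0)"
proof (rule tendsto_at_right_sequentially[of 0 1])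
  fix S :: "nat \<Rightarrow> real" assume S: "S \<longlonglongrightarrow> 0"
  have "(\<lambda>n. \<integral>u. matern_weight \<nu> u * exp (- ((S n)\<^sup>2 * exp (- u) / 2)) \<partial>lborel)
     \<longlonglongrightarrow> (\<integral>u. matern_weight \<nu> u * exp (- (0\<^sup>2 * exp (- u) / 2)) \<partial>lborel)"
  proof (rule integral_dominated_convergence[where w = "matern_weight \<nu>"])
    show "integrable lborel (matern_weight \<nu>)" using assms by (rule integrable_matern_weight)
    show "AE u in lborel. norm (matern_weight \<nu> u * exp (- ((S n)\<^sup>2 * exp (- u) / 2))) \<le> matern_weight \<nu> u" for n
      using matern_weight_pos[of \<nu>] by (intro AE_I2) (simp add: abs_mult mult_left_le less_imp_le)
    show "AE u in lborel. (\<lambda>n. matern_weight \<nu> u * exp (- ((S n)\<^sup>2 * exp (- u) / 2)))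
       \<longlonglongrightarrow> matern_weight \<nu> u * exp (- (0\<^sup>2 * exp (- u) / 2))"
      by (intro AE_I2 tendsto_intros S) simp
  qed auto
  then show "(\<lambda>n. matern_mixture \<nu> (S n)) \<longlonglongrightarrow> matern_mixture \<nu> 0"
    unfolding matern_mixture_def by (intro tendsto_divide tendsto_const) auto
qed simp

lemma matern_profile_eq_mixture:
  assumes "\<nu> > 0" "z \<ge> 0"
  shows "matern_profile \<nu> z = matern_mixture \<nu> z"
proof (cases "z = 0")
  case True
  have "((\<lambda>u. u powr \<nu> * bessel_K \<nu> u) \<longlongrightarrow> matern_mixture \<nu> 0) (at_right 0)"
  proof (rule Lim_transform_eventually[OF matern_mixture_tendsto[OF assms(1)]])
    show "\<forall>\<^sub>F u in at_right 0. matern_mixture \<nu> u = u powr \<nu> * bessel_K \<nu> u"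
      unfolding eventually_at_right_field using powr_bessel_K_eq_mixture[OF assms(1)]
      by (auto intro!: exI[of _ 1])
  qed
  then show ?thesis using True by (simp add: matern_profile_def tendsto_Lim)
next
  case False
  then show ?thesis using assms by (simp add: matern_profile_def powr_bessel_K_eq_mixture)
qed

abbreviation mixture_kernel :: "real \<Rightarrow> real \<Rightarrow> real \<Rightarrow> 'a::euclidean_space \<Rightarrow> 'a \<Rightarrow> real" where
  "mixture_kernel \<nu> l u \<equiv> gauss_kernel (\<nu> / l\<^sup>2 * exp (- u))"

lemma matern_eq_mixture:
  fixes x y :: "'a::euclidean_space"
  assumes "\<nu> > 0" "l > 0"
  shows "matern \<sigma> l c \<nu> x y =
    \<sigma>\<^sup>2 * c \<nu> / 2 * (\<integral>u. matern_weight \<nu> u * mixture_kernel \<nu> l u x y \<partial>lborel)"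
proof -
  let ?z = "sqrt (2 * \<nu>) * norm (x - y) / l"
  have "?z\<^sup>2 * exp (- u) / 2 = \<nu> / l\<^sup>2 * exp (- u) * (norm (x - y))\<^sup>2" for u
    using assms by (simp add: power_divide power_mult_distrib)
  then have "matern_mixture \<nu> ?z = (\<integral>u. matern_weight \<nu> u * mixture_kernel \<nu> l u x y \<partial>lborel) / 2"
    unfolding matern_mixture_def gauss_kernel_def by simp
  then show ?thesis
    using assms by (simp add: matern_def matern_profile_eq_mixture)
qed

text \<open>Bounds on Gaussian quadratic forms that hold for each \<open>u\<close> now integrate to
  bounds for the Matern kernel.\<close>

lemma has_bochner_integral_quad_form_matern:
  fixes X :: "'a::euclidean_space set"
  assumes "\<nu> > 0" "l > 0"
  shows "has_bochner_integral lborel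
      (\<lambda>u. \<sigma>\<^sup>2 * c \<nu> / 2 * (matern_weight \<nu> u * quad_form (mixture_kernel \<nu> l u) X a))
      (quad_form (matern \<sigma> l c \<nu>) X a)"
proof -
  have "has_bochner_integral lborel
     (\<lambda>u. \<Sum>x\<in>X. \<Sum>y\<in>X. (a x * a y * (\<sigma>\<^sup>2 * c \<nu> / 2)) * (matern_weight \<nu> u * mixture_kernel \<nu> l u x y))
     (\<Sum>x\<in>X. \<Sum>y\<in>X. (a x * a y * (\<sigma>\<^sup>2 * c \<nu> / 2)) * (\<integral>u. matern_weight \<nu> u * mixture_kernel \<nu> l u x y \<partial>lborel))"
    (is "has_bochner_integral lborel ?f ?i")
  proof (intro has_bochner_integral_sum has_bochner_integral_mult_right)
    fix x y :: 'a
    have "integrable lborel (\<lambda>u. matern_weight \<nu> u * mixture_kernel \<nu> l u x y)"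
      using assms by (intro integrable_matern_weight_mult) (auto simp: gauss_kernel_def)
    then show "has_bochner_integral lborel (\<lambda>u. matern_weight \<nu> u * mixture_kernel \<nu> l u x y)
       (\<integral>u. matern_weight \<nu> u * mixture_kernel \<nu> l u x y \<partial>lborel)"
      by (simp add: has_bochner_integral_iff)
  qed
  moreover have "?f = (\<lambda>u. \<sigma>\<^sup>2 * c \<nu> / 2 * (matern_weight \<nu> u * quad_form (mixture_kernel \<nu> l u) X a))"
    unfolding quad_form_def sum_distrib_left by (intro ext sum.cong refl) (simp only: mult_ac)
  moreover have "?i = quad_form (matern \<sigma> l c \<nu>) X a"
    unfolding quad_form_def matern_eq_mixture[OF assms] by (intro sum.cong refl) (simp only: mult_ac)
  ultimately show ?thesis by simp
qed

text \<open>Only the mixture components of width comparable to the separation distance are used.\<close>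

lemma coercive_matern:
  fixes X :: "'a::euclidean_space set"
  assumes "\<nu> > 0" "l > 0" "c \<nu> > 0"
    and "finite X" "q > 0" "\<And>x y. x \<in> X \<Longrightarrow> y \<in> X \<Longrightarrow> x \<noteq> y \<Longrightarrow> q \<le> norm (x - y)"
  defines "E \<equiv> \<nu> * q\<^sup>2 / (l\<^sup>2 * gauss_threshold DIM('a))"
  shows "coercive (matern \<sigma> l c \<nu>) X (\<sigma>\<^sup>2 * c \<nu> / 4 * (E powr \<nu> * exp (- \<nu> - E / 2)))"
  unfolding coercive_def
proof
  fix a :: "'a \<Rightarrow> real"
  let ?S = "\<Sum>x\<in>X. (a x)\<^sup>2"
  let ?k = "\<sigma>\<^sup>2 * c \<nu> / 2"
  have E: "E > 0" using assms gauss_threshold_pos[of "DIM('a)"] by (simp add: E_def)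
  \<comment> \<open>\<open>E\<close> is the value of exp u at which the rate of the component times
    q^2 equals \<open>gauss_threshold\<close>; for smaller values the components are coercive. On an
    interval of length 1 ending there the weight is at least
    \<open>E powr \<nu> * exp (- \<nu> - E / 2)\<close>, and the other components contribute
    nonnegatively.\<close>
  let ?J = "{ln E - 1..ln E}"
  have "has_bochner_integral lborel (indicator ?J :: real \<Rightarrow> real) (measure lborel ?J)"
    by (rule has_bochner_integral_real_indicator) auto
  then have J: "has_bochner_integral lborel (indicator ?J :: real \<Rightarrow> real) 1" by simp
  have "?k * (E powr \<nu> * exp (- \<nu> - E / 2) * (1/2 * ?S)) * 1 \<le> quad_form (matern \<sigma> l c \<nu>) X a"
  proof (rule has_bochner_integral_mono[OF has_bochner_integral_mult_right[OF J]
        has_bochner_integral_quad_form_matern[OF assms(1,2)]])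
    fix u
    let ?Q = "quad_form (mixture_kernel \<nu> l u) X a"
    have Q0: "?Q \<ge> 0" using assms by (intro quad_form_gauss_kernel_nonneg) auto
    have k: "?k \<ge> 0" using assms by simp
    show "?k * (E powr \<nu> * exp (- \<nu> - E / 2) * (1/2 * ?S)) * indicator ?J u \<le> ?k * (matern_weight \<nu> u * ?Q)"
    proof (cases "u \<in> ?J")
      case False
      then show ?thesis using Q0 k matern_weight_pos[of \<nu> u] by (simp add: less_imp_le)
    next
      case True
      have "exp u \<le> exp (ln E)" using True by (subst exp_le_cancel_iff) auto
      then have uE: "exp u \<le> E" using E by simp
      then have "gauss_threshold DIM('a) * exp u \<le> gauss_threshold DIM('a) * E"
        using gauss_threshold_pos[of "DIM('a)"] by simp
      also have "\<dots> = \<nu> / l\<^sup>2 * q\<^sup>2"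
        using gauss_threshold_pos[of "DIM('a)"] assms(2) by (simp add: E_def)
      finally have "gauss_threshold DIM('a) * exp u * exp (- u) \<le> \<nu> / l\<^sup>2 * q\<^sup>2 * exp (- u)"
        by (rule mult_right_mono) simp
      then have "gauss_threshold DIM('a) \<le> \<nu> / l\<^sup>2 * exp (- u) * q\<^sup>2"
        by (simp add: mult.assoc mult.left_commute[of _ "exp u"] mult_ac(2)[of "exp (- u)"] flip: exp_add)
      then have "coercive (mixture_kernel \<nu> l u) X (1/2)"
        using assms(4-6) by (intro coercive_gauss_kernel[where q = q])
      then have Q: "1/2 * ?S \<le> ?Q" unfolding coercive_def by (rule spec)
      have "\<nu> * (ln E - 1) \<le> \<nu> * u" using True assms(1) by (intro mult_left_mono) auto
      then have "\<nu> * ln E + (- \<nu> - E / 2) \<le> \<nu> * u - exp u / 2"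
        using uE by (simp add: algebra_simps)
      then have "exp (\<nu> * ln E + (- \<nu> - E / 2)) \<le> matern_weight \<nu> u"
        unfolding matern_weight_def by (subst exp_le_cancel_iff)
      then have w: "E powr \<nu> * exp (- \<nu> - E / 2) \<le> matern_weight \<nu> u"
        unfolding exp_add using E by (simp add: powr_def)
      have "E powr \<nu> * exp (- \<nu> - E / 2) * (1/2 * ?S) \<le> matern_weight \<nu> u * ?Q"
        using matern_weight_pos[of \<nu> u] by (intro mult_mono w Q) (auto simp: sum_nonneg)
      then have "?k * (E powr \<nu> * exp (- \<nu> - E / 2) * (1/2 * ?S)) \<le> ?k * (matern_weight \<nu> u * ?Q)"
        using k by (rule mult_left_mono)
      then show ?thesis using True by (simp only: indicator_simps mult_1_right)
    qed
  qed
  then show "\<sigma>\<^sup>2 * c \<nu> / 4 * (E powr \<nu> * exp (- \<nu> - E / 2)) * ?S \<le> quad_form (matern \<sigma> l c \<nu>) X a"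
    by (simp add: mult_ac)
qed

text \<open>The integral is split where the rate of the component times \<rho>^2 equals 1, that is
  at exp u = s. Narrower components are bounded trivially and integrate to s^\<nu> / \<nu>; for
  wider ones the cancellation gains (s exp (-u))^m, integrable because m > \<nu>. Both parts are of
  order \<rho>^(2 \<nu>).\<close>

lemma quad_form_matern_annihilator:
  fixes Y :: "'a::euclidean_space set"
  assumes "\<nu> > 0" "l > 0" "c \<nu> > 0" "\<nu> < real m"
    and "finite Y" "\<And>x y. x \<in> Y \<Longrightarrow> y \<in> Y \<Longrightarrow> norm (x - y) \<le> \<rho>" "\<rho> > 0"
    "\<And>w. w \<in> feature_words m \<Longrightarrow> (\<Sum>x\<in>Y. a x * word_feature w x) = 0"
  shows "quad_form (matern \<sigma> l c \<nu>) Y a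
     \<le> \<sigma>\<^sup>2 * c \<nu> / 2 * (3 * (\<Sum>x\<in>Y. \<bar>a x\<bar>)\<^sup>2 * ((\<nu> / l\<^sup>2 * \<rho>\<^sup>2) powr \<nu> * (1 / \<nu> + 1 / (real m - \<nu>))))"
proof -
  define s where "s = \<nu> / l\<^sup>2 * \<rho>\<^sup>2"
  have s: "s > 0" using assms by (simp add: s_def)
  have mnu: "real m - \<nu> > 0" using assms(4) by simp
  define g where "g u = indicator {..ln s} u * exp (\<nu> * u)
      + s ^ m * (indicator {ln s..} u * exp (- ((real m - \<nu>) * u)))" for u :: real
  let ?A = "3 * (\<Sum>x\<in>Y. \<bar>a x\<bar>)\<^sup>2"
  have "has_bochner_integral lborel g
     (exp (\<nu> * ln s) / \<nu> + s ^ m * (exp (- ((real m - \<nu>) * ln s)) / (real m - \<nu>)))"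
    unfolding g_def
    by (intro has_bochner_integral_add has_bochner_integral_mult_right
        has_bochner_integral_exp_atMost has_bochner_integral_exp_atLeast assms(1) mnu)
  moreover have "s ^ m * exp (- ((real m - \<nu>) * ln s)) = s powr \<nu>"
  proof -
    have "s ^ m * exp (- ((real m - \<nu>) * ln s)) = s powr real m * s powr (- (real m - \<nu>))"
      using s by (simp add: powr_realpow powr_def[of s "\<nu> - real m"] algebra_simps)
    also have "\<dots> = s powr \<nu>" unfolding powr_add[symmetric] by simp
    finally show ?thesis .
  qed
  moreover have "exp (\<nu> * ln s) = s powr \<nu>" using s by (simp add: powr_def)
  ultimately have g: "has_bochner_integral lborel g (s powr \<nu> * (1 / \<nu> + 1 / (real m - \<nu>)))"
    by (simp add: algebra_simps)
  show ?thesis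
    unfolding s_def[symmetric]
  proof (rule has_bochner_integral_mono[OF has_bochner_integral_quad_form_matern[OF assms(1,2)]
        has_bochner_integral_mult_right[OF has_bochner_integral_mult_right[OF g]]])
    fix u
    let ?Q = "quad_form (mixture_kernel \<nu> l u) Y a"
    have "?Q \<le> 3 * min 1 ((\<nu> / l\<^sup>2 * exp (- u) * \<rho>\<^sup>2) ^ m) * (\<Sum>x\<in>Y. \<bar>a x\<bar>)\<^sup>2"
      using assms by (intro quad_form_gauss_kernel_annihilator) auto
    also have "\<nu> / l\<^sup>2 * exp (- u) * \<rho>\<^sup>2 = s * exp (- u)" by (simp add: s_def)
    finally have Q: "?Q \<le> ?A * min 1 ((s * exp (- u)) ^ m)" by (simp add: mult_ac)
    have wg: "matern_weight \<nu> u * min 1 ((s * exp (- u)) ^ m) \<le> g u"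
    proof (cases "u \<le> ln s")
      case True
      have "matern_weight \<nu> u * min 1 ((s * exp (- u)) ^ m) \<le> exp (\<nu> * u) * 1"
        using s by (intro mult_mono matern_weight_le) auto
      also have "\<dots> \<le> g u" using True s by (simp add: g_def indicator_def)
      finally show ?thesis .
    next
      case False
      have "matern_weight \<nu> u * min 1 ((s * exp (- u)) ^ m) \<le> exp (\<nu> * u) * (s * exp (- u)) ^ m"
        using s by (intro mult_mono matern_weight_le) auto
      also have "\<dots> = s ^ m * exp (- ((real m - \<nu>) * u))"
      proof -
        have "exp (- u) ^ m = exp (- (real m * u))" by (simp flip: exp_of_nat_mult)
        then have "exp (\<nu> * u) * (s * exp (- u)) ^ m = s ^ m * (exp (\<nu> * u) * exp (- (real m * u)))"
          by (simp add: power_mult_distrib mult_ac)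
        also have "exp (\<nu> * u) * exp (- (real m * u)) = exp (- ((real m - \<nu>) * u))"
          unfolding exp_add[symmetric] by (simp add: algebra_simps)
        finally show ?thesis .
      qed
      also have "\<dots> \<le> g u" using False s by (simp add: g_def indicator_def)
      finally show ?thesis .
    qed
    have "matern_weight \<nu> u * ?Q \<le> matern_weight \<nu> u * (?A * min 1 ((s * exp (- u)) ^ m))"
      using matern_weight_pos[of \<nu> u] by (intro mult_left_mono Q) simp
    also have "\<dots> = ?A * (matern_weight \<nu> u * min 1 ((s * exp (- u)) ^ m))" by (simp only: mult_ac)
    also have "\<dots> \<le> ?A * g u" by (intro mult_left_mono wg) simp
    finally show "\<sigma>\<^sup>2 * c \<nu> / 2 * (matern_weight \<nu> u * ?Q) \<le> \<sigma>\<^sup>2 * c \<nu> / 2 * (?A * g u)"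
      using assms(3) by (intro mult_left_mono) auto
  qed
qed

lemma matern_commute: "matern \<sigma> l c \<nu> x y = matern \<sigma> l c \<nu> y x"
  by (simp add: matern_def norm_minus_commute)

lemma matern_diagonal: "matern \<sigma> l c \<nu> x x = matern \<sigma> l c \<nu> y y"
  by (simp add: matern_def)

section \<open>Exponential moments of Gaussian processes\<close>

lemma nn_integral_normal_density:
  "s > 0 \<Longrightarrow> (\<integral>\<^sup>+x. ennreal (normal_density m s x) \<partial>lborel) = 1"
  by (subst nn_integral_eq_integral) auto

lemma nn_integral_normal_density_exp:
  assumes "s > 0"
  shows "(\<integral>\<^sup>+x. ennreal (normal_density 0 s x * exp (b * x)) \<partial>lborel) = ennreal (exp (b\<^sup>2 * s\<^sup>2 / 2))"
proof -
  have "normal_density 0 s x * exp (b * x) = exp (b\<^sup>2 * s\<^sup>2 / 2) * normal_density (b * s\<^sup>2) s x" for x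
  proof -
    have "- x\<^sup>2 / (2 * s\<^sup>2) + b * x = b\<^sup>2 * s\<^sup>2 / 2 + - (x - b * s\<^sup>2)\<^sup>2 / (2 * s\<^sup>2)"
      using assms by (simp add: field_simps power2_eq_square)
    then have "exp (- x\<^sup>2 / (2 * s\<^sup>2)) * exp (b * x) = exp (b\<^sup>2 * s\<^sup>2 / 2) * exp (- (x - b * s\<^sup>2)\<^sup>2 / (2 * s\<^sup>2))"
      unfolding exp_add[symmetric] by (rule arg_cong)
    then show ?thesis by (simp add: normal_density_def)
  qed
  then have "(\<integral>\<^sup>+x. ennreal (normal_density 0 s x * exp (b * x)) \<partial>lborel)
     = (\<integral>\<^sup>+x. ennreal (exp (b\<^sup>2 * s\<^sup>2 / 2)) * ennreal (normal_density (b * s\<^sup>2) s x) \<partial>lborel)"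
    by (simp add: ennreal_mult)
  also have "\<dots> = ennreal (exp (b\<^sup>2 * s\<^sup>2 / 2))"
    by (subst nn_integral_cmult) (auto simp: nn_integral_normal_density[OF assms])
  finally show ?thesis .
qed

text \<open>Origin of the factor 1/4 in all exponential moments of squares below: the mean is finite
  for factors less than 1/2, and at 1/4 the integrand is sqrt 2 times a normal density of variance
  2.\<close>

lemma nn_integral_std_normal_density_exp_square:
  "(\<integral>\<^sup>+g. ennreal (std_normal_density g * exp (g\<^sup>2 / 4)) \<partial>lborel) = ennreal (sqrt 2)"
proof -
  have "std_normal_density g * exp (g\<^sup>2 / 4) = sqrt 2 * normal_density 0 (sqrt 2) g" for g
  proof -
    have "exp (- g\<^sup>2 / 2) * exp (g\<^sup>2 / 4) = exp (- g\<^sup>2 / 4)" by (simp flip: exp_add)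
    then show ?thesis by (simp add: normal_density_def real_sqrt_mult field_simps)
  qed
  then have "(\<integral>\<^sup>+g. ennreal (std_normal_density g * exp (g\<^sup>2 / 4)) \<partial>lborel)
     = (\<integral>\<^sup>+g. ennreal (sqrt 2) * ennreal (normal_density 0 (sqrt 2) g) \<partial>lborel)"
    by (simp add: ennreal_mult)
  also have "\<dots> = ennreal (sqrt 2)"
    by (subst nn_integral_cmult) (auto simp: nn_integral_normal_density)
  finally show ?thesis .
qed

text \<open>The third claim is the moment generating function at 1. Almost surely constant variables
  have no density and are treated apart; with mean zero they vanish almost surely.\<close>

lemma gaussian_variable_square_integrable:
  assumes "prob_space M" "gaussian_variable M Y"
  shows "integrable M Y" "integrable M (\<lambda>w. (Y w)\<^sup>2)"
    "(\<integral>w. Y w \<partial>M) = 0 \<Longrightarrow> (\<integral>\<^sup>+w. ennreal (exp (Y w)) \<partial>M) = ennreal (exp ((\<integral>w. (Y w)\<^sup>2 \<partial>M) / 2))"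
proof -
  interpret prob_space M by fact
  have Y [measurable]: "Y \<in> borel_measurable M" using assms(2) by (simp add: gaussian_variable_def)
  consider m s where "s > 0" "distributed M lborel Y (normal_density m s)"
    | m where "AE w in M. Y w = m"
    using assms(2) unfolding gaussian_variable_def by blast
  then have "integrable M Y \<and> integrable M (\<lambda>w. (Y w)\<^sup>2) \<and> ((\<integral>w. Y w \<partial>M) = 0 \<longrightarrow>
     (\<integral>\<^sup>+w. ennreal (exp (Y w)) \<partial>M) = ennreal (exp ((\<integral>w. (Y w)\<^sup>2 \<partial>M) / 2)))"
  proof cases
    case 1
    have i1: "integrable M Y"
      using distributed_integrable[OF 1(2), of "\<lambda>x. x"] integrable_normal_moment_nz_1[OF 1(1), of m] by simp
    have "integrable M (\<lambda>w. (Y w - m)\<^sup>2)"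
      using distributed_integrable[OF 1(2), of "\<lambda>x. (x - m)\<^sup>2"] integrable_normal_moment[OF 1(1), of m 2] by simp
    then have "integrable M (\<lambda>w. (Y w - m)\<^sup>2 + 2 * m * Y w - m\<^sup>2)" using i1 by simp
    moreover have "(\<lambda>w. (Y w - m)\<^sup>2 + 2 * m * Y w - m\<^sup>2) = (\<lambda>w. (Y w)\<^sup>2)"
      by (simp add: power2_eq_square algebra_simps fun_eq_iff)
    ultimately have i2: "integrable M (\<lambda>w. (Y w)\<^sup>2)" by simp
    have "(\<integral>\<^sup>+w. ennreal (exp (Y w)) \<partial>M) = ennreal (exp ((\<integral>w. (Y w)\<^sup>2 \<partial>M) / 2))" if z: "(\<integral>w. Y w \<partial>M) = 0"
    proof -
      have m: "m = 0" using normal_distributed_expectation[OF 1] z by simp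
      have v: "(\<integral>w. (Y w)\<^sup>2 \<partial>M) = s\<^sup>2" using normal_distributed_variance[OF 1] z by simp
      have "(\<integral>\<^sup>+w. ennreal (exp (Y w)) \<partial>M) = (\<integral>\<^sup>+x. ennreal (normal_density 0 s x) * ennreal (exp x) \<partial>lborel)"
        using distributed_nn_integral[OF 1(2), of "\<lambda>x. ennreal (exp x)"] m by simp
      also have "\<dots> = (\<integral>\<^sup>+x. ennreal (normal_density 0 s x * exp (1 * x)) \<partial>lborel)"
        by (simp add: ennreal_mult)
      also have "\<dots> = ennreal (exp (s\<^sup>2 / 2))"
        using nn_integral_normal_density_exp[OF 1(1), of 1] by simp
      finally show ?thesis unfolding v .
    qed
    then show ?thesis using i1 i2 by blast
  next
    case 2
    have "integrable M Y" using integrable_cong_AE[of Y M "\<lambda>_. m"] 2 by simp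
    moreover have "integrable M (\<lambda>w. (Y w)\<^sup>2)"
    proof -
      have "AE w in M. (Y w)\<^sup>2 = m\<^sup>2" using 2 by auto
      then show ?thesis by (subst integrable_cong_AE[where g = "\<lambda>_. m\<^sup>2"]) auto
    qed
    moreover have "(\<integral>\<^sup>+w. ennreal (exp (Y w)) \<partial>M) = ennreal (exp ((\<integral>w. (Y w)\<^sup>2 \<partial>M) / 2))" if z: "(\<integral>w. Y w \<partial>M) = 0"
    proof -
      have "(\<integral>w. Y w \<partial>M) = m" using integral_cong_AE[of Y M "\<lambda>_. m"] 2 by (simp add: prob_space)
      then have m: "m = 0" using z by simp
      have "(\<integral>w. (Y w)\<^sup>2 \<partial>M) = (\<integral>w. 0 \<partial>M)" using 2 m by (intro integral_cong_AE) auto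
      moreover have "(\<integral>\<^sup>+w. ennreal (exp (Y w)) \<partial>M) = (\<integral>\<^sup>+w. 1 \<partial>M)"
        using 2 m by (intro nn_integral_cong_AE) auto
      ultimately show ?thesis by (simp add: emeasure_space_1)
    qed
    ultimately show ?thesis by blast
  qed
  then show "integrable M Y" "integrable M (\<lambda>w. (Y w)\<^sup>2)"
    "(\<integral>w. Y w \<partial>M) = 0 \<Longrightarrow> (\<integral>\<^sup>+w. ennreal (exp (Y w)) \<partial>M) = ennreal (exp ((\<integral>w. (Y w)\<^sup>2 \<partial>M) / 2))"
    by blast+
qed

locale centered_gaussian_process =
  fixes M :: "'w measure" and T :: "'t set" and k :: "'t \<Rightarrow> 't \<Rightarrow> real" and f :: "'t \<Rightarrow> 'w \<Rightarrow> real"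
  assumes gp: "zero_mean_gaussian_process M T k f"
begin

sublocale prob_space M
  using gp by (simp add: zero_mean_gaussian_process_def gaussian_process_def)

lemma gaussian_sum:
  "finite S \<Longrightarrow> S \<subseteq> T \<Longrightarrow> gaussian_variable M (\<lambda>w. \<Sum>t\<in>S. a t * f t w)"
  using gp by (simp add: zero_mean_gaussian_process_def gaussian_process_def)

lemma gaussian_point: "t \<in> T \<Longrightarrow> gaussian_variable M (f t)"
  using gaussian_sum[of "{t}" "\<lambda>_. 1"] by simp

lemma measurable_point [measurable]: "t \<in> T \<Longrightarrow> f t \<in> borel_measurable M"
  using gaussian_point by (simp add: gaussian_variable_def)

lemma integrable_point: "t \<in> T \<Longrightarrow> integrable M (f t)"
  by (rule gaussian_variable_square_integrable(1)[OF prob_space_axioms gaussian_point])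

lemma expectation_point: "t \<in> T \<Longrightarrow> expectation (f t) = 0"
  using gp by (simp add: zero_mean_gaussian_process_def mean_fun_def)

lemma expectation_product: "s \<in> T \<Longrightarrow> t \<in> T \<Longrightarrow> expectation (\<lambda>w. f s w * f t w) = k s t"
  using gp by (auto simp: zero_mean_gaussian_process_def covariance_kernel_def)

lemma integrable_product:
  assumes "s \<in> T" "t \<in> T"
  shows "integrable M (\<lambda>w. f s w * f t w)"
proof (rule Bochner_Integration.integrable_bound)
  show "integrable M (\<lambda>w. (f s w)\<^sup>2 + (f t w)\<^sup>2)"
    using assms gaussian_variable_square_integrable(2)[OF prob_space_axioms gaussian_point]
    by (intro Bochner_Integration.integrable_add) auto
  have "\<bar>x * y\<bar> \<le> x\<^sup>2 + y\<^sup>2" for x y :: real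
  proof -
    have "2 * (\<bar>x\<bar> * \<bar>y\<bar>) \<le> \<bar>x\<bar>\<^sup>2 + \<bar>y\<bar>\<^sup>2" using sum_squares_bound[of "\<bar>x\<bar>" "\<bar>y\<bar>"] by (simp add: mult.assoc)
    moreover have "0 \<le> \<bar>x\<bar> * \<bar>y\<bar>" by simp
    ultimately have "\<bar>x\<bar> * \<bar>y\<bar> \<le> \<bar>x\<bar>\<^sup>2 + \<bar>y\<bar>\<^sup>2" by linarith
    then show ?thesis by (simp add: abs_mult)
  qed
  then show "AE w in M. norm (f s w * f t w) \<le> norm ((f s w)\<^sup>2 + (f t w)\<^sup>2)"
    by (intro AE_I2) (auto intro: order_trans[OF _ abs_ge_self])
qed (use assms in measurable)

text \<open>The exponential moments below rest on this formula. It sees the process only through its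
  covariance, so that uncorrelatedness does the work of independence.\<close>

lemma nn_expectation_exp_sum:
  assumes "finite S" "S \<subseteq> T"
  shows "(\<integral>\<^sup>+w. ennreal (exp (\<Sum>t\<in>S. a t * f t w)) \<partial>M) = ennreal (exp (quad_form k S a / 2))"
proof -
  have "expectation (\<lambda>w. \<Sum>t\<in>S. a t * f t w) = (\<Sum>t\<in>S. a t * expectation (f t))"
    using assms integrable_point by (subst Bochner_Integration.integral_sum) (auto intro!: integrable_mult_right)
  also have "\<dots> = 0" using assms expectation_point by (intro sum.neutral) auto
  finally have z: "expectation (\<lambda>w. \<Sum>t\<in>S. a t * f t w) = 0" .
  have sq: "(\<Sum>t\<in>S. a t * f t w)\<^sup>2 = (\<Sum>s\<in>S. \<Sum>t\<in>S. a s * a t * (f s w * f t w))" for w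
    unfolding power2_eq_square sum_product by (intro sum.cong refl) (simp only: mult_ac)
  have "expectation (\<lambda>w. (\<Sum>t\<in>S. a t * f t w)\<^sup>2) = (\<Sum>s\<in>S. \<Sum>t\<in>S. a s * a t * expectation (\<lambda>w. f s w * f t w))"
    unfolding sq
  proof (subst Bochner_Integration.integral_sum)
    show "integrable M (\<lambda>w. \<Sum>t\<in>S. a s * a t * (f s w * f t w))" if "s \<in> S" for s
      using that assms(2) by (intro Bochner_Integration.integrable_sum integrable_mult_right integrable_product) auto
    show "(\<Sum>s\<in>S. expectation (\<lambda>w. \<Sum>t\<in>S. a s * a t * (f s w * f t w)))
       = (\<Sum>s\<in>S. \<Sum>t\<in>S. a s * a t * expectation (\<lambda>w. f s w * f t w))"
    proof (rule sum.cong[OF refl])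
      fix s assume "s \<in> S"
      then show "expectation (\<lambda>w. \<Sum>t\<in>S. a s * a t * (f s w * f t w))
         = (\<Sum>t\<in>S. a s * a t * expectation (\<lambda>w. f s w * f t w))"
        using assms(2) by (subst Bochner_Integration.integral_sum)
          (auto intro!: integrable_mult_right integrable_product simp: subset_iff simp del: integrable_mult_right_iff)
    qed
  qed
  also have "\<dots> = quad_form k S a"
    unfolding quad_form_def using assms by (intro sum.cong refl) (auto simp: expectation_product subset_iff)
  finally show ?thesis
    using gaussian_variable_square_integrable(3)[OF prob_space_axioms gaussian_sum[OF assms] z] by simp
qed

text \<open>
  A Gaussian average linearises the square: \<open>exp (z\<^sup>2 / 4)\<close> is the mean of \<open>exp (g z / sqrt 2)\<close>
  over a standard normal \<open>g\<close>.
\<close>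

lemma nn_expectation_exp_square:
  assumes [measurable]: "Y \<in> borel_measurable M" "Z \<in> borel_measurable M"
  shows "(\<integral>\<^sup>+w. ennreal (exp (Y w + (Z w)\<^sup>2 / 4)) \<partial>M)
    = (\<integral>\<^sup>+g. ennreal (std_normal_density g) * (\<integral>\<^sup>+w. ennreal (exp (Y w + g / sqrt 2 * Z w)) \<partial>M) \<partial>lborel)"
proof -
  interpret pair_sigma_finite M lborel ..
  have "ennreal (exp (Y w + (Z w)\<^sup>2 / 4))
     = (\<integral>\<^sup>+g. ennreal (std_normal_density g) * ennreal (exp (Y w + g / sqrt 2 * Z w)) \<partial>lborel)" for w
  proof -
    have "(\<integral>\<^sup>+g. ennreal (std_normal_density g) * ennreal (exp (Y w + g / sqrt 2 * Z w)) \<partial>lborel)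
      = (\<integral>\<^sup>+g. ennreal (exp (Y w)) * ennreal (std_normal_density g * exp (Z w / sqrt 2 * g)) \<partial>lborel)"
      unfolding exp_add by (intro nn_integral_cong) (simp add: ennreal_mult mult_ac)
    also have "\<dots> = ennreal (exp (Y w)) * ennreal (exp ((Z w / sqrt 2)\<^sup>2 * 1\<^sup>2 / 2))"
      using nn_integral_normal_density_exp[of 1 "Z w / sqrt 2"] by (subst nn_integral_cmult) auto
    also have "\<dots> = ennreal (exp (Y w + (Z w)\<^sup>2 / 4))"
      unfolding exp_add by (simp add: ennreal_mult power_divide)
    finally show ?thesis by simp
  qed
  then have "(\<integral>\<^sup>+w. ennreal (exp (Y w + (Z w)\<^sup>2 / 4)) \<partial>M)
     = (\<integral>\<^sup>+w. (\<integral>\<^sup>+g. ennreal (std_normal_density g) * ennreal (exp (Y w + g / sqrt 2 * Z w)) \<partial>lborel) \<partial>M)"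
    by simp
  also have "\<dots> = (\<integral>\<^sup>+g. (\<integral>\<^sup>+w. ennreal (std_normal_density g) * ennreal (exp (Y w + g / sqrt 2 * Z w)) \<partial>M) \<partial>lborel)"
    by (rule Fubini'[symmetric]) measurable
  also have "\<dots> = (\<integral>\<^sup>+g. ennreal (std_normal_density g) * (\<integral>\<^sup>+w. ennreal (exp (Y w + g / sqrt 2 * Z w)) \<partial>M) \<partial>lborel)"
    by (intro nn_integral_cong nn_integral_cmult) measurable
  finally show ?thesis .
qed

lemma nn_expectation_exp_normalized_square:
  assumes "finite S" "S \<subseteq> T" "quad_form k S a = 1"
  shows "(\<integral>\<^sup>+w. ennreal (exp ((\<Sum>t\<in>S. a t * f t w)\<^sup>2 / 4)) \<partial>M) = ennreal (sqrt 2)"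
proof -
  have q: "quad_form k S (\<lambda>t. g * a t) = g\<^sup>2" for g
  proof -
    have "quad_form k S (\<lambda>t. g * a t) = g\<^sup>2 * quad_form k S a"
      unfolding quad_form_def sum_distrib_left power2_eq_square by (intro sum.cong refl) (simp only: mult_ac)
    then show ?thesis using assms(3) by simp
  qed
  have "(\<integral>\<^sup>+w. ennreal (exp ((\<Sum>t\<in>S. a t * f t w)\<^sup>2 / 4)) \<partial>M)
     = (\<integral>\<^sup>+g. ennreal (std_normal_density g) * (\<integral>\<^sup>+w. ennreal (exp (0 + g / sqrt 2 * (\<Sum>t\<in>S. a t * f t w))) \<partial>M) \<partial>lborel)"
    using nn_expectation_exp_square[of "\<lambda>_. 0" "\<lambda>w. \<Sum>t\<in>S. a t * f t w"] gaussian_sum[OF assms(1,2)]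
    by (simp add: gaussian_variable_def)
  also have "\<dots> = (\<integral>\<^sup>+g. ennreal (std_normal_density g * exp (g\<^sup>2 / 4)) \<partial>lborel)"
  proof (rule nn_integral_cong)
    fix g :: real
    have "(\<integral>\<^sup>+w. ennreal (exp (0 + g / sqrt 2 * (\<Sum>t\<in>S. a t * f t w))) \<partial>M)
       = (\<integral>\<^sup>+w. ennreal (exp (\<Sum>t\<in>S. (g / sqrt 2 * a t) * f t w)) \<partial>M)"
      by (simp add: sum_distrib_left mult_ac)
    also have "\<dots> = ennreal (exp (g\<^sup>2 / 4))"
      unfolding nn_expectation_exp_sum[OF assms(1,2)] q by (simp add: power_divide)
    finally show "ennreal (std_normal_density g) * (\<integral>\<^sup>+w. ennreal (exp (0 + g / sqrt 2 * (\<Sum>t\<in>S. a t * f t w))) \<partial>M)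
       = ennreal (std_normal_density g * exp (g\<^sup>2 / 4))" by (simp add: ennreal_mult)
  qed
  also have "\<dots> = ennreal (sqrt 2)" by (rule nn_integral_std_normal_density_exp_square)
  finally show ?thesis .
qed

lemma residual_measurable:
  assumes "distinct xs" "p \<notin> set xs" "c > 0" "coercive k (set xs) c" "\<And>x y. k x y = k y x"
    "insert p (set xs) \<subseteq> T"
  shows "(\<lambda>w. f p w - cond_mean k (\<lambda>t. f t w) xs p) \<in> borel_measurable M"
proof -
  obtain a where "residual_weights k xs p a"
    by (rule ex_residual_weights[OF assms(1-5)])
  note a = residual_weightsD[OF this]
  have e: "f p w - cond_mean k (\<lambda>t. f t w) xs p = (\<Sum>y\<in>insert p (set xs). f y w * a y)" for w
    by (rule a(4)[rule_format, of "\<lambda>t. f t w", symmetric])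
  show ?thesis
    unfolding e using assms(6)
    by (intro borel_measurable_sum borel_measurable_times measurable_point) auto
qed

lemma data_fit_measurable:
  assumes "distinct xs" "c > 0" "coercive k (set xs) c" "\<And>x y. k x y = k y x" "set xs \<subseteq> T"
  shows "(\<lambda>w. data_fit k (\<lambda>t. f t w) xs) \<in> borel_measurable M"
  using assms
proof (induction xs rule: rev_induct)
  case Nil
  show ?case by (simp add: data_fit_def data_vec_def scalar_prod_def inverse_mat_def)
next
  case (snoc p xs)
  have d: "distinct xs" "p \<notin> set xs" using snoc.prems(1) by auto
  have co: "coercive k (set xs) c" using coercive_subset[OF snoc.prems(3), of "set xs"] by auto
  have "(\<lambda>w. data_fit k (\<lambda>t. f t w) xs + (f p w - cond_mean k (\<lambda>t. f t w) xs p)\<^sup>2 / cond_var k xs p)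
     \<in> borel_measurable M"
    using residual_measurable[OF d snoc.prems(2) co snoc.prems(4)] snoc.IH[OF d(1) snoc.prems(2) co snoc.prems(4)]
      snoc.prems(5)
    by (intro borel_measurable_add borel_measurable_divide borel_measurable_power) auto
  then show ?case unfolding data_fit_snoc[OF snoc.prems(1-4)] .
qed

text \<open>The innovation at \<open>p\<close>: scaled by the conditional standard deviation it has
  unit variance, and it is uncorrelated with the process on \<open>xs\<close>.\<close>

lemma normalized_residual:
  assumes "distinct xs" "p \<notin> set xs" "c > 0" "coercive k (insert p (set xs)) c" "\<And>x y. k x y = k y x"
  obtains a where "quad_form k (insert p (set xs)) a = 1"
    "\<forall>z\<in>set xs. (\<Sum>y\<in>insert p (set xs). k z y * a y) = 0"
    "\<forall>f. (\<Sum>y\<in>insert p (set xs). a y * f y)\<^sup>2 = (f p - cond_mean k f xs p)\<^sup>2 / cond_var k xs p"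
proof -
  let ?Y = "insert p (set xs)"
  let ?V = "cond_var k xs p"
  have co: "coercive k (set xs) c" using coercive_subset[OF assms(4), of "set xs"] by auto
  have V: "?V > 0" using cond_var_ge[OF assms] assms(3) by simp
  obtain a where "residual_weights k xs p a"
    by (rule ex_residual_weights[OF assms(1-3) co assms(5)])
  note a = residual_weightsD[OF this]
  have s: "(\<Sum>y\<in>?Y. g y * (a y / sqrt ?V)) = (\<Sum>y\<in>?Y. g y * a y) / sqrt ?V" for g
    unfolding sum_divide_distrib by (intro sum.cong refl) (simp only: times_divide_eq_right)
  show ?thesis
  proof (rule that[of "\<lambda>y. a y / sqrt ?V"])
    have "quad_form k ?Y (\<lambda>y. a y / sqrt ?V) = quad_form k ?Y a / (sqrt ?V * sqrt ?V)"
      unfolding quad_form_def sum_divide_distrib by (intro sum.cong refl) (simp add: field_simps)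
    then show "quad_form k ?Y (\<lambda>y. a y / sqrt ?V) = 1" using V a(5) by simp
    show "\<forall>z\<in>set xs. (\<Sum>y\<in>?Y. k z y * (a y / sqrt ?V)) = 0"
      unfolding s using a(2) by (auto simp only: div_0)
    show "\<forall>f. (\<Sum>y\<in>?Y. a y / sqrt ?V * f y)\<^sup>2 = (f p - cond_mean k f xs p)\<^sup>2 / ?V"
    proof
      fix f
      have "(\<Sum>y\<in>?Y. a y / sqrt ?V * f y) = (f p - cond_mean k f xs p) / sqrt ?V"
        using s[of f] a(4) by (simp only: mult.commute[of "_ / _"])
      then show "(\<Sum>y\<in>?Y. a y / sqrt ?V * f y)\<^sup>2 = (f p - cond_mean k f xs p)\<^sup>2 / ?V"
        using V by (simp only: power_divide real_sqrt_pow2[OF less_imp_le])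
    qed
  qed
qed

lemma nn_expectation_exp_residual:
  assumes "distinct xs" "p \<notin> set xs" "c > 0" "coercive k (insert p (set xs)) c" "\<And>x y. k x y = k y x"
    "insert p (set xs) \<subseteq> T"
  shows "(\<integral>\<^sup>+w. ennreal (exp ((f p w - cond_mean k (\<lambda>t. f t w) xs p)\<^sup>2 / cond_var k xs p / 4)) \<partial>M) = ennreal (sqrt 2)"
proof -
  obtain a where a: "quad_form k (insert p (set xs)) a = 1"
    "\<forall>z\<in>set xs. (\<Sum>y\<in>insert p (set xs). k z y * a y) = 0"
    "\<forall>f. (\<Sum>y\<in>insert p (set xs). a y * f y)\<^sup>2 = (f p - cond_mean k f xs p)\<^sup>2 / cond_var k xs p"
    by (rule normalized_residual[OF assms(1-5)])
  have e: "(f p w - cond_mean k (\<lambda>t. f t w) xs p)\<^sup>2 / cond_var k xs p = (\<Sum>y\<in>insert p (set xs). a y * f y w)\<^sup>2" for w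
    by (rule a(3)[rule_format, of "\<lambda>t. f t w", symmetric])
  show ?thesis
    unfolding e using assms(6) a(1) by (intro nn_expectation_exp_normalized_square) auto
qed

lemma quad_form_add_scaled:
  assumes "\<And>x y. k x y = k y x"
  shows "quad_form k S (\<lambda>t. b t + h * a t)
    = quad_form k S b + 2 * h * (\<Sum>s\<in>S. a s * (\<Sum>t\<in>S. b t * k s t)) + h\<^sup>2 * quad_form k S a"
proof -
  have 1: "(\<Sum>s\<in>S. a s * (\<Sum>t\<in>S. b t * k s t)) = (\<Sum>s\<in>S. \<Sum>t\<in>S. a s * b t * k s t)"
    unfolding sum_distrib_left by (intro sum.cong refl) (simp only: mult_ac)
  have 2: "(\<Sum>s\<in>S. \<Sum>t\<in>S. b s * a t * k s t) = (\<Sum>s\<in>S. \<Sum>t\<in>S. a s * b t * k s t)"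
    by (subst sum.swap) (intro sum.cong refl, simp add: assms[of _ _] mult_ac)
  have "quad_form k S (\<lambda>t. b t + h * a t) = (\<Sum>s\<in>S. \<Sum>t\<in>S. b s * b t * k s t + h * (b s * a t * k s t)
      + h * (a s * b t * k s t) + h\<^sup>2 * (a s * a t * k s t))"
    unfolding quad_form_def by (intro sum.cong refl) (simp add: power2_eq_square algebra_simps)
  also have "\<dots> = quad_form k S b + h * (\<Sum>s\<in>S. \<Sum>t\<in>S. b s * a t * k s t)
      + h * (\<Sum>s\<in>S. \<Sum>t\<in>S. a s * b t * k s t) + h\<^sup>2 * quad_form k S a"
    unfolding quad_form_def by (simp only: sum.distrib sum_distrib_left)
  finally show ?thesis unfolding 1 2 by simp
qed

text \<open>The additional linear combination, uncorrelated with the data, makes the induction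
  close: the square contributed by the last point is linearised, and the resulting term, g / sqrt 2
  times its innovation, joins \<open>b\<close> because it is uncorrelated with all earlier points.
  Integration over \<open>g\<close> costs a factor sqrt 2 per point.\<close>

lemma nn_expectation_exp_data_fit_add:
  assumes "distinct xs" "c > 0" "coercive k (set xs) c" "\<And>x y. k x y = k y x"
    "finite S" "set xs \<subseteq> S" "S \<subseteq> T" "\<And>x. x \<in> set xs \<Longrightarrow> (\<Sum>t\<in>S. b t * k x t) = 0"
  shows "(\<integral>\<^sup>+w. ennreal (exp (data_fit k (\<lambda>t. f t w) xs / 4 + (\<Sum>t\<in>S. b t * f t w))) \<partial>M)
    = ennreal (sqrt 2 ^ length xs * exp (quad_form k S b / 2))"
  using assms
proof (induction xs arbitrary: b rule: rev_induct)
  case Nil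
  have "data_fit k g [] = 0" for g
    by (simp add: data_fit_def data_vec_def scalar_prod_def inverse_kernel_mat_Nil[THEN carrier_matD(1)])
  then show ?case using nn_expectation_exp_sum[OF assms(5,7)] by simp
next
  case (snoc p xs)
  let ?Y = "insert p (set xs)"
  have d: "distinct xs" "p \<notin> set xs" using snoc.prems(1) by auto
  have coY: "coercive k ?Y c" using snoc.prems(3) by simp
  have co: "coercive k (set xs) c" using coercive_subset[OF snoc.prems(3), of "set xs"] by auto
  have YS: "?Y \<subseteq> S" using snoc.prems(6) by simp
  obtain a0 where a0: "quad_form k ?Y a0 = 1"
    "\<forall>z\<in>set xs. (\<Sum>y\<in>?Y. k z y * a0 y) = 0"
    "\<forall>f. (\<Sum>y\<in>?Y. a0 y * f y)\<^sup>2 = (f p - cond_mean k f xs p)\<^sup>2 / cond_var k xs p"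
    by (rule normalized_residual[OF d snoc.prems(2) coY snoc.prems(4)])
  define a where "a y = (if y \<in> ?Y then a0 y else 0)" for y
  have aS: "(\<Sum>y\<in>S. a y * g y) = (\<Sum>y\<in>?Y. a0 y * g y)" for g
    using YS snoc.prems(5) by (intro sum.mono_neutral_cong_right) (auto simp: a_def)
  have qa: "quad_form k S a = 1"
  proof -
    have "quad_form k S a = quad_form k ?Y a"
      using YS snoc.prems(5) by (intro quad_form_extend) (auto simp: a_def)
    also have "\<dots> = quad_form k ?Y a0" unfolding quad_form_def by (intro sum.cong refl) (auto simp: a_def)
    finally show ?thesis using a0(1) by simp
  qed
  have cross: "(\<Sum>s\<in>S. a s * (\<Sum>t\<in>S. b t * k s t)) = 0"
    unfolding aS by (rule sum.neutral) (use snoc.prems(8) in auto)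
  have orth: "(\<Sum>t\<in>S. (b t + h * a t) * k x t) = 0" if "x \<in> set xs" for x h
  proof -
    have "(\<Sum>t\<in>S. (b t + h * a t) * k x t) = (\<Sum>t\<in>S. b t * k x t) + h * (\<Sum>t\<in>S. a t * k x t)"
      unfolding sum_distrib_left sum.distrib[symmetric] by (intro sum.cong refl) (simp add: algebra_simps)
    also have "(\<Sum>t\<in>S. a t * k x t) = 0"
      unfolding aS using a0(2) that by (simp only: mult.commute[of "a0 _"])
    finally show ?thesis using snoc.prems(8)[of x] that by simp
  qed
  let ?D = "\<lambda>w. data_fit k (\<lambda>t. f t w) xs" and ?L = "\<lambda>w. \<Sum>t\<in>S. b t * f t w" and ?Z = "\<lambda>w. \<Sum>t\<in>S. a t * f t w"
  have m: "(\<lambda>w. ?D w / 4 + ?L w) \<in> borel_measurable M" "?Z \<in> borel_measurable M"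
    using data_fit_measurable[OF d(1) snoc.prems(2) co snoc.prems(4)] YS snoc.prems(7)
      gaussian_sum[OF snoc.prems(5,7)] by (auto simp: gaussian_variable_def intro!: borel_measurable_add)
  have "data_fit k (\<lambda>t. f t w) (xs @ [p]) / 4 + ?L w = (?D w / 4 + ?L w) + (?Z w)\<^sup>2 / 4" for w
    unfolding data_fit_snoc[OF snoc.prems(1-4)] aS a0(3)[rule_format] by (simp add: add_divide_distrib)
  then have "(\<integral>\<^sup>+w. ennreal (exp (data_fit k (\<lambda>t. f t w) (xs @ [p]) / 4 + ?L w)) \<partial>M)
     = (\<integral>\<^sup>+w. ennreal (exp ((?D w / 4 + ?L w) + (?Z w)\<^sup>2 / 4)) \<partial>M)"
    by (simp only:)
  also have "\<dots> = (\<integral>\<^sup>+g. ennreal (std_normal_density g) * (\<integral>\<^sup>+w. ennreal (exp (?D w / 4 + ?L w + g / sqrt 2 * ?Z w)) \<partial>M) \<partial>lborel)"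
    by (rule nn_expectation_exp_square[OF m])
  also have "\<dots> = (\<integral>\<^sup>+g. ennreal (sqrt 2 ^ length xs * exp (quad_form k S b / 2)) * ennreal (std_normal_density g * exp (g\<^sup>2 / 4)) \<partial>lborel)"
  proof (rule nn_integral_cong)
    fix g :: real
    have e: "?D w / 4 + ?L w + g / sqrt 2 * ?Z w = ?D w / 4 + (\<Sum>t\<in>S. (b t + g / sqrt 2 * a t) * f t w)" for w
      unfolding distrib_right sum.distrib sum_distrib_left by (simp only: mult_ac add_ac)
    have "(\<integral>\<^sup>+w. ennreal (exp (?D w / 4 + ?L w + g / sqrt 2 * ?Z w)) \<partial>M)
       = ennreal (sqrt 2 ^ length xs * exp (quad_form k S (\<lambda>t. b t + g / sqrt 2 * a t) / 2))"
      unfolding e by (rule snoc.IH[OF d(1) snoc.prems(2) co snoc.prems(4,5) _ snoc.prems(7) orth]) (use YS in auto)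
    \<comment> \<open>There is no cross term: \<open>a\<close> lives on points with which the
      combination \<open>b\<close> is uncorrelated.\<close>
    also have "quad_form k S (\<lambda>t. b t + g / sqrt 2 * a t) = quad_form k S b + g\<^sup>2 / 2"
      unfolding quad_form_add_scaled[OF snoc.prems(4)] cross qa by (simp add: power_divide)
    finally have "(\<integral>\<^sup>+w. ennreal (exp (?D w / 4 + ?L w + g / sqrt 2 * ?Z w)) \<partial>M)
       = ennreal (sqrt 2 ^ length xs * exp (quad_form k S b / 2) * exp (g\<^sup>2 / 4))"
      by (simp add: add_divide_distrib exp_add mult_ac)
    then show "ennreal (std_normal_density g) * (\<integral>\<^sup>+w. ennreal (exp (?D w / 4 + ?L w + g / sqrt 2 * ?Z w)) \<partial>M)
      = ennreal (sqrt 2 ^ length xs * exp (quad_form k S b / 2)) * ennreal (std_normal_density g * exp (g\<^sup>2 / 4))"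
      by (simp add: ennreal_mult[symmetric] mult_ac)
  qed
  also have "\<dots> = ennreal (sqrt 2 ^ length xs * exp (quad_form k S b / 2)) * ennreal (sqrt 2)"
    by (subst nn_integral_cmult) (auto simp: nn_integral_std_normal_density_exp_square)
  also have "\<dots> = ennreal (sqrt 2 ^ length (xs @ [p]) * exp (quad_form k S b / 2))"
    by (simp add: ennreal_mult[symmetric] mult_ac)
  finally show ?case .
qed

text \<open>The value at 1/4 of the moment generating function of a chi-squared variable with
  \<open>length xs\<close> degrees of freedom.\<close>

lemma nn_expectation_exp_data_fit:
  assumes "distinct xs" "c > 0" "coercive k (set xs) c" "\<And>x y. k x y = k y x" "set xs \<subseteq> T"
  shows "(\<integral>\<^sup>+w. ennreal (exp (data_fit k (\<lambda>t. f t w) xs / 4)) \<partial>M) = ennreal (sqrt 2 ^ length xs)"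
  using nn_expectation_exp_data_fit_add[OF assms(1-4), of "set xs" "\<lambda>_. 0"] assms(5)
  by (simp add: quad_form_def)

end

text \<open>In place of a Borel-Cantelli argument: the series of all \<open>W n\<close> has finite
  mean, hence is almost surely finite, and its sum bounds every term at once.\<close>

lemma AE_bounded_of_summable_nn_integral:
  fixes W :: "nat \<Rightarrow> 'a \<Rightarrow> real"
  assumes [measurable]: "\<And>n. W n \<in> borel_measurable M" and W0: "\<And>n w. W n w \<ge> 0"
    and le: "\<And>n. (\<integral>\<^sup>+w. ennreal (W n w) \<partial>M) \<le> ennreal (c n)" and c: "summable c" "\<And>n. c n \<ge> 0"
  shows "AE w in M. \<exists>B>0. \<forall>n. W n w \<le> B"
proof -
  have "(\<integral>\<^sup>+w. (\<Sum>n. ennreal (W n w)) \<partial>M) = (\<Sum>n. \<integral>\<^sup>+w. ennreal (W n w) \<partial>M)"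
    by (rule nn_integral_suminf) measurable
  also have "\<dots> \<le> (\<Sum>n. ennreal (c n))" by (intro suminf_le le) auto
  also have "\<dots> = ennreal (\<Sum>n. c n)" by (rule suminf_ennreal2[OF c(2) c(1)])
  finally have "(\<integral>\<^sup>+w. (\<Sum>n. ennreal (W n w)) \<partial>M) \<noteq> \<infinity>" by (auto simp: top_unique)
  then have "AE w in M. (\<Sum>n. ennreal (W n w)) \<noteq> \<infinity>"
    by (intro nn_integral_noteq_infinite) auto
  then show ?thesis
  proof (eventually_elim)
    case (elim w)
    then obtain B where B: "B \<ge> 0" "(\<Sum>n. ennreal (W n w)) = ennreal B"
      by (cases "\<Sum>n. ennreal (W n w)") auto
    have "W n w \<le> B" for n
    proof -
      have "ennreal (W n w) \<le> (\<Sum>n. ennreal (W n w))"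
        using sum_le_suminf[of "\<lambda>n. ennreal (W n w)" "{n}"] by simp
      then show ?thesis using B by (simp add: ennreal_le_iff)
    qed
    then have "\<forall>n. W n w \<le> B + 1" by (smt (verit, best))
    moreover have "B + 1 > 0" using B by simp
    ultimately show ?case by blast
  qed
qed

section \<open>Leave-one-out residuals and determinants\<close>

lemma coercive_mono:
  assumes "coercive k X c" "c' \<le> c"
  shows "coercive k X c'"
  unfolding coercive_def
proof
  fix a
  have "c' * (\<Sum>x\<in>X. (a x)\<^sup>2) \<le> c * (\<Sum>x\<in>X. (a x)\<^sup>2)"
    using assms(2) by (intro mult_right_mono) (auto simp: sum_nonneg)
  also have "\<dots> \<le> quad_form k X a" using assms(1) unfolding coercive_def by (rule spec)
  finally show "c' * (\<Sum>x\<in>X. (a x)\<^sup>2) \<le> quad_form k X a" .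
qed

lemma data_fit_eq_quad_form:
  assumes "distinct xs" "c > 0" "coercive k (set xs) c" "\<And>x y. k x y = k y x"
  obtains a where "\<forall>z\<in>set xs. (\<Sum>y\<in>set xs. k z y * a y) = f z"
    "data_fit k f xs = quad_form k (set xs) a"
proof -
  obtain a where a: "\<forall>z\<in>set xs. (\<Sum>y\<in>set xs. k z y * a y) = f z"
    "\<forall>g. scalar_prod (data_vec g xs) (inverse_mat (kernel_mat k xs) *\<^sub>v data_vec f xs)
       = (\<Sum>y\<in>set xs. g y * a y)"
    by (rule kernel_system_solution[OF assms(1-3)])
  have "quad_form k (set xs) a = (\<Sum>y\<in>set xs. f y * a y)"
    unfolding quad_form_alt by (intro sum.cong refl) (simp only: a(1)[rule_format], simp only: mult.commute)
  then have "data_fit k f xs = quad_form k (set xs) a"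
    unfolding data_fit_def a(2)[rule_format] by simp
  with a(1) show ?thesis by (rule that)
qed

lemma data_fit_nonneg:
  assumes "distinct xs" "c > 0" "coercive k (set xs) c" "\<And>x y. k x y = k y x"
  shows "data_fit k f xs \<ge> 0"
proof -
  obtain a where a: "\<forall>z\<in>set xs. (\<Sum>y\<in>set xs. k z y * a y) = f z"
    "data_fit k f xs = quad_form k (set xs) a"
    by (rule data_fit_eq_quad_form[OF assms])
  have "0 \<le> c * (\<Sum>x\<in>set xs. (a x)\<^sup>2)" using assms(2) by (simp add: sum_nonneg)
  also have "\<dots> \<le> quad_form k (set xs) a" using assms(3) unfolding coercive_def by (rule spec)
  finally show ?thesis using a(2) by simp
qed

abbreviation squared_loo_residual :: "('p \<Rightarrow> 'p \<Rightarrow> real) \<Rightarrow> ('p \<Rightarrow> real) \<Rightarrow> 'p list \<Rightarrow> 'p \<Rightarrow> real" where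
  "squared_loo_residual k f xs p \<equiv>
     (f p - cond_mean k f (removeAll p xs) p)\<^sup>2 / cond_var k (removeAll p xs) p"

text \<open>
  With \<open>K a = f\<close>, the leave-one-out residual at \<open>p\<close> is \<open>a p\<close> times the conditional variance.
\<close>

lemma sum_loo_residuals_le:
  assumes "distinct xs" "c > 0" "coercive k (set xs) c" "\<And>x y. k x y = k y x"
    "G \<subseteq> set xs" "\<And>p. p \<in> G \<Longrightarrow> cond_var k (removeAll p xs) p \<le> v" "v \<ge> 0"
  shows "(\<Sum>p\<in>G. squared_loo_residual k f xs p)
     \<le> v / c * data_fit k f xs"
proof -
  obtain a where a: "\<forall>z\<in>set xs. (\<Sum>y\<in>set xs. k z y * a y) = f z"
    "data_fit k f xs = quad_form k (set xs) a"
    by (rule data_fit_eq_quad_form[OF assms(1-4)])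
  have "squared_loo_residual k f xs p \<le> v * (a p)\<^sup>2"
    if p: "p \<in> G" for p
  proof -
    let ?xs = "removeAll p xs" let ?V = "cond_var k ?xs p"
    have S: "insert p (set ?xs) = set xs" using p assms(5) by auto
    have d: "distinct ?xs" "p \<notin> set ?xs" using assms(1) by (auto simp: distinct_removeAll)
    have co: "coercive k (set ?xs) c" using coercive_subset[OF assms(3), of "set ?xs"] by auto
    have coY: "coercive k (insert p (set ?xs)) c" using assms(3) S by simp
    have V: "?V > 0" using cond_var_ge[OF d assms(2) coY assms(4)] assms(2) by linarith
    obtain b where "residual_weights k ?xs p b"
      by (rule ex_residual_weights[OF d assms(2) co assms(4)])
    note b = residual_weightsD[OF this]
    \<comment> \<open>\<open>b\<close> solves the system whose right-hand side is the conditional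
      variance at \<open>p\<close> and 0 elsewhere, so pairing it with \<open>f\<close> picks out
      the entry \<open>a p\<close>.\<close>
    have "(\<Sum>y\<in>set xs. f y * b y) = (\<Sum>y\<in>set xs. (if y = p then ?V else 0) * a y)"
    proof (rule sum_solution_swap[OF assms(4)])
      show "(\<Sum>y\<in>set xs. k z y * a y) = f z" if "z \<in> set xs" for z using a(1) that by blast
      show "(\<Sum>y\<in>set xs. k z y * b y) = (if z = p then ?V else 0)" if "z \<in> set xs" for z
        using b(2,3) that unfolding S by auto
    qed
    also have "\<dots> = (\<Sum>y\<in>set xs. if y = p then ?V * a y else 0)" by (intro sum.cong) auto
    also have "\<dots> = ?V * a p" using p assms(5) by auto
    finally have "f p - cond_mean k f ?xs p = ?V * a p" using b(4) unfolding S by simp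
    then have "(f p - cond_mean k f ?xs p)\<^sup>2 / ?V = ?V * (a p)\<^sup>2"
      using V by (simp add: power2_eq_square)
    also have "\<dots> \<le> v * (a p)\<^sup>2" using assms(6)[OF p] by (intro mult_right_mono) auto
    finally show ?thesis .
  qed
  then have "(\<Sum>p\<in>G. squared_loo_residual k f xs p)
     \<le> (\<Sum>p\<in>G. v * (a p)\<^sup>2)" by (rule sum_mono)
  also have "\<dots> \<le> (\<Sum>p\<in>set xs. v * (a p)\<^sup>2)" using assms(5,7) by (intro sum_mono2) auto
  also have "\<dots> = v / c * (c * (\<Sum>p\<in>set xs. (a p)\<^sup>2))" using assms(2) by (simp add: sum_distrib_left)
  also have "\<dots> \<le> v / c * data_fit k f xs"
    using assms(2,3,7) unfolding a(2) coercive_def by (intro mult_left_mono) auto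
  finally show ?thesis .
qed

text \<open>The determinant is a product of successive conditional variances, each at least
  \<open>c\<close>.\<close>

lemma det_kernel_mat_ge:
  assumes "distinct xs" "c > 0" "coercive k (set xs) c" "\<And>x y. k x y = k y x"
  shows "c ^ length xs \<le> kernel_det k xs"
  using assms
proof (induction xs rule: rev_induct)
  case Nil
  show ?case using det_dim_zero[OF kernel_mat_carrier[of k "[]", simplified]] by simp
next
  case (snoc p xs)
  have d: "distinct xs" "p \<notin> set xs" using snoc.prems(1) by auto
  have coY: "coercive k (insert p (set xs)) c" using snoc.prems(3) by simp
  have co: "coercive k (set xs) c" using coercive_subset[OF snoc.prems(3), of "set xs"] by auto
  have IH: "c ^ length xs \<le> kernel_det k xs"
    by (rule snoc.IH[OF d(1) snoc.prems(2) co snoc.prems(4)])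
  moreover have "0 \<le> c ^ length xs" using snoc.prems(2) by simp
  ultimately have "0 \<le> kernel_det k xs" by linarith
  then have "c ^ length xs * c \<le> kernel_det k xs * cond_var k xs p"
    using IH cond_var_ge[OF d snoc.prems(2) coY snoc.prems(4)] snoc.prems(2) by (intro mult_mono) auto
  then show ?case
    unfolding det_kernel_mat_snoc[OF d snoc.prems(2) co snoc.prems(4)] by (simp add: mult.commute)
qed

text \<open>
  Every point outside \<open>B\<close> is predicted with mean square error at most \<open>v\<close> from the values on \<open>B\<close>.
\<close>

definition predicts :: "('p \<Rightarrow> 'p \<Rightarrow> real) \<Rightarrow> 'p set \<Rightarrow> 'p set \<Rightarrow> real \<Rightarrow> bool" where
  "predicts k X B v \<longleftrightarrow> (\<forall>p\<in>X - B. \<exists>b. b p = 1 \<and> (\<forall>y. y \<notin> insert p B \<longrightarrow> b y = 0) \<and>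
     quad_form k (insert p B) b \<le> v)"

text \<open>Weights supported on \<open>B\<close> and \<open>p\<close> remain admissible for every
  list containing \<open>B\<close>, so conditioning on further points cannot spoil the
  bound.\<close>

lemma cond_var_le_of_predicts:
  assumes "predicts k X B v" "p \<in> X - B" "distinct xs" "p \<notin> set xs" "B \<subseteq> set xs"
    "c > 0" "coercive k (set xs) c" "\<And>x y. k x y = k y x"
  shows "cond_var k xs p \<le> v"
proof -
  obtain b where b: "b p = 1" "\<forall>y. y \<notin> insert p B \<longrightarrow> b y = 0" "quad_form k (insert p B) b \<le> v"
    using assms(1,2) unfolding predicts_def by blast
  have "cond_var k xs p \<le> quad_form k (insert p (set xs)) b"
    by (rule cond_var_le[OF assms(3,4,6,7)]) (use assms(8) b(1) in auto)
  also have "\<dots> = quad_form k (insert p B) b"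
    using assms(5) b(2) by (intro quad_form_extend) auto
  finally show ?thesis using b(3) by simp
qed

lemma cond_var_le_diagonal:
  assumes "distinct xs" "p \<notin> set xs" "c > 0" "coercive k (set xs) c" "\<And>x y. k x y = k y x"
  shows "cond_var k xs p \<le> k p p"
proof -
  have "cond_var k xs p \<le> quad_form k (insert p (set xs)) (\<lambda>y. if y = p then 1 else 0)"
    by (rule cond_var_le[OF assms]) simp
  also have "\<dots> = quad_form k {p} (\<lambda>y. if y = p then 1 else 0)" by (intro quad_form_extend) auto
  also have "\<dots> = k p p" by (simp add: quad_form_def)
  finally show ?thesis .
qed

text \<open>The variance bound is assumed for every conditioning list that contains
  \<open>ys\<close>, since this list grows along the induction.\<close>

lemma det_kernel_mat_append_le:
  assumes "distinct (ys @ zs)" "c > 0" "coercive k (set (ys @ zs)) c" "\<And>x y. k x y = k y x"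
    and "\<And>us p. distinct us \<Longrightarrow> p \<in> set zs - set us \<Longrightarrow> set ys \<subseteq> set us \<Longrightarrow>
      coercive k (set us) c \<Longrightarrow> cond_var k us p \<le> v"
  shows "kernel_det k (ys @ zs) \<le> kernel_det k ys * v ^ length zs"
  using assms
proof (induction zs rule: rev_induct)
  case Nil
  then show ?case by simp
next
  case (snoc p zs)
  let ?us = "ys @ zs"
  have d: "distinct ?us" "p \<notin> set ?us" using snoc.prems(1) by auto
  have coY: "coercive k (insert p (set ?us)) c" using snoc.prems(3) by simp
  have co: "coercive k (set ?us) c" using coercive_subset[OF snoc.prems(3), of "set ?us"] by auto
  have V: "0 \<le> cond_var k ?us p" using cond_var_ge[OF d snoc.prems(2) coY snoc.prems(4)] snoc.prems(2) by simp
  have Vv: "cond_var k ?us p \<le> v" using d co by (intro snoc.prems(5)) auto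
  have IH: "kernel_det k ?us \<le> kernel_det k ys * v ^ length zs"
    by (rule snoc.IH[OF d(1) snoc.prems(2) co snoc.prems(4)]) (rule snoc.prems(5), auto)
  moreover have "0 \<le> c ^ length ?us" using snoc.prems(2) by simp
  ultimately have "kernel_det k ?us * cond_var k ?us p
     \<le> (kernel_det k ys * v ^ length zs) * v"
    using Vv V det_kernel_mat_ge[OF d(1) snoc.prems(2) co snoc.prems(4)] by (intro mult_mono) linarith+
  then show ?case
    unfolding append_assoc[symmetric] det_kernel_mat_snoc[OF d snoc.prems(2) co snoc.prems(4)] by (simp add: mult_ac)
qed

text \<open>The points of \<open>B\<close> come first and cost only the prior variance
  \<open>k0\<close>; each of the others is then predicted from a set that contains
  \<open>B\<close>.\<close>

lemma det_kernel_mat_le: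
  assumes "distinct xs" "c > 0" "coercive k (set xs) c" "\<And>x y. k x y = k y x"
    "B \<subseteq> set xs" "predicts k (set xs) B v" "\<And>p. k p p \<le> k0" "v \<ge> 0"
  shows "kernel_det k xs \<le> k0 ^ card B * v ^ (length xs - card B)"
proof -
  define bs where "bs = filter (\<lambda>p. p \<in> B) xs"
  define gs where "gs = filter (\<lambda>p. p \<notin> B) xs"
  have bs: "distinct bs" "set bs = B" using assms(1,5) by (auto simp: bs_def)
  then have lb: "length bs = card B" using distinct_card by fastforce
  have lg: "length gs = length xs - card B"
    using sum_length_filter_compl[of "\<lambda>p. p \<in> B" xs] lb by (simp add: bs_def gs_def)
  have gs: "distinct gs" "set gs = set xs - B" using assms(1) by (auto simp: gs_def)
  have S: "set (bs @ gs) = set xs" using bs gs assms(5) by auto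
  have "kernel_det k ([] @ bs) \<le> kernel_det k [] * k0 ^ length bs"
  proof (rule det_kernel_mat_append_le[OF _ assms(2) _ assms(4)])
    show "coercive k (set ([] @ bs)) c" using coercive_subset[OF assms(3), of B] bs assms(5) by simp
    show "cond_var k us p \<le> k0" if "distinct us" "p \<in> set bs - set us" "coercive k (set us) c" for us p
      using cond_var_le_diagonal[OF that(1) _ assms(2) that(3) assms(4)] that(2) assms(7)[of p] by force
  qed (use bs in auto)
  then have b: "kernel_det k bs \<le> k0 ^ length bs"
    using det_dim_zero[OF kernel_mat_carrier[of k "[]", simplified]] by simp
  have "mset xs = mset (bs @ gs)" by (simp add: bs_def gs_def)
  then have "kernel_det k xs = kernel_det k (bs @ gs)"
    by (rule det_kernel_mat_permute)
  also have "\<dots> \<le> kernel_det k bs * v ^ length gs"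
  proof (rule det_kernel_mat_append_le[OF _ assms(2) _ assms(4)])
    show "cond_var k us p \<le> v" if "distinct us" "p \<in> set gs - set us" "set bs \<subseteq> set us" "coercive k (set us) c" for us p
      by (rule cond_var_le_of_predicts[OF assms(6) _ that(1) _ _ assms(2) that(4) assms(4)])
        (use that bs gs in auto)
  qed (use bs gs S assms(3) in auto)
  also have "\<dots> \<le> k0 ^ length bs * v ^ length gs" using b assms(8) by (intro mult_right_mono) auto
  finally show ?thesis unfolding lb lg .
qed

section \<open>Cells and predicting subsets\<close>

lemma card_cells_le:
  fixes X :: "'a::euclidean_space set"
  assumes "s > 0" "\<And>x. x \<in> X \<Longrightarrow> norm x \<le> R"
  shows "finite (cell_index s ` X)" "R \<ge> 0 \<Longrightarrow> real (card (cell_index s ` X)) \<le> (2 * R / s + 2) ^ DIM('a)"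
proof -
  let ?I = "{\<lfloor>- R / s\<rfloor>..\<lfloor>R / s\<rfloor>}"
  have sub: "cell_index s ` X \<subseteq> PiE Basis (\<lambda>_. ?I)"
  proof (rule image_subsetI)
    fix x assume x: "x \<in> X"
    have "\<lfloor>- R / s\<rfloor> \<le> \<lfloor>inner x b / s\<rfloor> \<and> \<lfloor>inner x b / s\<rfloor> \<le> \<lfloor>R / s\<rfloor>" if "b \<in> Basis" for b
    proof -
      have "\<bar>inner x b\<bar> \<le> R" using Basis_le_norm[OF that, of x] assms(2)[OF x] by linarith
      then show ?thesis using assms(1) by (intro conjI floor_mono divide_right_mono) auto
    qed
    then show "cell_index s x \<in> PiE Basis (\<lambda>_. ?I)" by (auto simp: cell_index_def)
  qed
  have fin: "finite (PiE (Basis :: 'a set) (\<lambda>_. ?I))" by (intro finite_PiE) auto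
  show "finite (cell_index s ` X)" using finite_subset[OF sub fin] .
  assume R: "R \<ge> 0"
  have "card (cell_index s ` X) \<le> card (PiE (Basis :: 'a set) (\<lambda>_. ?I))" by (rule card_mono[OF fin sub])
  also have "\<dots> = card ?I ^ DIM('a)" by (simp add: card_PiE)
  finally have "real (card (cell_index s ` X)) \<le> real (card ?I) ^ DIM('a)"
    by (metis of_nat_le_iff of_nat_power)
  also have "\<dots> \<le> (2 * R / s + 2) ^ DIM('a)"
  proof (rule power_mono)
    have "0 \<le> R / s" using R assms(1) by simp
    then have "\<lfloor>- R / s\<rfloor> \<le> 0" "0 \<le> \<lfloor>R / s\<rfloor>" by (simp_all add: floor_le_iff)
    then have p: "0 \<le> \<lfloor>R / s\<rfloor> - \<lfloor>- R / s\<rfloor> + 1" by linarith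
    have "real (card ?I) = real_of_int (\<lfloor>R / s\<rfloor> - \<lfloor>- R / s\<rfloor> + 1)"
      unfolding card_atLeastAtMost_int by (rule of_nat_nat[OF p])
    then have "real (card ?I) = real_of_int \<lfloor>R / s\<rfloor> - real_of_int \<lfloor>- R / s\<rfloor> + 1" by simp
    moreover have "real_of_int \<lfloor>R / s\<rfloor> \<le> R / s" "- R / s < real_of_int \<lfloor>- R / s\<rfloor> + 1" by linarith+
    ultimately show "real (card ?I) \<le> 2 * R / s + 2" by linarith
  qed simp
  finally show "real (card (cell_index s ` X)) \<le> (2 * R / s + 2) ^ DIM('a)" .
qed

text \<open>The bound of \<open>quad_form_matern_annihilator\<close> for absolute weight sums up to
  2^j and cells of diameter at most \<open>d\<close> times \<open>s\<close>, with the power of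
  \<open>s\<close> taken out.\<close>

definition matern_error_const :: "real \<Rightarrow> real \<Rightarrow> (real \<Rightarrow> real) \<Rightarrow> real \<Rightarrow> nat \<Rightarrow> nat \<Rightarrow> nat \<Rightarrow> real" where
  "matern_error_const \<sigma> l c \<nu> m d j =
     \<sigma>\<^sup>2 * c \<nu> / 2 * (3 * (2 ^ j)\<^sup>2 * ((\<nu> / l\<^sup>2 * (real d)\<^sup>2) powr \<nu> * (1 / \<nu> + 1 / (real m - \<nu>))))"

lemma matern_error_const_pos:
  assumes "\<sigma> > 0" "l > 0" "c \<nu> > 0" "\<nu> > 0" "\<nu> < real m" "d > 0"
  shows "matern_error_const \<sigma> l c \<nu> m d j > 0"
proof -
  have "1 / \<nu> + 1 / (real m - \<nu>) > 0" using assms by (intro add_pos_pos) auto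
  then show ?thesis using assms unfolding matern_error_const_def by simp
qed

text \<open>In each cell the chosen points reproduce all features at the other points, so the
  weights of the prediction error annihilate the features. Their absolute sum is at most 1 + (2^j -
  1), the source of 2^j in the constant.\<close>

lemma matern_predicting_subset:
  fixes X :: "'a::euclidean_space set"
  assumes "\<sigma> > 0" "l > 0" "c \<nu> > 0" "\<nu> > 0" "\<nu> < real m" "s > 0" "finite X" "R \<ge> 0"
    and "\<And>x. x \<in> X \<Longrightarrow> norm x \<le> R"
  defines "j \<equiv> card (feature_words m :: 'a option option list set)"
  obtains B where "B \<subseteq> X" "real (card B) \<le> real j * (2 * R / s + 2) ^ DIM('a)"
    "predicts (matern \<sigma> l c \<nu>) X B (matern_error_const \<sigma> l c \<nu> m DIM('a) j * s powr (2 * \<nu>))"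
proof -
  let ?J = "feature_words m :: 'a option option list set"
  let ?cells = "cell_index s ` X"
  define cell where "cell I = {x\<in>X. cell_index s x = I}" for I
  have fin: "finite (cell I)" for I using assms(7) by (simp add: cell_def)
  have "\<forall>I. \<exists>B\<subseteq>cell I. card B \<le> card ?J \<and> (\<forall>x\<in>cell I. \<exists>u. (\<forall>w\<in>?J. word_feature w x = (\<Sum>b\<in>B. u b * word_feature w b))
      \<and> (\<Sum>b\<in>B. \<bar>u b\<bar>) \<le> 2 ^ card ?J - 1)"
    using bounded_spanning_subset[OF finite_feature_words fin, where \<Phi> = word_feature] by (rule allI)
  then obtain BB where BB: "\<And>I. BB I \<subseteq> cell I" "\<And>I. card (BB I) \<le> card ?J"
    "\<And>I. \<forall>x\<in>cell I. \<exists>u. (\<forall>w\<in>?J. word_feature w x = (\<Sum>b\<in>BB I. u b * word_feature w b))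
      \<and> (\<Sum>b\<in>BB I. \<bar>u b\<bar>) \<le> 2 ^ card ?J - 1"
    using choice[of "\<lambda>I B. B \<subseteq> cell I \<and> card B \<le> card ?J \<and> (\<forall>x\<in>cell I. \<exists>u. (\<forall>w\<in>?J. word_feature w x = (\<Sum>b\<in>B. u b * word_feature w b))
      \<and> (\<Sum>b\<in>B. \<bar>u b\<bar>) \<le> 2 ^ card ?J - 1)"] by blast
  define B where "B = (\<Union>I\<in>?cells. BB I)"
  have BX: "B \<subseteq> X" using BB(1) by (auto simp: B_def cell_def)
  have fB: "finite B" using BX assms(7) finite_subset by blast
  have "card B \<le> (\<Sum>I\<in>?cells. card (BB I))"
    unfolding B_def using assms(7) by (intro card_UN_le) simp
  also have "\<dots> \<le> (\<Sum>I\<in>?cells. j)" unfolding j_def by (intro sum_mono BB(2))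
  finally have "card B \<le> card ?cells * j" by simp
  then have "real (card B) \<le> real (card ?cells) * real j" by (metis of_nat_le_iff of_nat_mult)
  also have "\<dots> \<le> (2 * R / s + 2) ^ DIM('a) * real j"
    using card_cells_le(2)[OF assms(6,9,8)] by (intro mult_right_mono) auto
  finally have cB: "real (card B) \<le> real j * (2 * R / s + 2) ^ DIM('a)" by (simp add: mult.commute)
  have "\<exists>b. b p = 1 \<and> (\<forall>y. y \<notin> insert p B \<longrightarrow> b y = 0) \<and>
     quad_form (matern \<sigma> l c \<nu>) (insert p B) b \<le> matern_error_const \<sigma> l c \<nu> m DIM('a) j * s powr (2 * \<nu>)"
    if p: "p \<in> X - B" for p
  proof -
    define I where "I = cell_index s p"
    have pc: "p \<in> cell I" using p by (simp add: cell_def I_def)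
    have BI: "BB I \<subseteq> B" using p by (auto simp: B_def I_def)
    then have pB: "p \<notin> BB I" using p by auto
    have fBI: "finite (BB I)" using BI fB finite_subset by blast
    let ?Y = "insert p (BB I)"
    obtain u where u: "\<forall>w\<in>?J. word_feature w p = (\<Sum>b\<in>BB I. u b * word_feature w b)"
      "(\<Sum>b\<in>BB I. \<bar>u b\<bar>) \<le> 2 ^ card ?J - 1"
      using BB(3)[of I] pc by blast
    define b where "b y = (if y = p then 1 else if y \<in> BB I then - u y else 0)" for y
    have sb: "(\<Sum>y\<in>?Y. b y * g y) = g p - (\<Sum>y\<in>BB I. u y * g y)" for g
    proof -
      have "(\<Sum>y\<in>BB I. b y * g y) = (\<Sum>y\<in>BB I. - (u y * g y))"
        using pB by (intro sum.cong) (auto simp: b_def)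
      then show ?thesis using fBI pB by (simp add: sum_negf) (simp add: b_def)
    qed
    have ann: "(\<Sum>y\<in>?Y. b y * word_feature w y) = 0" if "w \<in> ?J" for w
      unfolding sb using u(1) that by simp
    have "(\<Sum>y\<in>BB I. \<bar>b y\<bar>) = (\<Sum>y\<in>BB I. \<bar>u y\<bar>)" using pB by (intro sum.cong) (auto simp: b_def)
    then have "(\<Sum>y\<in>?Y. \<bar>b y\<bar>) = 1 + (\<Sum>y\<in>BB I. \<bar>u y\<bar>)" using fBI pB by simp (simp add: b_def)
    then have S: "(\<Sum>y\<in>?Y. \<bar>b y\<bar>) \<le> 2 ^ j" using u(2) by (simp add: j_def)
    have diam: "norm (x - y) \<le> DIM('a) * s" if "x \<in> ?Y" "y \<in> ?Y" for x y
    proof -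
      have "x \<in> cell I" "y \<in> cell I" using that pc BB(1)[of I] by auto
      then have "cell_index s x = cell_index s y" by (simp add: cell_def)
      then show ?thesis using cell_index_eq_imp[OF assms(6), of x y] by simp
    qed
    have "quad_form (matern \<sigma> l c \<nu>) (insert p B) b = quad_form (matern \<sigma> l c \<nu>) ?Y b"
      using fB BI by (intro quad_form_extend) (auto simp: b_def)
    also have "\<dots> \<le> \<sigma>\<^sup>2 * c \<nu> / 2 * (3 * (\<Sum>x\<in>?Y. \<bar>b x\<bar>)\<^sup>2 *
        ((\<nu> / l\<^sup>2 * (DIM('a) * s)\<^sup>2) powr \<nu> * (1 / \<nu> + 1 / (real m - \<nu>))))"
      using assms fBI diam ann by (intro quad_form_matern_annihilator) auto
    also have "\<dots> \<le> \<sigma>\<^sup>2 * c \<nu> / 2 * (3 * (2 ^ j)\<^sup>2 *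
        ((\<nu> / l\<^sup>2 * (DIM('a) * s)\<^sup>2) powr \<nu> * (1 / \<nu> + 1 / (real m - \<nu>))))"
      using S assms by (intro mult_left_mono mult_right_mono power_mono) (auto simp: sum_nonneg)
    also have "(\<nu> / l\<^sup>2 * (DIM('a) * s)\<^sup>2) powr \<nu> = (\<nu> / l\<^sup>2 * (real DIM('a))\<^sup>2) powr \<nu> * s powr (2 * \<nu>)"
    proof -
      have e: "(\<nu> / l\<^sup>2 * (DIM('a) * s)\<^sup>2) = (\<nu> / l\<^sup>2 * (real DIM('a))\<^sup>2) * s powr 2"
        using assms(6) by (simp add: power_mult_distrib powr_numeral)
      have "(s powr 2) powr \<nu> = s powr (2 * \<nu>)" by (simp only: powr_powr)
      then show ?thesis unfolding e by (simp only: powr_mult)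
    qed
    finally have "quad_form (matern \<sigma> l c \<nu>) (insert p B) b \<le> matern_error_const \<sigma> l c \<nu> m DIM('a) j * s powr (2 * \<nu>)"
      unfolding matern_error_const_def by (simp only: mult_ac)
    then show ?thesis using BI by (intro exI[of _ b]) (auto simp: b_def)
  qed
  then have "predicts (matern \<sigma> l c \<nu>) X B (matern_error_const \<sigma> l c \<nu> m DIM('a) j * s powr (2 * \<nu>))"
    unfolding predicts_def by blast
  with BX cB show ?thesis by (rule that)
qed

section \<open>Asymptotics of the two criteria\<close>

text \<open>Boundedness of \<Omega> makes the family of minima bounded above, so that the real
  supremum in \<open>fill_distance\<close> is a genuine upper bound.\<close>

lemma dist_le_fill_distance:
  fixes \<Omega> :: "'a::euclidean_space set"
  assumes "bounded \<Omega>" "\<And>i. i \<ge> 1 \<Longrightarrow> x i \<in> \<Omega>" "n \<ge> 1" "y \<in> \<Omega>"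
  obtains i where "i \<in> {1..n}" "dist y (x i) \<le> fill_distance \<Omega> x n"
proof -
  let ?F = "\<lambda>y. Min ((\<lambda>i. dist y (x i)) ` {1..n})"
  obtain D where D: "\<And>u v. u \<in> \<Omega> \<Longrightarrow> v \<in> \<Omega> \<Longrightarrow> dist u v \<le> D"
    using assms(1) unfolding bounded_two_points by blast
  have "bdd_above (?F ` \<Omega>)"
  proof (rule bdd_aboveI2)
    fix u assume u: "u \<in> \<Omega>"
    have "?F u \<le> dist u (x 1)" using assms(3) by (intro Min_le) auto
    also have "\<dots> \<le> D" using D u assms(2) by simp
    finally show "?F u \<le> D" .
  qed
  then have le: "?F y \<le> fill_distance \<Omega> x n"
    unfolding fill_distance_def using assms(4) by (rule cSUP_upper[rotated])
  have "?F y \<in> (\<lambda>i. dist y (x i)) ` {1..n}" using assms(3) by (intro Min_in) auto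
  then obtain i where i: "i \<in> {1..n}" "?F y = dist y (x i)" by auto
  show ?thesis using le i by (intro that[of i]) auto
qed

text \<open>Volume comparison: \<open>n\<close> balls whose radius is the fill distance cover the
  ball of radius \<open>r\<close>.\<close>

lemma fill_distance_ge:
  fixes \<Omega> :: "'a::euclidean_space set"
  assumes "bounded \<Omega>" "\<And>i. i \<ge> 1 \<Longrightarrow> x i \<in> \<Omega>" "n \<ge> 1" "ball p r \<subseteq> \<Omega>" "r > 0"
  shows "r * real n powr (- 1 / DIM('a)) \<le> fill_distance \<Omega> x n"
proof -
  let ?h = "fill_distance \<Omega> x n" and ?d = "DIM('a)"
  have p: "p \<in> \<Omega>" using assms(4,5) by auto
  have h0: "?h \<ge> 0"
  proof -
    obtain i where "dist p (x i) \<le> ?h" by (rule dist_le_fill_distance[OF assms(1-3) p])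
    then show ?thesis using zero_le_dist[of p "x i"] by linarith
  qed
  have "ball p r \<subseteq> (\<Union>i\<in>{1..n}. cball (x i) ?h)"
  proof
    fix y assume "y \<in> ball p r"
    then have y: "y \<in> \<Omega>" using assms(4) by auto
    obtain i where "i \<in> {1..n}" "dist y (x i) \<le> ?h" by (rule dist_le_fill_distance[OF assms(1-3) y])
    then show "y \<in> (\<Union>i\<in>{1..n}. cball (x i) ?h)" by (auto simp: dist_commute)
  qed
  then have "measure lebesgue (ball p r) \<le> measure lebesgue (\<Union>i\<in>{1..n}. cball (x i) ?h)"
    by (intro measure_mono_fmeasurable) (auto intro!: fmeasurable.finite_UN)
  also have "\<dots> \<le> (\<Sum>i\<in>{1..n}. measure lebesgue (cball (x i) ?h))"
    by (intro measure_UNION_le) auto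
  finally have "unit_ball_vol ?d * r ^ ?d \<le> (\<Sum>i\<in>{1..n}. unit_ball_vol ?d * ?h ^ ?d)"
    using h0 assms(5) by (simp add: content_ball content_cball)
  then have "unit_ball_vol ?d * r ^ ?d \<le> unit_ball_vol ?d * (real n * ?h ^ ?d)" by (simp add: mult_ac)
  then have "r ^ ?d \<le> real n * ?h ^ ?d"
    using unit_ball_vol_pos[of "real ?d"] by (subst (asm) mult_le_cancel_left_pos) auto
  also have "\<dots> = (real n powr (1 / ?d) * ?h) ^ ?d"
    using assms(3) by (simp add: power_mult_distrib powr_powr flip: powr_realpow)
  finally have "r \<le> real n powr (1 / ?d) * ?h"
    by (rule power_le_imp_le_base[of _ "?d - 1", simplified]) (use h0 in simp)
  then have "r * real n powr (- 1 / ?d) \<le> (real n powr (1 / ?d) * ?h) * real n powr (- 1 / ?d)"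
    by (intro mult_right_mono) auto
  also have "\<dots> = (real n powr (1 / ?d) * real n powr (- 1 / ?d)) * ?h" by simp
  also have "real n powr (1 / ?d) * real n powr (- 1 / ?d) = 1"
    unfolding powr_add[symmetric] using assms(3) by simp
  finally show ?thesis by simp
qed

text \<open>A ball inside \<Omega> bounds the fill distance from below, and quasi-uniformity passes
  this bound on to the separation radius.\<close>

lemma quasi_uniform_separation:
  fixes \<Omega> :: "'a::euclidean_space set"
  assumes "bounded \<Omega>" "open \<Omega>" "\<And>i. i \<ge> 1 \<Longrightarrow> x i \<in> \<Omega>" "quasi_uniform \<Omega> x"
  obtains a where "a > 0" "\<forall>n\<ge>2. \<forall>i\<in>{1..n}. \<forall>j\<in>{1..n}. i \<noteq> j \<longrightarrow>
      a * real n powr (- 1 / DIM('a)) \<le> norm (x i - x j)"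
proof -
  obtain r where r: "r > 0" "ball (x 1) r \<subseteq> \<Omega>" using assms(2,3) open_contains_ball by blast
  obtain c where c: "c > 0" "\<forall>n\<ge>2. fill_distance \<Omega> x n \<le> c * separation_radius x n"
    using assms(4) unfolding quasi_uniform_def by blast
  show ?thesis
  proof (rule that[of "2 * r / c"])
    show "2 * r / c > 0" using r c by simp
    show "\<forall>n\<ge>2. \<forall>i\<in>{1..n}. \<forall>j\<in>{1..n}. i \<noteq> j \<longrightarrow>
      2 * r / c * real n powr (- 1 / DIM('a)) \<le> norm (x i - x j)"
    proof (intro allI impI ballI)
      fix n i j assume n: "(2::nat) \<le> n" and ij: "i \<in> {1..n}" "j \<in> {1..n}" "i \<noteq> j"
      let ?S = "{dist (x i) (x j) |i j. i \<in> {1..n} \<and> j \<in> {1..n} \<and> i \<noteq> j}"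
      have "finite ?S"
        by (rule finite_subset[of _ "(\<lambda>(i, j). dist (x i) (x j)) ` ({1..n} \<times> {1..n})"]) auto
      then have "Min ?S \<le> dist (x i) (x j)" using ij by (intro Min_le) auto
      then have "2 * separation_radius x n \<le> norm (x i - x j)"
        by (simp add: separation_radius_def dist_norm)
      moreover have "r * real n powr (- 1 / DIM('a)) \<le> fill_distance \<Omega> x n"
        by (rule fill_distance_ge[OF assms(1,3) _ r(2,1)]) (use n in auto)
      then have "r * real n powr (- 1 / DIM('a)) \<le> c * separation_radius x n"
        using c(2) n by force
      then have "2 * r / c * real n powr (- 1 / DIM('a)) \<le> 2 * separation_radius x n"
        using c(1) by (simp add: field_simps)
      ultimately show "2 * r / c * real n powr (- 1 / DIM('a)) \<le> norm (x i - x j)" by linarith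
    qed
  qed
qed

text \<open>\<open>coercive_matern\<close> at separation a n^(-1/d). The lower bounds on
  \<open>c\<close> and on the order keep the constant independent of \<open>\<nu>\<close>.\<close>

lemma coercive_matern_uniform:
  fixes X :: "nat \<Rightarrow> 'a::euclidean_space set"
  assumes "\<sigma> > 0" "l > 0" "0 < \<nu>1" "c0 > 0" "\<And>\<nu>. \<nu> \<in> {\<nu>1..\<nu>2} \<Longrightarrow> c0 \<le> c \<nu>" "a > 0"
    and "\<And>n. finite (X n)"
    and "\<And>n x y. n \<ge> 2 \<Longrightarrow> x \<in> X n \<Longrightarrow> y \<in> X n \<Longrightarrow> x \<noteq> y \<Longrightarrow> a * real n powr (- 1 / DIM('a)) \<le> norm (x - y)"
  obtains \<kappa> where "\<kappa> > 0" "\<forall>n\<ge>2. \<forall>\<nu>\<in>{\<nu>1..\<nu>2}. coercive (matern \<sigma> l c \<nu>) (X n) (\<kappa> * real n powr (- (2 * \<nu> / DIM('a))))"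
proof -
  let ?d = "real DIM('a)"
  define A where "A = a\<^sup>2 / (l\<^sup>2 * gauss_threshold DIM('a))"
  have A: "A > 0" using assms gauss_threshold_pos[of "DIM('a)"] by (simp add: A_def)
  \<comment> \<open>Truncation at 1 makes powers of \<open>g\<close> decrease in the exponent, so
    that \<open>g powr \<nu>2\<close> stays below \<open>(\<nu> * A) powr \<nu>\<close> for every
    \<open>\<nu>\<close> in the interval.\<close>
  define g where "g = min 1 (\<nu>1 * A)"
  have g: "g > 0" "g \<le> 1" using A assms(3) by (auto simp: g_def)
  define \<kappa> where "\<kappa> = \<sigma>\<^sup>2 * c0 / 4 * (g powr \<nu>2 * exp (- \<nu>2 - \<nu>2 * A / 2))"
  show ?thesis
  proof (rule that[of \<kappa>])
    show "\<kappa> > 0" using assms g by (simp add: \<kappa>_def)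
    show "\<forall>n\<ge>2. \<forall>\<nu>\<in>{\<nu>1..\<nu>2}. coercive (matern \<sigma> l c \<nu>) (X n) (\<kappa> * real n powr (- (2 * \<nu> / ?d)))"
    proof (intro allI impI ballI)
      fix n \<nu> assume n: "(2::nat) \<le> n" and \<nu>: "\<nu> \<in> {\<nu>1..\<nu>2}"
      define q where "q = a * real n powr (- 1 / ?d)"
      define E where "E = \<nu> * q\<^sup>2 / (l\<^sup>2 * gauss_threshold DIM('a))"
      have q: "q > 0" using assms(6) n by (simp add: q_def)
      have \<nu>0: "\<nu> > 0" using \<nu> assms(3) by auto
      have cn: "c0 \<le> c \<nu>" using assms(5) \<nu> by blast
      have co: "coercive (matern \<sigma> l c \<nu>) (X n) (\<sigma>\<^sup>2 * c \<nu> / 4 * (E powr \<nu> * exp (- \<nu> - E / 2)))"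
        unfolding E_def
      proof (rule coercive_matern[OF \<nu>0 assms(2) _ assms(7) q])
        show "c \<nu> > 0" using cn assms(4) by linarith
        show "q \<le> norm (x - y)" if "x \<in> X n" "y \<in> X n" "x \<noteq> y" for x y
          unfolding q_def using assms(8)[OF n that] .
      qed
      have q2: "q\<^sup>2 = a\<^sup>2 * real n powr (- 2 / ?d)"
        by (simp add: q_def power_mult_distrib power2_eq_square[of "_ powr _"] flip: powr_add)
      have E: "E = \<nu> * A * real n powr (- 2 / ?d)" by (simp add: E_def A_def q2)
      have "real n powr (- 2 / ?d) \<le> real n powr 0" using n by (intro powr_mono) auto
      then have n1: "real n powr (- 2 / ?d) \<le> 1" using n by simp
      have "E \<le> \<nu> * A * 1" unfolding E using n1 \<nu>0 A by (intro mult_left_mono) auto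
      also have "\<dots> \<le> \<nu>2 * A" using \<nu> A by simp
      finally have "exp (- \<nu>2 - \<nu>2 * A / 2) \<le> exp (- \<nu> - E / 2)" using \<nu> by simp
      moreover have "g powr \<nu>2 * real n powr (- (2 * \<nu> / ?d)) \<le> E powr \<nu>"
      proof -
        have "E powr \<nu> = (\<nu> * A) powr \<nu> * real n powr (- (2 * \<nu> / ?d))"
          unfolding E using \<nu>0 A by (simp add: powr_mult powr_powr)
        moreover have "g powr \<nu>2 \<le> (\<nu> * A) powr \<nu>"
        proof -
          have "g powr \<nu>2 \<le> g powr \<nu>" using \<nu> g by (intro powr_mono') auto
          also have "\<nu>1 * A \<le> \<nu> * A" using \<nu> A by simp
          then have "g powr \<nu> \<le> (\<nu> * A) powr \<nu>"
            using \<nu>0 g by (intro powr_mono2) (auto simp: g_def)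
          finally show ?thesis .
        qed
        ultimately show ?thesis by (simp add: mult_right_mono)
      qed
      ultimately have le: "(g powr \<nu>2 * real n powr (- (2 * \<nu> / ?d))) * exp (- \<nu>2 - \<nu>2 * A / 2) \<le> E powr \<nu> * exp (- \<nu> - E / 2)"
        by (intro mult_mono) auto
      have "\<sigma>\<^sup>2 * c0 / 4 \<le> \<sigma>\<^sup>2 * c \<nu> / 4" using cn by (simp add: mult_left_mono)
      then have "\<sigma>\<^sup>2 * c0 / 4 * ((g powr \<nu>2 * real n powr (- (2 * \<nu> / ?d))) * exp (- \<nu>2 - \<nu>2 * A / 2))
         \<le> \<sigma>\<^sup>2 * c \<nu> / 4 * (E powr \<nu> * exp (- \<nu> - E / 2))"
        by (rule mult_mono[OF _ le]) (use assms(4) cn in auto)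
      then have "\<kappa> * real n powr (- (2 * \<nu> / ?d)) \<le> \<sigma>\<^sup>2 * c \<nu> / 4 * (E powr \<nu> * exp (- \<nu> - E / 2))"
        unfolding \<kappa>_def by (simp only: mult_ac)
      then show "coercive (matern \<sigma> l c \<nu>) (X n) (\<kappa> * real n powr (- (2 * \<nu> / ?d)))"
        using co coercive_mono by blast
    qed
  qed
qed

text \<open>
  Cells of side \<open>A n\<^bsup>-1/d\<^esup>\<close> with \<open>A\<close> large: there are few of them compared to \<open>n\<close>,
  and each contributes boundedly many points to \<open>B\<close>.
\<close>

lemma matern_predicting_small_subset:
  fixes X :: "nat \<Rightarrow> 'a::euclidean_space set"
  assumes "\<sigma> > 0" "l > 0" "c \<nu> > 0" "\<nu> > 0" "\<And>n. finite (X n)" "\<And>n x. x \<in> X n \<Longrightarrow> norm x \<le> R" "\<delta> > 0"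
  obtains C where "C > 0" "\<forall>\<^sub>F n in sequentially. \<exists>B\<subseteq>X n. real (card B) \<le> \<delta> * real n \<and>
      predicts (matern \<sigma> l c \<nu>) (X n) B (C * real n powr (- (2 * \<nu> / DIM('a))))"
proof -
  let ?d = "DIM('a)"
  define m where "m = nat \<lceil>\<nu>\<rceil> + 1"
  have m: "\<nu> < real m" unfolding m_def by linarith
  define j where "j = card (feature_words m :: 'a option option list set)"
  \<comment> \<open>There will be at most \<eta>^d n cells with at most \<open>j\<close> points of
    \<open>B\<close> each; as \<eta> is at most 1, the product j \<eta>^d is at most j \<eta>, hence
    at most \<delta>.\<close>
  define \<eta> where "\<eta> = min 1 (\<delta> / (real j + 1))"
  have \<eta>: "0 < \<eta>" "\<eta> \<le> 1" using assms(7) by (auto simp: \<eta>_def)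
  have "\<eta> ^ ?d \<le> \<eta> ^ 1" using \<eta> by (intro power_decreasing) auto
  then have "real j * \<eta> ^ ?d \<le> (real j + 1) * (\<delta> / (real j + 1))"
    using assms(7) \<eta> by (intro mult_mono) (auto simp: \<eta>_def)
  then have j\<eta>: "real j * \<eta> ^ ?d \<le> \<delta>" by simp
  define R' where "R' = max 1 R"
  have R': "R' > 0" by (simp add: R'_def)
  \<comment> \<open>With cells of side A n^(-1/d) the main term \<open>2 * R' / s\<close> of the
    cell count is half of \<eta> n^(1/d); the other half absorbs the added 2 once \<open>n\<close>
    is large.\<close>
  define A where "A = 4 * R' / \<eta>"
  have A: "A > 0" using R' \<eta> by (simp add: A_def)
  define C where "C = matern_error_const \<sigma> l c \<nu> m ?d j * A powr (2 * \<nu>)"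
  show ?thesis
  proof (rule that[of C])
    show "C > 0" unfolding C_def using matern_error_const_pos[of \<sigma> l c \<nu> m ?d j] assms(1-4) m A by simp
    have "(\<lambda>n. real n powr (- 1 / ?d)) \<longlonglongrightarrow> 0" by real_asymp
    then have "\<forall>\<^sub>F n in sequentially. real n powr (- 1 / ?d) < \<eta> / 4"
      using \<eta> by (intro order_tendstoD) auto
    then show "\<forall>\<^sub>F n in sequentially. \<exists>B\<subseteq>X n. real (card B) \<le> \<delta> * real n \<and>
      predicts (matern \<sigma> l c \<nu>) (X n) B (C * real n powr (- (2 * \<nu> / ?d)))"
      using eventually_ge_at_top[of 1]
    proof eventually_elim
      case (elim n)
      define t where "t = real n powr (1 / ?d)"
      have t: "t > 0" using elim by (simp add: t_def)
      have ti: "real n powr (- 1 / ?d) = 1 / t" by (simp add: t_def powr_minus_divide)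
      define s where "s = A / t"
      have s: "s > 0" using A t by (simp add: s_def)
      obtain B where B: "B \<subseteq> X n" "real (card B) \<le> real j * (2 * R' / s + 2) ^ ?d"
        "predicts (matern \<sigma> l c \<nu>) (X n) B (matern_error_const \<sigma> l c \<nu> m ?d j * s powr (2 * \<nu>))"
        unfolding j_def
      proof (rule matern_predicting_subset[of \<sigma> l c \<nu> m s "X n" R'])
        show "norm x \<le> R'" if "x \<in> X n" for x using assms(6)[OF that] by (simp add: R'_def)
      qed (use assms(1-5) m s R' in auto)
      have "2 * R' / s + 2 = (\<eta> / 2) * t + 2"
        using R' \<eta> t by (simp add: s_def A_def)
      also have "\<dots> \<le> (\<eta> / 2) * t + (\<eta> / 2) * t"
        using elim(1) t unfolding ti by (simp add: field_simps)
      also have "\<dots> = \<eta> * t" by simp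
      finally have "(2 * R' / s + 2) ^ ?d \<le> (\<eta> * t) ^ ?d" using R' s by (intro power_mono) auto
      also have "\<dots> = \<eta> ^ ?d * real n"
        using elim by (simp add: t_def power_mult_distrib powr_powr flip: powr_realpow)
      finally have "real j * (2 * R' / s + 2) ^ ?d \<le> (real j * \<eta> ^ ?d) * real n"
        by (simp add: mult_left_mono mult.assoc)
      also have "\<dots> \<le> \<delta> * real n" using j\<eta> by (intro mult_right_mono) auto
      finally have cB: "real (card B) \<le> \<delta> * real n" using B(2) by linarith
      have "s powr (2 * \<nu>) = A powr (2 * \<nu>) * real n powr (- (2 * \<nu> / ?d))"
        using A t elim by (simp add: s_def t_def powr_divide powr_powr powr_minus_divide)
      then have "matern_error_const \<sigma> l c \<nu> m ?d j * s powr (2 * \<nu>) = C * real n powr (- (2 * \<nu> / ?d))"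
        by (simp add: C_def)
      with B(1,3) cB show ?case by auto
    qed
  qed
qed

section \<open>Bounds for the two criteria\<close>

lemma ell_ML_eq: "ell_ML K f xs \<nu> = data_fit (K \<nu>) f xs + ln (kernel_det (K \<nu>) xs)"
  by (simp add: ell_ML_def data_fit_def)

lemma ell_ML_ge:
  assumes "distinct xs" "c > 0" "coercive (K \<nu>) (set xs) c" "\<And>x y. K \<nu> x y = K \<nu> y x"
  shows "real (length xs) * ln c \<le> ell_ML K f xs \<nu>"
proof -
  have "c ^ length xs \<le> kernel_det (K \<nu>) xs" by (rule det_kernel_mat_ge[OF assms])
  then have "ln (c ^ length xs) \<le> ln (kernel_det (K \<nu>) xs)"
    using assms(2) by (intro ln_mono) (auto intro: less_le_trans[of 0 "c ^ length xs"])
  then show ?thesis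
    using data_fit_nonneg[OF assms, of f] assms(2) by (simp add: ell_ML_eq ln_realpow)
qed

lemma ell_CV_eq:
  assumes "distinct xs"
  shows "ell_CV K f xs \<nu> =
     (\<Sum>p\<in>set xs. squared_loo_residual (K \<nu>) f xs p)
       + (\<Sum>p\<in>set xs. ln (cond_var (K \<nu>) (removeAll p xs) p))"
  unfolding ell_CV_def sum_list_distinct_conv_sum_set[OF assms] by (rule sum.distrib)

lemma loo_cond_var_ge:
  assumes "distinct xs" "c > 0" "coercive k (set xs) c" "\<And>x y. k x y = k y x" "p \<in> set xs"
  shows "c \<le> cond_var k (removeAll p xs) p"
proof -
  have "insert p (set (removeAll p xs)) = set xs" using assms(5) by auto
  then have "coercive k (insert p (set (removeAll p xs))) c" using assms(3) by simp
  then show ?thesis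
    using assms(1) by (intro cond_var_ge[OF _ _ assms(2) _ assms(4)]) (auto simp: distinct_removeAll)
qed

lemma ell_CV_ge:
  assumes "distinct xs" "c > 0" "coercive (K \<nu>) (set xs) c" "\<And>x y. K \<nu> x y = K \<nu> y x"
  shows "real (length xs) * ln c \<le> ell_CV K f xs \<nu>"
proof -
  have V: "c \<le> cond_var (K \<nu>) (removeAll p xs) p" if "p \<in> set xs" for p
    by (rule loo_cond_var_ge[OF assms that])
  have "(\<Sum>p\<in>set xs. ln c) \<le> (\<Sum>p\<in>set xs. ln (cond_var (K \<nu>) (removeAll p xs) p))"
    using V assms(2) by (intro sum_mono ln_mono) (auto intro: less_le_trans)
  moreover have "0 \<le> (\<Sum>p\<in>set xs. squared_loo_residual (K \<nu>) f xs p)"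
    using V assms(2) by (intro sum_nonneg divide_nonneg_nonneg) (auto intro: order_trans[OF less_imp_le])
  ultimately show ?thesis
    by (simp add: ell_CV_eq[OF assms(1)] distinct_card[OF assms(1)])
qed

lemma ell_ML_le:
  assumes "distinct xs" "c > 0" "coercive (K \<nu>) (set xs) c" "\<And>x y. K \<nu> x y = K \<nu> y x"
    "B \<subseteq> set xs" "predicts (K \<nu>) (set xs) B v" "\<And>p. K \<nu> p p \<le> k0" "k0 > 0" "v > 0"
  shows "ell_ML K f xs \<nu> \<le> data_fit (K \<nu>) f xs + real (card B) * ln k0 + (real (length xs) - real (card B)) * ln v"
proof -
  have "card B \<le> card (set xs)" using assms(5) by (intro card_mono) auto
  then have cB: "card B \<le> length xs" using assms(1) by (simp add: distinct_card)
  have pos: "0 < kernel_det (K \<nu>) xs"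
    using det_kernel_mat_ge[OF assms(1-4)] assms(2) by (auto intro: less_le_trans[of 0 "c ^ length xs"])
  then have "ln (kernel_det (K \<nu>) xs) \<le> ln (k0 ^ card B * v ^ (length xs - card B))"
    using det_kernel_mat_le[OF assms(1-7)] assms(9) by (intro ln_mono) auto
  also have "\<dots> = real (card B) * ln k0 + (real (length xs) - real (card B)) * ln v"
    using assms(8,9) cB by (simp add: ln_mult ln_realpow of_nat_diff)
  finally show ?thesis by (simp add: ell_ML_eq)
qed

text \<open>Outside \<open>B\<close> the residuals cost v / c times the data fit. On
  \<open>B\<close> the available variance bound is \<open>k0\<close>, whose ratio to
  \<open>c\<close> is too large, so the residuals there are bounded one by one by
  \<open>z\<close>.\<close>

lemma ell_CV_le:
  assumes "distinct xs" "c > 0" "coercive (K \<nu>) (set xs) c" "\<And>x y. K \<nu> x y = K \<nu> y x"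
    "B \<subseteq> set xs" "predicts (K \<nu>) (set xs) B v" "\<And>p. K \<nu> p p \<le> k0" "k0 > 0" "v > 0"
    "\<And>p. p \<in> set xs \<Longrightarrow> squared_loo_residual (K \<nu>) f xs p \<le> z"
  shows "ell_CV K f xs \<nu> \<le> v / c * data_fit (K \<nu>) f xs + real (card B) * z
     + real (card B) * ln k0 + (real (length xs) - real (card B)) * ln v"
proof -
  let ?V = "\<lambda>p. cond_var (K \<nu>) (removeAll p xs) p"
  let ?r = "\<lambda>p. (f p - cond_mean (K \<nu>) f (removeAll p xs) p)\<^sup>2 / ?V p"
  have fB: "finite B" using assms(5) finite_subset by blast
  have cX: "card (set xs - B) = length xs - card B"
    using assms(1,5) fB by (simp add: card_Diff_subset distinct_card)
  have "card B \<le> card (set xs)" using assms(5) by (intro card_mono) auto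
  then have cB: "card B \<le> length xs" using assms(1) by (simp add: distinct_card)
  have V0: "0 < ?V p" if "p \<in> set xs" for p
    using loo_cond_var_ge[OF assms(1-4) that] assms(2) by linarith
  have rm: "distinct (removeAll p xs)" "p \<notin> set (removeAll p xs)" "coercive (K \<nu>) (set (removeAll p xs)) c" for p
    using assms(1) coercive_subset[OF assms(3), of "set (removeAll p xs)"] by (auto simp: distinct_removeAll)
  have Vg: "?V p \<le> v" if "p \<in> set xs - B" for p
    by (rule cond_var_le_of_predicts[OF assms(6) that rm(1,2) _ assms(2) rm(3) assms(4)]) (use assms(5) that in auto)
  have Vb: "?V p \<le> k0" for p
    using cond_var_le_diagonal[OF rm(1,2) assms(2) rm(3) assms(4)] assms(7)[of p] by (rule order_trans)
  have split: "(\<Sum>p\<in>set xs. g p) = (\<Sum>p\<in>B. g p) + (\<Sum>p\<in>set xs - B. g p)" for g :: "'a \<Rightarrow> real"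
    using sum.subset_diff[OF assms(5)] by (simp add: add.commute)
  have "(\<Sum>p\<in>set xs - B. ?r p) \<le> v / c * data_fit (K \<nu>) f xs"
    using Vg assms(9) by (intro sum_loo_residuals_le[OF assms(1-4)]) auto
  moreover have "(\<Sum>p\<in>B. ?r p) \<le> (\<Sum>p\<in>B. z)" using assms(5,10) by (intro sum_mono) auto
  moreover have "(\<Sum>p\<in>B. ln (?V p)) \<le> (\<Sum>p\<in>B. ln k0)"
    using Vb V0 assms(5) by (intro sum_mono ln_mono) auto
  moreover have "(\<Sum>p\<in>set xs - B. ln (?V p)) \<le> (\<Sum>p\<in>set xs - B. ln v)"
    using Vg V0 by (intro sum_mono ln_mono) auto
  ultimately show ?thesis
    unfolding ell_CV_eq[OF assms(1)] split[of ?r] split[of "\<lambda>p. ln (?V p)"]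
    using cX cB by (simp add: of_nat_diff)
qed

text \<open>If \<open>v n\<close> were at most \<nu>0 - \<epsilon>, minimality would put the lower
  bound at \<open>v n\<close> below the upper bound at \<nu>0. Their leading terms differ by at
  least 2 \<epsilon> / d times n log n, of which the choice of \<delta> spends only half; the
  constants \<open>a\<close> and \<open>C\<close> cannot make up for the rest.\<close>

lemma liminf_arg_min_ge:
  fixes L :: "nat \<Rightarrow> real \<Rightarrow> real" and v :: "nat \<Rightarrow> real"
  assumes d: "d > 0" and \<nu>0: "\<nu>0 \<in> {\<nu>1..\<nu>2}" "\<nu>0 > 0"
    and min: "\<And>n. n \<ge> 1 \<Longrightarrow> is_arg_min (L n) (\<lambda>\<nu>. \<nu> \<in> {\<nu>1..\<nu>2}) (v n)"
    and lower: "\<And>n \<nu>. n \<ge> 2 \<Longrightarrow> \<nu> \<in> {\<nu>1..\<nu>2} \<Longrightarrow> real n * (a - 2 * \<nu> / d * ln (real n)) \<le> L n \<nu>"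
    and upper: "\<And>\<delta>. \<delta> > 0 \<Longrightarrow> \<exists>C. \<forall>\<^sub>F n in sequentially.
       L n \<nu>0 \<le> real n * (C + 12 * \<delta> * ln (real n) - (1 - \<delta>) * (2 * \<nu>0 / d) * ln (real n))"
  shows "ereal \<nu>0 \<le> liminf (\<lambda>n. ereal (v n))"
proof (rule le_Liminf_iff[THEN iffD2], intro allI impI)
  fix y assume "y < ereal \<nu>0"
  then obtain \<epsilon> where \<epsilon>: "\<epsilon> > 0" "y < ereal (\<nu>0 - \<epsilon>)"
  proof -
    obtain z where z: "y < ereal z" "z < \<nu>0" using \<open>y < ereal \<nu>0\<close> ereal_dense2[of y "ereal \<nu>0"] by auto
    show ?thesis by (rule that[of "\<nu>0 - z"]) (use z in auto)
  qed
  \<comment> \<open>The losses proportional to \<delta>, namely 12 \<delta> and \<delta> times 2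
    \<nu>0 / d, add up to \<epsilon> / d.\<close>
  define \<delta> where "\<delta> = \<epsilon> / d / (12 + 2 * \<nu>0 / d)"
  have den: "12 + 2 * \<nu>0 / d > 0" using d \<nu>0 by (intro add_pos_nonneg) auto
  have \<delta>: "\<delta> > 0" using \<epsilon> d den by (simp add: \<delta>_def)
  have \<delta>e: "\<delta> * (12 + 2 * \<nu>0 / d) = \<epsilon> / d" using den by (simp add: \<delta>_def)
  obtain C where C: "\<forall>\<^sub>F n in sequentially.
      L n \<nu>0 \<le> real n * (C + 12 * \<delta> * ln (real n) - (1 - \<delta>) * (2 * \<nu>0 / d) * ln (real n))"
    using upper[OF \<delta>] by blast
  have "filterlim (\<lambda>n. \<epsilon> / d * ln (real n)) at_top sequentially"
    using \<epsilon> d by real_asymp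
  then have "\<forall>\<^sub>F n in sequentially. C - a < \<epsilon> / d * ln (real n)"
    by (simp add: filterlim_at_top_dense)
  with C show "\<forall>\<^sub>F n in sequentially. y < ereal (v n)"
    using eventually_ge_at_top[of 2]
  proof eventually_elim
    case (elim n)
    have vn: "v n \<in> {\<nu>1..\<nu>2}" "L n (v n) \<le> L n \<nu>0"
      using min[of n] elim(3) \<nu>0 unfolding is_arg_min_def by (auto simp: not_less)
    have "\<nu>0 - \<epsilon> < v n"
    proof (rule ccontr)
      assume "\<not> \<nu>0 - \<epsilon> < v n"
      then have "v n \<le> \<nu>0 - \<epsilon>" by simp
      then have "2 * v n / d * ln (real n) \<le> 2 * (\<nu>0 - \<epsilon>) / d * ln (real n)"
        using d elim(3) by (intro mult_right_mono divide_right_mono) auto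
      moreover have "real n * (a - 2 * v n / d * ln (real n))
         \<le> real n * (C + 12 * \<delta> * ln (real n) - (1 - \<delta>) * (2 * \<nu>0 / d) * ln (real n))"
        using lower[OF elim(3) vn(1)] vn(2) elim(1) by linarith
      then have "a - 2 * v n / d * ln (real n) \<le> C + 12 * \<delta> * ln (real n) - (1 - \<delta>) * (2 * \<nu>0 / d) * ln (real n)"
        using elim(3) by simp
      moreover have "(1 - \<delta>) * (2 * \<nu>0 / d) * ln (real n) = 2 * \<nu>0 / d * ln (real n) - \<delta> * (2 * \<nu>0 / d) * ln (real n)"
        by (simp only: left_diff_distrib mult_1_left)
      moreover have "\<delta> * (12 + 2 * \<nu>0 / d) * ln (real n) = 12 * \<delta> * ln (real n) + \<delta> * (2 * \<nu>0 / d) * ln (real n)"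
        by (simp only: distrib_left distrib_right mult.commute[of \<delta> 12])
      then have "12 * \<delta> * ln (real n) + \<delta> * (2 * \<nu>0 / d) * ln (real n) = \<epsilon> / d * ln (real n)"
        unfolding \<delta>e by simp
      moreover have "2 * (\<nu>0 - \<epsilon>) / d * ln (real n) = 2 * \<nu>0 / d * ln (real n) - 2 * (\<epsilon> / d * ln (real n))"
        by (simp add: left_diff_distrib diff_divide_distrib)
      \<comment> \<open>The linear core of the estimate, with every product that involves the
        logarithm treated as a single variable.\<close>
      moreover have "P \<le> U - 2 * e \<Longrightarrow> a - P \<le> C + S - V \<Longrightarrow> V = U - T \<Longrightarrow> S + T = e \<Longrightarrow> e \<le> C - a"
        for P S T U V e :: real by linarith
      ultimately have "\<epsilon> / d * ln (real n) \<le> C - a" by metis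
      then show False using elim(2) by linarith
    qed
    then show ?case using \<epsilon>(2) by (meson ereal_less_eq(3) less_le_trans less_imp_le)
  qed
qed


section \<open>Almost sure bounds along the design points\<close>

lemma set_first_points: "set (first_points x n) = x ` {1..n}"
  by (auto simp: first_points_def)

lemma length_first_points [simp]: "length (first_points x n) = n"
  by (simp add: first_points_def)

lemma distinct_first_points:
  assumes "inj_on x {1..}"
  shows "distinct (first_points x n)"
  unfolding first_points_def distinct_map by (intro conjI distinct_upt inj_on_subset[OF assms]) auto

text \<open>Exponential moments made uniform in \<open>n\<close>. The means
  \<open>sqrt 2 ^ n\<close> are beaten by exp (-n), which gives the term 4 n. The residuals at
  \<open>n\<close> points need the weight n^(-3) to leave the summable n^(-2), which gives 4 * 3 =
  12 as the coefficient of the logarithm.\<close>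

lemma (in centered_gaussian_process) AE_data_fit_and_residual_bounds:
  assumes "\<And>n. distinct (X n)" "\<And>n. length (X n) = n" "\<And>n. set (X n) \<subseteq> T" "\<And>x y. k x y = k y x"
    and "\<And>n. n \<ge> 2 \<Longrightarrow> \<exists>c>0. coercive k (set (X n)) c"
  shows "AE w in M. \<exists>b. \<forall>n\<ge>2. data_fit k (\<lambda>t. f t w) (X n) \<le> 4 * real n + b \<and>
    (\<forall>p\<in>set (X n). squared_loo_residual k (\<lambda>t. f t w) (X n) p
       \<le> 12 * ln (real n) + b)"
proof -
  let ?r = "\<lambda>n p. removeAll p (X n)"
  define c where "c n = (SOME c. c > 0 \<and> coercive k (set (X n)) c)" for n
  have c: "c n > 0" "coercive k (set (X n)) (c n)" if "n \<ge> 2" for n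
    using someI_ex[of "\<lambda>c. c > 0 \<and> coercive k (set (X n)) c"] assms(5)[OF that] by (auto simp: c_def)
  define Q where "Q n w = data_fit k (\<lambda>t. f t w) (X n)" for n w
  define Z where "Z n p w = squared_loo_residual k (\<lambda>t. f t w) (X n) p" for n p w
  have Qm: "Q n \<in> borel_measurable M" if "n \<ge> 2" for n
    unfolding Q_def by (rule data_fit_measurable[OF assms(1) c[OF that] assms(4,3)])
  have QI: "(\<integral>\<^sup>+w. ennreal (exp (Q n w / 4)) \<partial>M) = ennreal (sqrt 2 ^ n)" if "n \<ge> 2" for n
    unfolding Q_def by (subst nn_expectation_exp_data_fit[OF assms(1) c[OF that] assms(4,3)]) (simp add: assms(2))
  have rm: "distinct (?r n p)" "p \<notin> set (?r n p)" for n p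
    using assms(1) by (auto simp: distinct_removeAll)
  have co: "coercive k (insert p (set (?r n p))) (c n)" "insert p (set (?r n p)) \<subseteq> T"
    if "n \<ge> 2" "p \<in> set (X n)" for n p
  proof -
    have "insert p (set (?r n p)) = set (X n)" using that(2) by auto
    then show "coercive k (insert p (set (?r n p))) (c n)" "insert p (set (?r n p)) \<subseteq> T"
      using c(2)[OF that(1)] assms(3) by simp_all
  qed
  have Zm: "Z n p \<in> borel_measurable M" if "n \<ge> 2" "p \<in> set (X n)" for n p
  proof -
    have "coercive k (set (?r n p)) (c n)"
      using coercive_subset[OF co(1)[OF that], of "set (?r n p)"] by auto
    then show ?thesis
      unfolding Z_def using residual_measurable[OF rm c(1)[OF that(1)] _ assms(4) co(2)[OF that]] by measurable
  qed
  have ZI: "(\<integral>\<^sup>+w. ennreal (exp (Z n p w / 4)) \<partial>M) = ennreal (sqrt 2)" if "n \<ge> 2" "p \<in> set (X n)" for n p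
    unfolding Z_def by (rule nn_expectation_exp_residual[OF rm c(1)[OF that(1)] co(1)[OF that] assms(4) co(2)[OF that]])
  have Q2: "Q (n + 2) \<in> borel_measurable M" for n by (rule Qm) simp
  \<comment> \<open>The shift by 2 starts both families at the first index for which coercivity is
    assumed.\<close>
  define W1 where "W1 n w = exp (Q (n + 2) w / 4) * exp (- real (n + 2))" for n w
  define W2 where "W2 n w = (\<Sum>p\<in>set (X (n + 2)). exp (Z (n + 2) p w / 4)) * inverse (real (n + 2) ^ 3)" for n w
  have A1: "AE w in M. \<exists>B>0. \<forall>n. W1 n w \<le> B"
  proof (rule AE_bounded_of_summable_nn_integral)
    show "W1 n \<in> borel_measurable M" for n unfolding W1_def using Q2[of n] by measurable
    show "W1 n w \<ge> 0" for n w by (simp add: W1_def)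
    show "(\<integral>\<^sup>+w. ennreal (W1 n w) \<partial>M) \<le> ennreal ((sqrt 2 * exp (- 1)) ^ (n + 2))" for n
    proof -
      have "(\<integral>\<^sup>+w. ennreal (W1 n w) \<partial>M) = (\<integral>\<^sup>+w. ennreal (exp (Q (n + 2) w / 4)) * ennreal (exp (- real (n + 2))) \<partial>M)"
        unfolding W1_def by (intro nn_integral_cong ennreal_mult) auto
      also have "\<dots> = ennreal (sqrt 2 ^ (n + 2)) * ennreal (exp (- real (n + 2)))"
      proof (subst nn_integral_multc)
        show "(\<lambda>w. ennreal (exp (Q (n + 2) w / 4))) \<in> borel_measurable M" using Q2[of n] by measurable
      qed (simp only: QI le_add2)
      also have "exp (- real (n + 2)) = exp (- 1) ^ (n + 2)" unfolding exp_of_nat_mult[symmetric] by simp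
      also have "ennreal (sqrt 2 ^ (n + 2)) * ennreal (exp (- 1) ^ (n + 2)) = ennreal ((sqrt 2 * exp (- 1)) ^ (n + 2))"
        by (simp only: power_mult_distrib ennreal_mult[symmetric] real_sqrt_ge_zero zero_le_power exp_ge_zero zero_le_numeral)
      finally show ?thesis by simp
    qed
    have "sqrt 2 < (2::real)" using real_sqrt_less_mono[of 2 4] by simp
    moreover have "exp (1::real) \<ge> 2" using exp_ge_add_one_self[of 1] by simp
    ultimately have "sqrt 2 < exp (1::real)" by linarith
    then have "sqrt 2 * exp (- 1) < (1::real)" by (simp add: exp_minus field_simps)
    then show "summable (\<lambda>n. (sqrt 2 * exp (- 1 :: real)) ^ (n + 2))"
      by (intro summable_ignore_initial_segment summable_geometric) simp
  qed simp
  have A2: "AE w in M. \<exists>B>0. \<forall>n. W2 n w \<le> B"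
  proof (rule AE_bounded_of_summable_nn_integral)
    show "W2 n \<in> borel_measurable M" for n
      unfolding W2_def using Zm[of "n + 2"] by (intro borel_measurable_times borel_measurable_sum) (auto intro!: borel_measurable_exp[THEN measurable_compose[rotated]])
    show "W2 n w \<ge> 0" for n w by (simp add: W2_def sum_nonneg)
    show "(\<integral>\<^sup>+w. ennreal (W2 n w) \<partial>M) \<le> ennreal (sqrt 2 * inverse (real (n + 2) ^ 2))" for n
    proof -
      have m: "(\<lambda>w. ennreal (exp (Z (n + 2) p w / 4))) \<in> borel_measurable M" if "p \<in> set (X (n + 2))" for p
        using Zm[OF le_add2 that] by measurable
      have "(\<integral>\<^sup>+w. ennreal (W2 n w) \<partial>M)
         = (\<integral>\<^sup>+w. (\<Sum>p\<in>set (X (n + 2)). ennreal (exp (Z (n + 2) p w / 4))) * ennreal (inverse (real (n + 2) ^ 3)) \<partial>M)"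
        unfolding W2_def by (intro nn_integral_cong) (subst ennreal_mult, auto simp: sum_nonneg sum_ennreal)
      also have "\<dots> = (\<Sum>p\<in>set (X (n + 2)). \<integral>\<^sup>+w. ennreal (exp (Z (n + 2) p w / 4)) \<partial>M) * ennreal (inverse (real (n + 2) ^ 3))"
        using m by (subst nn_integral_multc, measurable) (subst nn_integral_sum, auto)
      also have "(\<Sum>p\<in>set (X (n + 2)). \<integral>\<^sup>+w. ennreal (exp (Z (n + 2) p w / 4)) \<partial>M) = (\<Sum>p\<in>set (X (n + 2)). ennreal (sqrt 2))"
        by (intro sum.cong refl ZI) auto
      also have "\<dots> = ennreal (real (n + 2) * sqrt 2)"
        by (simp add: distinct_card assms(1,2) ennreal_mult' ennreal_of_nat_eq_real_of_nat)
      also have "\<dots> * ennreal (inverse (real (n + 2) ^ 3)) = ennreal (real (n + 2) * sqrt 2 * inverse (real (n + 2) ^ 3))"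
        by (simp add: ennreal_mult)
      also have "real (n + 2) * sqrt 2 * inverse (real (n + 2) ^ 3) = sqrt 2 * inverse (real (n + 2) ^ 2)"
        by (simp only: power3_eq_cube power2_eq_square) (simp del: of_nat_add)
      finally show ?thesis by simp
    qed
    show "summable (\<lambda>n. sqrt 2 * inverse (real (n + 2) ^ 2))"
      using inverse_power_summable[of 2, where ?'a = real]
      by (intro summable_mult) (rule summable_ignore_initial_segment, simp)
  qed simp
  from A1 A2 show ?thesis
  proof eventually_elim
    case (elim w)
    obtain B1 B2 where B: "B1 > 0" "\<forall>n. W1 n w \<le> B1" "B2 > 0" "\<forall>n. W2 n w \<le> B2" using elim by blast
    define b where "b = max (4 * ln B1) (4 * ln B2)"
    have "Q n w \<le> 4 * real n + b \<and> (\<forall>p\<in>set (X n). Z n p w \<le> 12 * ln (real n) + b)" if n: "n \<ge> 2" for n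
    proof
      have n2: "Suc (Suc (n - 2)) = n" using n by simp
      have "W1 (n - 2) w = exp (Q n w / 4 - real n)" using n by (simp add: W1_def n2 flip: exp_add)
      then have "exp (Q n w / 4 - real n) \<le> exp (ln B1)" using B(1,2) by (metis exp_ln)
      then show "Q n w \<le> 4 * real n + b" by (simp add: b_def)
      show "\<forall>p\<in>set (X n). Z n p w \<le> 12 * ln (real n) + b"
      proof
        fix p assume p: "p \<in> set (X n)"
        have "exp (Z n p w / 4) \<le> (\<Sum>p\<in>set (X n). exp (Z n p w / 4))"
          using p by (intro member_le_sum) auto
        then have "exp (Z n p w / 4) * inverse (real n ^ 3) \<le> (\<Sum>p\<in>set (X n). exp (Z n p w / 4)) * inverse (real n ^ 3)"
          by (intro mult_right_mono) auto
        also have "\<dots> = W2 (n - 2) w" using n by (simp add: W2_def n2)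
        also have "\<dots> \<le> B2" using B by blast
        finally have "exp (Z n p w / 4) \<le> B2 * real n ^ 3" using n by (simp add: field_simps)
        also have "\<dots> = exp (ln B2 + 3 * ln (real n))"
          using n B(3) by (simp add: exp_add exp_of_nat_mult[of 3, simplified])
        finally show "Z n p w \<le> 12 * ln (real n) + b" by (simp add: b_def)
      qed
    qed
    then show ?case unfolding Q_def Z_def by blast
  qed
qed


theorem corollary3p14:
  fixes \<sigma> l \<nu>\<^sub>m\<^sub>i\<^sub>n \<nu>\<^sub>m\<^sub>a\<^sub>x \<nu>\<^sub>0 :: real
    and c :: "real \<Rightarrow> real"
    and \<Omega> :: "(real ^ 'd) set"
    and x :: "nat \<Rightarrow> real ^ 'd"
    and M :: "'w measure"
    and f\<^sub>0 :: "real ^ 'd \<Rightarrow> 'w \<Rightarrow> real"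
    and nu_ML nu_CV :: "nat \<Rightarrow> 'w \<Rightarrow> real"
  assumes Theta: "0 < \<nu>\<^sub>m\<^sub>i\<^sub>n" "\<nu>\<^sub>m\<^sub>i\<^sub>n \<le> \<nu>\<^sub>m\<^sub>a\<^sub>x" "real CARD('d) / 2 < \<nu>\<^sub>m\<^sub>a\<^sub>x"
    and kernel: "\<sigma> > 0" "l > 0" "\<And>\<nu>. \<nu> > 0 \<Longrightarrow> c \<nu> > 0"
    and c_inf: "(INF \<nu>\<in>{\<nu>\<^sub>m\<^sub>i\<^sub>n..\<nu>\<^sub>m\<^sub>a\<^sub>x}. c \<nu>) > 0"
    and domain: "bounded \<Omega>" "connected \<Omega>" "open \<Omega>"
      "interior_cone_condition \<Omega>" "lipschitz_boundary \<Omega>"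
    and points: "\<And>i. i \<ge> 1 \<Longrightarrow> x i \<in> \<Omega>" "inj_on x {1..}" "quasi_uniform \<Omega> x"
    and nu0: "\<nu>\<^sub>0 \<in> {real CARD('d) / 2<..\<nu>\<^sub>m\<^sub>a\<^sub>x}"
    and process: "zero_mean_gaussian_process M \<Omega> (matern \<sigma> l c \<nu>\<^sub>0) f\<^sub>0"
      "AE w in M. continuous_on \<Omega> (\<lambda>p. f\<^sub>0 p w)"
    and min_ML: "\<And>n w. n \<ge> 1 \<Longrightarrow> w \<in> space M \<Longrightarrow>
      is_arg_min (ell_ML (matern \<sigma> l c) (\<lambda>p. f\<^sub>0 p w) (first_points x n))
        (\<lambda>\<nu>. \<nu> \<in> {\<nu>\<^sub>m\<^sub>i\<^sub>n..\<nu>\<^sub>m\<^sub>a\<^sub>x}) (nu_ML n w)"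
    and min_CV: "\<And>n w. n \<ge> 1 \<Longrightarrow> w \<in> space M \<Longrightarrow>
      is_arg_min (ell_CV (matern \<sigma> l c) (\<lambda>p. f\<^sub>0 p w) (first_points x n))
        (\<lambda>\<nu>. \<nu> \<in> {\<nu>\<^sub>m\<^sub>i\<^sub>n..\<nu>\<^sub>m\<^sub>a\<^sub>x}) (nu_CV n w)"
  shows "AE w in M. liminf (\<lambda>n. ereal (nu_ML n w)) \<ge> ereal \<nu>\<^sub>0
                  \<and> liminf (\<lambda>n. ereal (nu_CV n w)) \<ge> ereal (\<nu>\<^sub>0 - real CARD('d) / 2)"
proof (cases "\<nu>\<^sub>0 < \<nu>\<^sub>m\<^sub>i\<^sub>n")
  case True
  \<comment> \<open>Here the whole parameter interval lies above \<open>\<nu>\<^sub>0\<close>, and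
    so does every minimiser.\<close>
  have weaken: "ereal (\<nu>\<^sub>0 - real CARD('d) / 2) \<le> ereal \<nu>\<^sub>0" by simp
  have "ereal \<nu>\<^sub>0 \<le> liminf (\<lambda>n. ereal (nu_ML n w)) \<and> ereal \<nu>\<^sub>0 \<le> liminf (\<lambda>n. ereal (nu_CV n w))"
    if w: "w \<in> space M" for w
  proof (intro conjI Liminf_bounded)
    show "\<forall>\<^sub>F n in sequentially. ereal \<nu>\<^sub>0 \<le> ereal (nu_ML n w)"
      using eventually_ge_at_top[of 1]
      by eventually_elim (use min_ML[OF _ w] True in \<open>force simp: is_arg_min_def\<close>)
    show "\<forall>\<^sub>F n in sequentially. ereal \<nu>\<^sub>0 \<le> ereal (nu_CV n w)"
      using eventually_ge_at_top[of 1]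
      by eventually_elim (use min_CV[OF _ w] True in \<open>force simp: is_arg_min_def\<close>)
  qed
  then show ?thesis using order_trans[OF weaken] by (intro AE_I2) blast
next
  case False
  let ?d = "real CARD('d)"
  let ?K = "matern \<sigma> l c :: real \<Rightarrow> real ^ 'd \<Rightarrow> _"
  let ?k = "?K \<nu>\<^sub>0"
  let ?xs = "first_points x"
  let ?\<Theta> = "{\<nu>\<^sub>m\<^sub>i\<^sub>n..\<nu>\<^sub>m\<^sub>a\<^sub>x}"
  \<comment> \<open>In this case \<open>\<nu>\<^sub>0\<close> is itself a competitor in the
    minimisation, so the criteria can be compared with their values there.\<close>
  have \<nu>0: "\<nu>\<^sub>0 \<in> ?\<Theta>" "\<nu>\<^sub>0 > 0" using False nu0 Theta by auto
  have dist: "distinct (?xs n)" for n by (rule distinct_first_points[OF points(2)])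
  have sub: "set (?xs n) \<subseteq> \<Omega>" for n using points(1) by (auto simp: set_first_points)
  obtain R where R: "\<forall>y\<in>\<Omega>. norm y \<le> R" using domain(1) unfolding bounded_iff by blast
  obtain a where a: "a > 0" "\<forall>n\<ge>2. \<forall>i\<in>{1..n}. \<forall>j\<in>{1..n}. i \<noteq> j \<longrightarrow>
      a * real n powr (- 1 / DIM(real ^ 'd)) \<le> norm (x i - x j)"
    by (rule quasi_uniform_separation[OF domain(1,3) points(1,3)])
  have bdd: "bdd_below (c ` ?\<Theta>)"
    using kernel(3) Theta(1) by (intro bdd_belowI2[of _ 0]) (force intro: less_imp_le)
  obtain \<kappa> where \<kappa>: "\<kappa> > 0" "\<forall>n\<ge>2. \<forall>\<nu>\<in>?\<Theta>.
      coercive (?K \<nu>) (set (?xs n)) (\<kappa> * real n powr (- (2 * \<nu> / DIM(real ^ 'd))))"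
  proof (rule coercive_matern_uniform[OF kernel(1,2) Theta(1) c_inf _ a(1)])
    show "(INF \<nu>\<in>?\<Theta>. c \<nu>) \<le> c \<nu>" if "\<nu> \<in> ?\<Theta>" for \<nu>
      using bdd that by (rule cINF_lower)
    show "a * real n powr (- 1 / DIM(real ^ 'd)) \<le> norm (y - z)"
      if "n \<ge> 2" "y \<in> set (?xs n)" "z \<in> set (?xs n)" "y \<noteq> z" for n y z
      using a(2) that by (force simp: set_first_points)
  qed auto
  \<comment> \<open>Common order of the lower bound for the smallest eigenvalue and, at
    \<open>\<nu>\<^sub>0\<close>, of the upper bound for the conditional variances outside
    \<open>B\<close>; their ratio is therefore free of \<open>n\<close>.\<close>
  define \<rho> where "\<rho> n \<nu> = real n powr (- (2 * \<nu> / ?d))" for n :: nat and \<nu>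
  have \<rho>: "\<rho> n \<nu> > 0" "ln (\<rho> n \<nu>) = - (2 * \<nu> / ?d) * ln (real n)" if "n \<ge> 2" for n \<nu>
    using that by (simp_all add: \<rho>_def ln_powr)
  have co: "coercive (?K \<nu>) (set (?xs n)) (\<kappa> * \<rho> n \<nu>)" "0 < \<kappa> * \<rho> n \<nu>"
    if "n \<ge> 2" "\<nu> \<in> ?\<Theta>" for n \<nu>
    using \<kappa> that \<rho>(1) by (auto simp: \<rho>_def)
  have lnc: "real n * ln (\<kappa> * \<rho> n \<nu>) = real n * (ln \<kappa> - 2 * \<nu> / ?d * ln (real n))" if "n \<ge> 2" for n \<nu>
    using \<kappa>(1) \<rho>[OF that, of \<nu>] by (simp add: ln_mult)
  \<comment> \<open>At least 1, so that \<open>ln k0\<close> is nonnegative and its coefficient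
    \<open>card B\<close> may be enlarged to \<open>n\<close>.\<close>
  define k0 where "k0 = max 1 (?k 0 0)"
  have k0: "k0 > 0" "ln k0 \<ge> 0" by (auto simp: k0_def)
  have k0_le: "?k p p \<le> k0" for p
  proof -
    have "?k p p = ?k 0 0" by (rule matern_diagonal)
    also have "\<dots> \<le> k0" unfolding k0_def by (rule max.cobounded2)
    finally show ?thesis .
  qed
  interpret centered_gaussian_process M \<Omega> "?k" f\<^sub>0
    by standard (rule process(1))
  have "AE w in M. \<exists>b. \<forall>n\<ge>2. data_fit ?k (\<lambda>t. f\<^sub>0 t w) (?xs n) \<le> 4 * real n + b \<and>
    (\<forall>p\<in>set (?xs n). squared_loo_residual ?k (\<lambda>t. f\<^sub>0 t w) (?xs n) p \<le> 12 * ln (real n) + b)"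
  proof (rule AE_data_fit_and_residual_bounds[OF dist length_first_points sub matern_commute])
    show "\<exists>c'>0. coercive ?k (set (?xs n)) c'" if "n \<ge> 2" for n
      using co[OF that \<nu>0(1)] by blast
  qed
  then show ?thesis
    using AE_space
  proof eventually_elim
    case (elim w)
    let ?f = "\<lambda>p. f\<^sub>0 p w"
    obtain b0 where b0: "\<forall>n\<ge>2. data_fit ?k ?f (?xs n) \<le> 4 * real n + b0 \<and>
      (\<forall>p\<in>set (?xs n). squared_loo_residual ?k ?f (?xs n) p \<le> 12 * ln (real n) + b0)"
      using elim(1) by blast
    define b where "b = \<bar>b0\<bar>"
    have b: "b \<ge> 0" "b0 \<le> b" by (auto simp: b_def)
    have fit: "data_fit ?k ?f (?xs n) \<le> real n * (4 + b)" if "n \<ge> 2" for n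
    proof -
      have "b \<le> real n * b" using that b(1) by (simp add: mult_le_cancel_right1)
      then show ?thesis using b0 that b(2) by (force simp: distrib_left)
    qed
    have loo: "squared_loo_residual ?k ?f (?xs n) p \<le> 12 * ln (real n) + b"
      if "n \<ge> 2" "p \<in> set (?xs n)" for n p
      using b0 that b(2) by force
    \<comment> \<open>Collects what does not depend on the sample: a small exceptional set together
      with the resulting bound on the logarithmic terms at \<open>\<nu>\<^sub>0\<close>.\<close>
    define good where "good \<delta> C0 n \<longleftrightarrow> n \<ge> 2 \<and> (\<exists>B\<subseteq>set (?xs n). real (card B) \<le> \<delta> * real n \<and>
        predicts ?k (set (?xs n)) B (C0 * \<rho> n \<nu>\<^sub>0) \<and>
        real (card B) * ln k0 + (real n - real (card B)) * ln (C0 * \<rho> n \<nu>\<^sub>0)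
          \<le> real n * (ln k0 + \<bar>ln C0\<bar> - (1 - \<delta>) * (2 * \<nu>\<^sub>0 / ?d) * ln (real n)))" for \<delta> C0 n
    have upper: "\<exists>C0>0. \<forall>\<^sub>F n in sequentially. good \<delta> C0 n"
      if \<delta>: "\<delta> > 0" for \<delta>
    proof -
      obtain C0 where C0: "C0 > 0" "\<forall>\<^sub>F n in sequentially. \<exists>B\<subseteq>set (?xs n). real (card B) \<le> \<delta> * real n \<and>
          predicts ?k (set (?xs n)) B (C0 * real n powr (- (2 * \<nu>\<^sub>0 / DIM(real ^ 'd))))"
      proof (rule matern_predicting_small_subset[of \<sigma> l c \<nu>\<^sub>0 "\<lambda>n. set (?xs n)" R \<delta>])
        show "norm y \<le> R" if "y \<in> set (?xs n)" for n y using R sub that by blast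
      qed (use kernel \<nu>0 \<delta> in auto)
      have "\<forall>\<^sub>F n in sequentially. good \<delta> C0 n"
        using C0(2) eventually_ge_at_top[of 2]
      proof eventually_elim
        case (elim n)
        obtain B where B: "B \<subseteq> set (?xs n)" "real (card B) \<le> \<delta> * real n"
          "predicts ?k (set (?xs n)) B (C0 * \<rho> n \<nu>\<^sub>0)"
          using elim(1) by (auto simp: \<rho>_def)
        have "card B \<le> card (set (?xs n))" using B(1) by (intro card_mono) auto
        then have cB: "real (card B) \<le> real n" using dist[of n] by (simp add: distinct_card)
        let ?t = "2 * \<nu>\<^sub>0 / ?d * ln (real n)"
        have t: "?t \<ge> 0" using \<nu>0 elim(2) by simp
        have "ln (C0 * \<rho> n \<nu>\<^sub>0) = ln C0 - ?t"
          using C0(1) \<rho>[OF elim(2), of \<nu>\<^sub>0] by (simp add: ln_mult)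
        moreover have "(real n - real (card B)) * (ln C0 - ?t)
            = (real n - real (card B)) * ln C0 - (real n - real (card B)) * ?t"
          by (rule right_diff_distrib)
        moreover have "(real n - real (card B)) * ln C0 \<le> real n * \<bar>ln C0\<bar>"
        proof -
          have "(real n - real (card B)) * ln C0 \<le> (real n - real (card B)) * \<bar>ln C0\<bar>"
            using cB by (intro mult_left_mono) auto
          also have "\<dots> \<le> real n * \<bar>ln C0\<bar>" by (intro mult_right_mono) auto
          finally show ?thesis .
        qed
        moreover have "(1 - \<delta>) * real n * ?t \<le> (real n - real (card B)) * ?t"
          using B(2) t by (intro mult_right_mono) (auto simp: left_diff_distrib)
        moreover have "real (card B) * ln k0 \<le> real n * ln k0"
          using cB k0(2) by (rule mult_right_mono)
        moreover have "U + P \<le> V + S - T" if "P = Q - R" "Q \<le> S" "T \<le> R" "U \<le> V" for P Q R S T U V :: real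
          using that by linarith
        ultimately have "real (card B) * ln k0 + (real n - real (card B)) * ln (C0 * \<rho> n \<nu>\<^sub>0)
          \<le> real n * ln k0 + real n * \<bar>ln C0\<bar> - (1 - \<delta>) * real n * ?t" by (simp only:)
        also have "\<dots> = real n * (ln k0 + \<bar>ln C0\<bar> - (1 - \<delta>) * (2 * \<nu>\<^sub>0 / ?d) * ln (real n))"
          by (simp add: algebra_simps)
        finally show ?case unfolding good_def using B elim(2) by blast
      qed
      with C0(1) show ?thesis by blast
    qed
    \<comment> \<open>One bound for both criteria: the data fit enters with coefficient 1 for
      maximum likelihood and \<open>C0 / \<kappa>\<close> for cross validation, so the sum of the
      two covers each, and the residual term on \<open>B\<close> is nonnegative.\<close>
    define U where "U n B C0 = (1 + C0 / \<kappa>) * (real n * (4 + b)) + real (card B) * (12 * ln (real n) + b)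
        + real (card B) * ln k0 + (real n - real (card B)) * ln (C0 * \<rho> n \<nu>\<^sub>0)" for n and B :: "(real ^ 'd) set" and C0
    have criterion: "ereal \<nu>\<^sub>0 \<le> liminf (\<lambda>n. ereal (v n))"
      if min: "\<And>n. n \<ge> 1 \<Longrightarrow> is_arg_min (L n) (\<lambda>\<nu>. \<nu> \<in> ?\<Theta>) (v n)"
        and lo: "\<And>n \<nu>. n \<ge> 2 \<Longrightarrow> \<nu> \<in> ?\<Theta> \<Longrightarrow> real n * ln (\<kappa> * \<rho> n \<nu>) \<le> L n \<nu>"
        and up: "\<And>n B C0. n \<ge> 2 \<Longrightarrow> B \<subseteq> set (?xs n) \<Longrightarrow> predicts ?k (set (?xs n)) B (C0 * \<rho> n \<nu>\<^sub>0) \<Longrightarrow>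
          C0 > 0 \<Longrightarrow> L n \<nu>\<^sub>0 \<le> U n B C0"
      for L v
    proof (rule liminf_arg_min_ge[where d = ?d and a = "ln \<kappa>", OF _ \<nu>0 min])
      show "real n * (ln \<kappa> - 2 * \<nu> / ?d * ln (real n)) \<le> L n \<nu>"
        if "n \<ge> 2" "\<nu> \<in> ?\<Theta>" for n \<nu>
        using lo[OF that] lnc[OF that(1)] by simp
      show "\<exists>C. \<forall>\<^sub>F n in sequentially. L n \<nu>\<^sub>0
          \<le> real n * (C + 12 * \<delta> * ln (real n) - (1 - \<delta>) * (2 * \<nu>\<^sub>0 / ?d) * ln (real n))"
        if \<delta>: "\<delta> > 0" for \<delta>
      proof -
        obtain C0 where C0: "C0 > 0" and ev: "\<forall>\<^sub>F n in sequentially. good \<delta> C0 n"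
          using upper[OF \<delta>] by blast
        have "\<forall>\<^sub>F n in sequentially. L n \<nu>\<^sub>0
          \<le> real n * (((1 + C0 / \<kappa>) * (4 + b) + \<delta> * b + ln k0 + \<bar>ln C0\<bar>)
              + 12 * \<delta> * ln (real n) - (1 - \<delta>) * (2 * \<nu>\<^sub>0 / ?d) * ln (real n))"
          using ev
        proof eventually_elim
          case (elim n)
          then obtain B where n: "n \<ge> 2" and B: "B \<subseteq> set (?xs n)" "predicts ?k (set (?xs n)) B (C0 * \<rho> n \<nu>\<^sub>0)"
            "real (card B) * ln k0 + (real n - real (card B)) * ln (C0 * \<rho> n \<nu>\<^sub>0)
              \<le> real n * (ln k0 + \<bar>ln C0\<bar> - (1 - \<delta>) * (2 * \<nu>\<^sub>0 / ?d) * ln (real n))"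
            "real (card B) \<le> \<delta> * real n"
            unfolding good_def by blast
          have "real (card B) * (12 * ln (real n) + b) \<le> \<delta> * real n * (12 * ln (real n) + b)"
            using B(4) b(1) n by (intro mult_right_mono) auto
          then have "L n \<nu>\<^sub>0 \<le> (1 + C0 / \<kappa>) * (real n * (4 + b)) + \<delta> * real n * (12 * ln (real n) + b)
              + real n * (ln k0 + \<bar>ln C0\<bar> - (1 - \<delta>) * (2 * \<nu>\<^sub>0 / ?d) * ln (real n))"
            using up[OF n B(1,2) C0] B(3) unfolding U_def by linarith
          also have "\<dots> = real n * (((1 + C0 / \<kappa>) * (4 + b) + \<delta> * b + ln k0 + \<bar>ln C0\<bar>)
              + 12 * \<delta> * ln (real n) - (1 - \<delta>) * (2 * \<nu>\<^sub>0 / ?d) * ln (real n))"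
            by (simp add: algebra_simps)
          finally show ?case .
        qed
        then show ?thesis by blast
      qed
    qed simp
    have fit_nonneg: "0 \<le> data_fit ?k ?f (?xs n)" if "n \<ge> 2" for n
      by (rule data_fit_nonneg[OF dist co(2,1)[OF that \<nu>0(1)] matern_commute])
    have "ereal \<nu>\<^sub>0 \<le> liminf (\<lambda>n. ereal (nu_ML n w))"
    proof (rule criterion[OF min_ML[OF _ elim(2)]])
      show "real n * ln (\<kappa> * \<rho> n \<nu>) \<le> ell_ML ?K ?f (?xs n) \<nu>" if "n \<ge> 2" "\<nu> \<in> ?\<Theta>" for n \<nu>
        using ell_ML_ge[of "?xs n" "\<kappa> * \<rho> n \<nu>" ?K \<nu> ?f, OF dist co(2,1)[OF that] matern_commute] by simp
      fix n B C0
      assume n: "n \<ge> 2" and B: "B \<subseteq> set (?xs n)" "predicts ?k (set (?xs n)) B (C0 * \<rho> n \<nu>\<^sub>0)" and C0: "C0 > 0"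
      have v: "C0 * \<rho> n \<nu>\<^sub>0 > 0" using C0 \<rho>(1)[OF n] by simp
      have "1 * data_fit ?k ?f (?xs n) \<le> (1 + C0 / \<kappa>) * (real n * (4 + b))"
        using C0 \<kappa>(1) by (intro mult_mono fit[OF n] fit_nonneg[OF n]) auto
      moreover have "0 \<le> real (card B) * (12 * ln (real n) + b)" using b(1) n by simp
      moreover have "ell_ML ?K ?f (?xs n) \<nu>\<^sub>0 \<le> data_fit ?k ?f (?xs n)
          + real (card B) * ln k0 + (real n - real (card B)) * ln (C0 * \<rho> n \<nu>\<^sub>0)"
        using ell_ML_le[of "?xs n" "\<kappa> * \<rho> n \<nu>\<^sub>0" ?K \<nu>\<^sub>0 B "C0 * \<rho> n \<nu>\<^sub>0" k0 ?f,
            OF dist co(2,1)[OF n \<nu>0(1)] matern_commute B k0_le k0(1) v] by simp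
      ultimately show "ell_ML ?K ?f (?xs n) \<nu>\<^sub>0 \<le> U n B C0" unfolding U_def by linarith
    qed
    moreover have "ereal \<nu>\<^sub>0 \<le> liminf (\<lambda>n. ereal (nu_CV n w))"
    proof (rule criterion[OF min_CV[OF _ elim(2)]])
      show "real n * ln (\<kappa> * \<rho> n \<nu>) \<le> ell_CV ?K ?f (?xs n) \<nu>" if "n \<ge> 2" "\<nu> \<in> ?\<Theta>" for n \<nu>
        using ell_CV_ge[of "?xs n" "\<kappa> * \<rho> n \<nu>" ?K \<nu> ?f, OF dist co(2,1)[OF that] matern_commute] by simp
      fix n B C0
      assume n: "n \<ge> 2" and B: "B \<subseteq> set (?xs n)" "predicts ?k (set (?xs n)) B (C0 * \<rho> n \<nu>\<^sub>0)" and C0: "C0 > 0"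
      have v: "C0 * \<rho> n \<nu>\<^sub>0 > 0" using C0 \<rho>(1)[OF n] by simp
      have ratio: "C0 * \<rho> n \<nu>\<^sub>0 / (\<kappa> * \<rho> n \<nu>\<^sub>0) = C0 / \<kappa>" using \<rho>(1)[OF n, of \<nu>\<^sub>0] by simp
      have "C0 / \<kappa> * data_fit ?k ?f (?xs n) \<le> (1 + C0 / \<kappa>) * (real n * (4 + b))"
        using C0 \<kappa>(1) by (intro mult_mono fit[OF n] fit_nonneg[OF n]) auto
      moreover have "ell_CV ?K ?f (?xs n) \<nu>\<^sub>0 \<le> C0 / \<kappa> * data_fit ?k ?f (?xs n) + real (card B) * (12 * ln (real n) + b)
          + real (card B) * ln k0 + (real n - real (card B)) * ln (C0 * \<rho> n \<nu>\<^sub>0)"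
        using ell_CV_le[of "?xs n" "\<kappa> * \<rho> n \<nu>\<^sub>0" ?K \<nu>\<^sub>0 B "C0 * \<rho> n \<nu>\<^sub>0" k0 ?f "12 * ln (real n) + b",
            OF dist co(2,1)[OF n \<nu>0(1)] matern_commute B k0_le k0(1) v loo[OF n]]
        unfolding ratio by simp
      ultimately show "ell_CV ?K ?f (?xs n) \<nu>\<^sub>0 \<le> U n B C0" unfolding U_def by linarith
    qed
    \<comment> \<open>Both criteria reached \<open>\<nu>\<^sub>0\<close> itself; for cross
      validation this is weakened to the claim.\<close>
    moreover have "ereal (\<nu>\<^sub>0 - ?d / 2) \<le> ereal \<nu>\<^sub>0" by simp
    ultimately show ?case using order_trans by blast
  qed
qed

end
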